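(* Let $(\Pi,\pi):A\to\widetilde A$ be a Lie algebroid epimorphism. Assume that $(P,N)$ is a Poisson-Nijenhuis structure on $A$ such that $P$ and $N$ are $\Pi$-projectable. Then $(\widetilde P,\widetilde N)$ is a Poisson-Nijenhuis structure on $\widetilde A$.
   Context: A Lie algebroid $(A,[\cdot,\cdot]_A,\rho_A)$ over $M$ is a vector bundle $A\to M$ with an anchor $\rho_A:A\to TM$ and a Lie bracket $[\cdot,\cdot]_A$ on $\Gamma(A)$ with $[X,fY]_A=f[X,Y]_A+\rho_A(X)(f)Y$. $d^A$ is its differential, $\mathcal L^A_X=i_Xd^A+d^Ai_X$, and $[\cdot,\cdot]_A$ also denotes the Schouten bracket on $\Gamma(\wedge^\bullet A)$. For $P\in\Gamma(\wedge^2A)$, $P^\sharp\alpha=i_\alpha P$, i.e. $\beta(P^\sharp\alpha)=P(\alpha,\beta)$; $P$ is a Poisson structure on $A$ if $[P,P]_A=0$; put $[\alpha,\beta]_P=\mathcal L^A_{P^\sharp\alpha}\beta-\mathcal L^A_{P^\sharp\beta}\alpha-d^A(P(\alpha,\beta))$. A bundle map $N:A\to A$ over the identity is a Nijenhuis operator if $[NX,NY]_A=N([NX,Y]_A+[X,NY]_A-N[X,Y]_A)$ for all $X,Y\in\Gamma(A)$. It is compatible with $P$ if $N\circ P^\sharp=P^\sharp\circ N^*$ and $[\alpha,\beta]_{NP}=[N^*\alpha,\beta]_P+[\alpha,N^*\beta]_P-N^*[\alpha,\beta]_P$ for all $\alpha,\beta\in\Gamma(A^* )$, where $(NP)^\sharp=N\circ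 P^\sharp$ and $[\cdot,\cdot]_{NP}$ is given by the formula for $[\cdot,\cdot]_P$ with $NP$ in place of $P$. A Poisson-Nijenhuis structure on $A$ is a pair $(P,N)$ of a Poisson structure $P$ and a Nijenhuis operator $N$ compatible with $P$. Let $A\to M$ and $\widetilde A\to\widetilde M$ be Lie algebroids. A vector bundle morphism $\Pi:A\to\widetilde A$ over $\pi:M\to\widetilde M$ is a Lie algebroid morphism if $d^A(\Pi^*\widetilde\alpha)=\Pi^*(d^{\widetilde A}\widetilde\alpha)$ for all $\widetilde\alpha\in\Gamma(\wedge^k\widetilde A^* )$ and all $k$, where $(\Pi^*\widetilde\alpha)(x)(a_1,\dots,a_k)=\widetilde\alpha(\pi(x))(\Pi(a_1),\dots,\Pi(a_k))$. It is a Lie algebroid epimorphism if moreover $\pi$ is a surjective submersion and each $\Pi_x:A_x\to\widetilde A_{\pi(x)}$ is surjective. A section $X\in\Gamma(A)$ is $\Pi$-projectable if there is $\widetilde X\in\Gamma(\widetilde A)$ with $\Pi\circ X=\widetilde X\circ\pi$; $\Gamma_p(A)$ is the space of $\Pi$-projectable sections. $P\in\Gamma(\wedge^2A)$ is $\Pi$-projectable if $P^\sharp(\Pi^*\widetilde\alpha)\in\Gamma_p(A)$ for each $\widetilde\alpha\in\Gamma(\widetilde A^* )$; then $\widetilde P\in\Gamma(\wedge^2\widetilde A)$ is characterized by $(\widetilde P^\sharp\widetilde\alpha)\circ\pi=\Pi\circ P^\sharp(\Pi^*\widetilde\alpha)$ for all $\widetilde\alpha\in\Gamma(\widetilde A^*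 )$. A Nijenhuis operator $N$ on $A$ is $\Pi$-projectable if $N(\Gamma_p(A))\subseteq\Gamma_p(A)$ and $N(\Gamma(\ker\Pi))\subseteq\Gamma(\ker\Pi)$; then $\widetilde N:\widetilde A\to\widetilde A$ is defined by $(\widetilde N\widetilde X)\circ\pi=\Pi\circ(NX)$ for $\widetilde X\in\Gamma(\widetilde A)$, where $X\in\Gamma_p(A)$ is any section with $\Pi\circ X=\widetilde X\circ\pi$. *)

theory Defs
  imports
    "HOL-Analysis.Analysis"
    "HOL-Combinatorics.Permutations"
    "HOL-Library.Function_Algebras"
begin

text \<open>
  Covectors, multivectors and tangent vectors are represented by real-valued functions, so that
  function spaces have to be real vector spaces (with pointwise operations) themselves.
\<close>

instantiation "fun" :: (type, real_vector) real_vector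
begin

definition scaleR_fun :: "real \<Rightarrow> ('a \<Rightarrow> 'b) \<Rightarrow> 'a \<Rightarrow> 'b"
  where "scaleR_fun c f = (\<lambda>x. c *\<^sub>R f x)"

instance
  by standard (simp_all add: scaleR_fun_def plus_fun_def fun_eq_iff algebra_simps)

end


subsection \<open>Smooth manifolds\<close>

text \<open>For open \<open>S\<close> in a finite-dimensional space this is \<open>C\<^sup>k\<close> in the usual sense: all iterated
  directional derivatives up to order \<open>k\<close> exist and are continuous.\<close>

primrec Ck_on :: "nat \<Rightarrow> 'a::real_normed_vector set \<Rightarrow> ('a \<Rightarrow> 'b::real_normed_vector) \<Rightarrow> bool" where
  "Ck_on 0 S f \<longleftrightarrow> continuous_on S f"
| "Ck_on (Suc k) S f \<longleftrightarrow> (\<forall>x\<in>S. f differentiable (at x)) \<and>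
     (\<forall>v. Ck_on k S (\<lambda>x. frechet_derivative f (at x) v))"

definition smooth_on :: "'a::real_normed_vector set \<Rightarrow> ('a \<Rightarrow> 'b::real_normed_vector) \<Rightarrow> bool"
  where "smooth_on S f \<longleftrightarrow> (\<forall>k. Ck_on k S f)"

definition basis_of :: "'v::real_vector set \<Rightarrow> nat \<Rightarrow> (nat \<Rightarrow> 'v) \<Rightarrow> bool"
  where "basis_of V n b \<longleftrightarrow>
    inj_on b {..<n} \<and> independent (b ` {..<n}) \<and> span (b ` {..<n}) = V"

text \<open>
  The points of a manifold are all elements of a type \<open>'m\<close> whose topology is Hausdorff and second
  countable. Charts take values in a finite-dimensional normed space \<open>'e\<close>; unlike
  \<^class>\<open>euclidean_space\<close>, this does not exclude manifolds of dimension zero.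
\<close>

type_synonym ('m, 'e) atlas = "('m set \<times> ('m \<Rightarrow> 'e)) set"

definition smooth_manifold ::
    "('m::{t2_space,second_countable_topology}, 'e::real_normed_vector) atlas \<Rightarrow> bool"
  where "smooth_manifold M \<longleftrightarrow>
    (\<exists>B::'e set. finite B \<and> span B = UNIV) \<and>
    (\<Union>(U, \<phi>)\<in>M. U) = UNIV \<and>
    (\<forall>(U, \<phi>)\<in>M. open U \<and> open (\<phi> ` U) \<and> inj_on \<phi> U \<and> homeomorphism U (\<phi> ` U) \<phi> (inv_into U \<phi>)) \<and>
    (\<forall>(U, \<phi>)\<in>M. \<forall>(V, \<psi>)\<in>M. smooth_on (\<phi> ` (U \<inter> V)) (\<psi> \<circ> inv_into U \<phi>))"

definition smooth_fun_on ::
    "('m::topological_space, 'e::real_normed_vector) atlas \<Rightarrow> 'm set \<Rightarrow> ('m \<Rightarrow> real) \<Rightarrow> bool"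
  where "smooth_fun_on M W f \<longleftrightarrow> (\<forall>(U, \<phi>)\<in>M. smooth_on (\<phi> ` (U \<inter> W)) (f \<circ> inv_into U \<phi>))"

definition smooth_functions ::
    "('m::topological_space, 'e::real_normed_vector) atlas \<Rightarrow> ('m \<Rightarrow> real) set"
  where "smooth_functions M = {f. smooth_fun_on M UNIV f}"

definition smooth_map ::
    "('m::topological_space, 'e::real_normed_vector) atlas \<Rightarrow>
     ('n::topological_space, 'f::real_normed_vector) atlas \<Rightarrow> ('m \<Rightarrow> 'n) \<Rightarrow> bool"
  where "smooth_map M N f \<longleftrightarrow> continuous_on UNIV f \<and>
    (\<forall>(U, \<phi>)\<in>M. \<forall>(V, \<psi>)\<in>N. smooth_on (\<phi> ` (U \<inter> f -` V)) (\<psi> \<circ> f \<circ> inv_into U \<phi>))"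

text \<open>Tangent vectors are point derivations of the algebra of smooth functions, extended by \<open>0\<close> to
  functions that are not smooth.\<close>

definition tangent_space ::
    "('m::topological_space, 'e::real_normed_vector) atlas \<Rightarrow> 'm \<Rightarrow> (('m \<Rightarrow> real) \<Rightarrow> real) set"
  where "tangent_space M x = {D.
    (\<forall>f\<in>smooth_functions M. \<forall>g\<in>smooth_functions M.
       D (\<lambda>y. f y + g y) = D f + D g \<and> D (\<lambda>y. f y * g y) = D f * g x + f x * D g) \<and>
    (\<forall>c. \<forall>f\<in>smooth_functions M. D (\<lambda>y. c * f y) = c * D f) \<and>
    (\<forall>f. f \<notin> smooth_functions M \<longrightarrow> D f = 0)}"

definition tangent_map ::
    "('n::topological_space, 'f::real_normed_vector) atlas \<Rightarrow> ('m \<Rightarrow> 'n) \<Rightarrow>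
     (('m \<Rightarrow> real) \<Rightarrow> real) \<Rightarrow> ('n \<Rightarrow> real) \<Rightarrow> real"
  where "tangent_map N f D = (\<lambda>g. if g \<in> smooth_functions N then D (g \<circ> f) else 0)"

definition submersion ::
    "('m::topological_space, 'e::real_normed_vector) atlas \<Rightarrow>
     ('n::topological_space, 'f::real_normed_vector) atlas \<Rightarrow> ('m \<Rightarrow> 'n) \<Rightarrow> bool"
  where "submersion M N f \<longleftrightarrow> smooth_map M N f \<and>
    (\<forall>x. tangent_map N f ` tangent_space M x = tangent_space N (f x))"


subsection \<open>Vector bundles\<close>

text \<open>
  The fibres are linear subspaces of one ambient real vector space \<open>'v\<close>, which carries no further
  structure (any family of vector spaces embeds into its direct sum). Local trivialisations are
  given as local frames. Maps defined on fibres are extended by \<open>0\<close>.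
\<close>

record ('m, 'e, 'v) vbundle =
  base :: "('m, 'e) atlas"
  bdl_rank :: nat
  fibre :: "'m \<Rightarrow> 'v set"
  frames :: "('m set \<times> (nat \<Rightarrow> 'm \<Rightarrow> 'v)) set"

definition smooth_comb ::
    "('m::topological_space, 'e::real_normed_vector) atlas \<Rightarrow> 'm set \<Rightarrow> nat \<Rightarrow>
     (nat \<Rightarrow> 'm \<Rightarrow> 'v::real_vector) \<Rightarrow> ('m \<Rightarrow> 'v) \<Rightarrow> bool"
  where "smooth_comb M W n b s \<longleftrightarrow>
    (\<exists>c. (\<forall>i<n. smooth_fun_on M W (c i)) \<and> (\<forall>x\<in>W. s x = (\<Sum>i<n. c i x *\<^sub>R b i x)))"

definition vector_bundle ::
    "('m::{t2_space,second_countable_topology}, 'e::real_normed_vector, 'v::real_vector, 'z) vbundle_scheme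
     \<Rightarrow> bool"
  where "vector_bundle E \<longleftrightarrow>
    smooth_manifold (base E) \<and>
    (\<Union>(U, e)\<in>frames E. U) = UNIV \<and>
    (\<forall>(U, e)\<in>frames E. open U \<and> (\<forall>x\<in>U. basis_of (fibre E x) (bdl_rank E) (\<lambda>i. e i x))) \<and>
    (\<forall>(U, e)\<in>frames E. \<forall>(V, b)\<in>frames E. \<forall>i<bdl_rank E.
       smooth_comb (base E) (U \<inter> V) (bdl_rank E) e (b i))"

definition sections ::
    "('m::topological_space, 'e::real_normed_vector, 'v::real_vector, 'z) vbundle_scheme \<Rightarrow>
     ('m \<Rightarrow> 'v) set"
  where "sections E = {s. (\<forall>x. s x \<in> fibre E x) \<and>
    (\<forall>(U, e)\<in>frames E. smooth_comb (base E) U (bdl_rank E) e s)}"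

definition bundle_morphism ::
    "('m::topological_space, 'e::real_normed_vector, 'v::real_vector, 'y) vbundle_scheme \<Rightarrow>
     ('n::topological_space, 'f::real_normed_vector, 'w::real_vector, 'z) vbundle_scheme \<Rightarrow>
     ('m \<Rightarrow> 'v \<Rightarrow> 'w) \<Rightarrow> ('m \<Rightarrow> 'n) \<Rightarrow> bool"
  where "bundle_morphism E F \<Phi> f \<longleftrightarrow>
    smooth_map (base E) (base F) f \<and>
    (\<forall>x. (\<forall>v\<in>fibre E x. \<Phi> x v \<in> fibre F (f x)) \<and>
         (\<forall>v\<in>fibre E x. \<forall>w\<in>fibre E x. \<forall>a b.
            \<Phi> x (a *\<^sub>R v + b *\<^sub>R w) = a *\<^sub>R \<Phi> x v + b *\<^sub>R \<Phi> x w) \<and>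
         (\<forall>v. v \<notin> fibre E x \<longrightarrow> \<Phi> x v = 0)) \<and>
    (\<forall>(U, e)\<in>frames E. \<forall>(V, b)\<in>frames F. \<forall>i<bdl_rank E.
       smooth_comb (base E) (U \<inter> f -` V) (bdl_rank F) (\<lambda>j x. b j (f x)) (\<lambda>x. \<Phi> x (e i x)))"

text \<open>The frames of the tangent bundle consist of the directional derivatives, read in a chart,
  along the vectors of a basis of the model space.\<close>

definition tangent_bundle ::
    "('m::topological_space, 'e::real_normed_vector) atlas \<Rightarrow>
     ('m, 'e, ('m \<Rightarrow> real) \<Rightarrow> real) vbundle"
  where "tangent_bundle M = \<lparr>
    base = M,
    bdl_rank = dim (UNIV :: 'e set),
    fibre = tangent_space M,
    frames = {(U, \<lambda>i x f. if f \<in> smooth_functions M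
                       then frechet_derivative (f \<circ> inv_into U \<phi>) (at (\<phi> x)) (b i) else 0)
               | U \<phi> b. (U, \<phi>) \<in> M \<and> basis_of UNIV (dim (UNIV :: 'e set)) b}\<rparr>"


subsection \<open>Forms and multisections\<close>

text \<open>A \<open>k\<close>-form on a vector space \<open>V\<close> is a function of the list of its \<open>k\<close> arguments, extended by
  \<open>0\<close> to all other lists. In particular \<open>alt_forms 1 V\<close> is the dual space of \<open>V\<close>, and a function \<open>f\<close>
  corresponds to the \<open>0\<close>-form with value \<open>f x\<close> on the empty list.\<close>

definition alt_forms :: "nat \<Rightarrow> 'v::real_vector set \<Rightarrow> ('v list \<Rightarrow> real) set"
  where "alt_forms k V = {\<omega>.
    (\<forall>vs. \<not> (length vs = k \<and> set vs \<subseteq> V) \<longrightarrow> \<omega> vs = 0) \<and>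
    (\<forall>us ws. \<forall>v\<in>V. \<forall>w\<in>V. \<forall>a b. length us + 1 + length ws = k \<and> set us \<subseteq> V \<and> set ws \<subseteq> V \<longrightarrow>
       \<omega> (us @ (a *\<^sub>R v + b *\<^sub>R w) # ws) = a * \<omega> (us @ v # ws) + b * \<omega> (us @ w # ws)) \<and>
    (\<forall>vs. \<not> distinct vs \<longrightarrow> \<omega> vs = 0)}"

text \<open>The space \<open>\<Gamma>(\<Lambda>\<^sup>k E\<^sup>*)\<close>.\<close>

definition kforms ::
    "nat \<Rightarrow> ('m::topological_space, 'e::real_normed_vector, 'v::real_vector, 'z) vbundle_scheme \<Rightarrow>
     ('m \<Rightarrow> 'v list \<Rightarrow> real) set"
  where "kforms k E = {\<omega>. (\<forall>x. \<omega> x \<in> alt_forms k (fibre E x)) \<and>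
    (\<forall>(U, e)\<in>frames E. \<forall>js. length js = k \<and> set js \<subseteq> {..<bdl_rank E} \<longrightarrow>
       smooth_fun_on (base E) U (\<lambda>x. \<omega> x (map (\<lambda>j. e j x) js)))}"

definition dual_bundle ::
    "('m::topological_space, 'e::real_normed_vector, 'v::real_vector, 'z) vbundle_scheme \<Rightarrow>
     ('m, 'e, 'v list \<Rightarrow> real) vbundle"
  where "dual_bundle E = \<lparr>
    base = base E,
    bdl_rank = bdl_rank E,
    fibre = (\<lambda>x. alt_forms 1 (fibre E x)),
    frames = {(U, \<epsilon>). \<exists>e. (U, e) \<in> frames E \<and>
      (\<forall>x\<in>U. \<forall>i<bdl_rank E. \<epsilon> i x \<in> alt_forms 1 (fibre E x) \<and>
         (\<forall>j<bdl_rank E. \<epsilon> i x [e j x] = (if i = j then 1 else 0)))}\<rparr>"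

text \<open>\<open>\<Gamma>(\<Lambda>\<^sup>k E)\<close>, a multivector being an alternating form on the dual space.\<close>

definition multisections ::
    "nat \<Rightarrow> ('m::topological_space, 'e::real_normed_vector, 'v::real_vector, 'z) vbundle_scheme \<Rightarrow>
     ('m \<Rightarrow> ('v list \<Rightarrow> real) list \<Rightarrow> real) set"
  where "multisections k E = kforms k (dual_bundle E)"

text \<open>\<open>\<Phi>\<^sup>*\<omega>\<close> for a bundle map \<open>\<Phi>\<close> over \<open>\<pi>\<close>.\<close>

definition pullback ::
    "('m, 'e, 'v, 'z) vbundle_scheme \<Rightarrow> ('m \<Rightarrow> 'v \<Rightarrow> 'w) \<Rightarrow> ('m \<Rightarrow> 'n) \<Rightarrow>
     ('n \<Rightarrow> 'w list \<Rightarrow> real) \<Rightarrow> 'm \<Rightarrow> 'v list \<Rightarrow> real"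
  where "pullback E \<Phi> \<pi> \<omega> = (\<lambda>x vs. if set vs \<subseteq> fibre E x then \<omega> (\<pi> x) (map (\<Phi> x) vs) else 0)"

definition app :: "('m \<Rightarrow> 'v \<Rightarrow> 'v) \<Rightarrow> ('m \<Rightarrow> 'v) \<Rightarrow> 'm \<Rightarrow> 'v"
  where "app N X = (\<lambda>x. N x (X x))"

text \<open>The transpose \<open>N\<^sup>*\<close>, acting on \<open>\<Gamma>(E\<^sup>*)\<close>.\<close>

definition dual_map ::
    "('m, 'e, 'v, 'z) vbundle_scheme \<Rightarrow> ('m \<Rightarrow> 'v \<Rightarrow> 'v) \<Rightarrow>
     ('m \<Rightarrow> 'v list \<Rightarrow> real) \<Rightarrow> 'm \<Rightarrow> 'v list \<Rightarrow> real"
  where "dual_map E N = pullback E N id"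

text \<open>\<open>P\<^sup>\<sharp>\<alpha>\<close>, determined by \<open>\<beta>(P\<^sup>\<sharp>\<alpha>) = P(\<alpha>, \<beta>)\<close>.\<close>

definition sharp ::
    "('m, 'e, 'v::real_vector, 'z) vbundle_scheme \<Rightarrow>
     ('m \<Rightarrow> ('v list \<Rightarrow> real) list \<Rightarrow> real) \<Rightarrow> ('m \<Rightarrow> 'v list \<Rightarrow> real) \<Rightarrow> 'm \<Rightarrow> 'v"
  where "sharp E P \<alpha> = (\<lambda>x. THE v. v \<in> fibre E x \<and>
    (\<forall>\<beta>\<in>alt_forms 1 (fibre E x). \<beta> [v] = P x [\<alpha> x, \<beta>]))"


subsection \<open>Lie algebroids\<close>

record ('m, 'e, 'v) algebroid = "('m, 'e, 'v) vbundle" +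
  anchor :: "'m \<Rightarrow> 'v \<Rightarrow> ('m \<Rightarrow> real) \<Rightarrow> real"
  bracket :: "('m \<Rightarrow> 'v) \<Rightarrow> ('m \<Rightarrow> 'v) \<Rightarrow> 'm \<Rightarrow> 'v"

definition lie_algebroid ::
    "('m::{t2_space,second_countable_topology}, 'e::real_normed_vector, 'v::real_vector) algebroid
     \<Rightarrow> bool"
  where "lie_algebroid A \<longleftrightarrow>
    vector_bundle A \<and>
    bundle_morphism A (tangent_bundle (base A)) (anchor A) id \<and>
    (\<forall>X\<in>sections A. \<forall>Y\<in>sections A. bracket A X Y \<in> sections A) \<and>
    (\<forall>X\<in>sections A. \<forall>Y\<in>sections A. \<forall>Z\<in>sections A. \<forall>a b.
       bracket A (a *\<^sub>R X + b *\<^sub>R Y) Z = a *\<^sub>R bracket A X Z + b *\<^sub>R bracket A Y Z) \<and>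
    (\<forall>X\<in>sections A. \<forall>Y\<in>sections A. bracket A X Y = - bracket A Y X) \<and>
    (\<forall>X\<in>sections A. \<forall>Y\<in>sections A. \<forall>Z\<in>sections A.
       bracket A X (bracket A Y Z) + bracket A Y (bracket A Z X) + bracket A Z (bracket A X Y) = 0) \<and>
    (\<forall>X\<in>sections A. \<forall>Y\<in>sections A. \<forall>f\<in>smooth_functions (base A).
       bracket A X (\<lambda>x. f x *\<^sub>R Y x) =
         (\<lambda>x. f x *\<^sub>R bracket A X Y x + anchor A x (X x) f *\<^sub>R Y x))"

definition del :: "nat \<Rightarrow> 'a list \<Rightarrow> 'a list"
  where "del i xs = take i xs @ drop (Suc i) xs"

text \<open>The right-hand side of the Koszul formula for \<open>(d\<omega>)(X\<^sub>0, \<dots>, X\<^sub>k)\<close>. Its value at \<open>x\<close> depends on the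
  values of the sections at \<open>x\<close> only, which gives \<open>d\<omega>\<close> pointwise.\<close>

definition koszul ::
    "('m, 'e, 'v) algebroid \<Rightarrow> ('m \<Rightarrow> 'v list \<Rightarrow> real) \<Rightarrow> ('m \<Rightarrow> 'v) list \<Rightarrow> 'm \<Rightarrow> real"
  where "koszul A \<omega> Xs x =
    (\<Sum>i<length Xs. (- 1) ^ i *
       anchor A x ((Xs ! i) x) (\<lambda>y. \<omega> y (map (\<lambda>X. X y) (del i Xs)))) +
    (\<Sum>j<length Xs. \<Sum>i<j. (- 1) ^ (i + j) *
       \<omega> x (bracket A (Xs ! i) (Xs ! j) x # map (\<lambda>X. X x) (del i (del j Xs))))"

definition differential ::
    "('m::topological_space, 'e::real_normed_vector, 'v::real_vector) algebroid \<Rightarrow>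
     ('m \<Rightarrow> 'v list \<Rightarrow> real) \<Rightarrow> 'm \<Rightarrow> 'v list \<Rightarrow> real"
  where "differential A \<omega> = (\<lambda>x vs. if set vs \<subseteq> fibre A x
    then THE c. \<forall>Xs. set Xs \<subseteq> sections A \<and> map (\<lambda>X. X x) Xs = vs \<longrightarrow> c = koszul A \<omega> Xs x
    else 0)"

definition insertion :: "('m \<Rightarrow> 'v) \<Rightarrow> ('m \<Rightarrow> 'v list \<Rightarrow> real) \<Rightarrow> 'm \<Rightarrow> 'v list \<Rightarrow> real"
  where "insertion X \<omega> = (\<lambda>x vs. \<omega> x (X x # vs))"

definition lie_derivative ::
    "('m::topological_space, 'e::real_normed_vector, 'v::real_vector) algebroid \<Rightarrow>
     ('m \<Rightarrow> 'v) \<Rightarrow> ('m \<Rightarrow> 'v list \<Rightarrow> real) \<Rightarrow> 'm \<Rightarrow> 'v list \<Rightarrow> real"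
  where "lie_derivative A X \<omega> =
    insertion X (differential A \<omega>) + differential A (insertion X \<omega>)"

text \<open>\<open>v\<^sub>1 \<and> \<dots> \<and> v\<^sub>p\<close>, with value \<open>det (\<alpha>\<^sub>i(v\<^sub>j))\<close> on the covectors \<open>\<alpha>\<^sub>1, \<dots>, \<alpha>\<^sub>p\<close>.\<close>

definition wedge ::
    "'v::real_vector set \<Rightarrow> 'v list \<Rightarrow> ('v list \<Rightarrow> real) list \<Rightarrow> real"
  where "wedge V vs = (\<lambda>\<alpha>s. if length \<alpha>s = length vs \<and> set \<alpha>s \<subseteq> alt_forms 1 V
    then \<Sum>\<sigma> | \<sigma> permutes {..<length vs}.
           of_int (sign \<sigma>) * (\<Prod>i<length vs. (\<alpha>s ! i) [vs ! \<sigma> i])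
    else 0)"

text \<open>\<open>P\<close> is, near \<open>x\<close>, the sum of the decomposables \<open>X\<^sub>1 \<and> \<dots> \<and> X\<^sub>p\<close> listed in \<open>D\<close>.\<close>

definition decomposes ::
    "('m::topological_space, 'e::real_normed_vector, 'v::real_vector) algebroid \<Rightarrow> nat \<Rightarrow>
     ('m \<Rightarrow> ('v list \<Rightarrow> real) list \<Rightarrow> real) \<Rightarrow> ('m \<Rightarrow> 'v) list list \<Rightarrow> 'm \<Rightarrow> bool"
  where "decomposes A p P D x \<longleftrightarrow>
    (\<forall>Xs\<in>set D. length Xs = p \<and> set Xs \<subseteq> sections A) \<and>
    (\<exists>W. open W \<and> x \<in> W \<and>
       (\<forall>y\<in>W. P y = (\<Sum>Xs\<leftarrow>D. wedge (fibre A y) (map (\<lambda>X. X y) Xs))))"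

text \<open>
  The Schouten bracket of multisections of degrees \<open>p, q \<ge> 1\<close> is the local, biadditive operation with
  \<open>[X\<^sub>1 \<and> \<dots> \<and> X\<^sub>p, Y\<^sub>1 \<and> \<dots> \<and> Y\<^sub>q] = \<Sum>\<^sub>i\<^sub>,\<^sub>j (-1)\<^sup>i\<^sup>+\<^sup>j [X\<^sub>i, Y\<^sub>j] \<and> X\<^sub>1 \<and> \<dots> \<and> X\<^sub>p \<and> Y\<^sub>1 \<and> \<dots> \<and> Y\<^sub>q\<close>,
  where \<open>X\<^sub>i\<close> and \<open>Y\<^sub>j\<close> are omitted after the bracket. The result does not depend on the decompositions.
\<close>

definition schouten_bracket ::
    "('m::topological_space, 'e::real_normed_vector, 'v::real_vector) algebroid \<Rightarrow>
     nat \<Rightarrow> ('m \<Rightarrow> ('v list \<Rightarrow> real) list \<Rightarrow> real) \<Rightarrow>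
     nat \<Rightarrow> ('m \<Rightarrow> ('v list \<Rightarrow> real) list \<Rightarrow> real) \<Rightarrow>
     'm \<Rightarrow> ('v list \<Rightarrow> real) list \<Rightarrow> real"
  where "schouten_bracket A p P q Q = (\<lambda>x. THE R. \<forall>C D. decomposes A p P C x \<and> decomposes A q Q D x \<longrightarrow>
    R = (\<Sum>Xs\<leftarrow>C. \<Sum>Ys\<leftarrow>D. \<Sum>i<p. \<Sum>j<q. (- 1) ^ (i + j) *\<^sub>R
          wedge (fibre A x)
            (map (\<lambda>X. X x) (bracket A (Xs ! i) (Ys ! j) # del i Xs @ del j Ys))))"


subsection \<open>Poisson-Nijenhuis structures\<close>

definition poisson ::
    "('m::topological_space, 'e::real_normed_vector, 'v::real_vector) algebroid \<Rightarrow>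
     ('m \<Rightarrow> ('v list \<Rightarrow> real) list \<Rightarrow> real) \<Rightarrow> bool"
  where "poisson A P \<longleftrightarrow> P \<in> multisections 2 A \<and> schouten_bracket A 2 P 2 P = 0"

definition form_bracket ::
    "('m::topological_space, 'e::real_normed_vector, 'v::real_vector) algebroid \<Rightarrow>
     ('m \<Rightarrow> ('v list \<Rightarrow> real) list \<Rightarrow> real) \<Rightarrow>
     ('m \<Rightarrow> 'v list \<Rightarrow> real) \<Rightarrow> ('m \<Rightarrow> 'v list \<Rightarrow> real) \<Rightarrow> 'm \<Rightarrow> 'v list \<Rightarrow> real"
  where "form_bracket A P \<alpha> \<beta> =
    lie_derivative A (sharp A P \<alpha>) \<beta> - lie_derivative A (sharp A P \<beta>) \<alpha>
    - differential A (\<lambda>x vs. if vs = [] then P x [\<alpha> x, \<beta> x] else 0)"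

definition nijenhuis ::
    "('m::topological_space, 'e::real_normed_vector, 'v::real_vector) algebroid \<Rightarrow>
     ('m \<Rightarrow> 'v \<Rightarrow> 'v) \<Rightarrow> bool"
  where "nijenhuis A N \<longleftrightarrow> bundle_morphism A A N id \<and>
    (\<forall>X\<in>sections A. \<forall>Y\<in>sections A.
       bracket A (app N X) (app N Y) =
       app N (bracket A (app N X) Y + bracket A X (app N Y) - app N (bracket A X Y)))"

text \<open>The tensor \<open>NP\<close>, i.e. \<open>NP(\<alpha>, \<beta>) = \<beta>(N P\<^sup>\<sharp>\<alpha>)\<close>. It is a bivector when \<open>N \<circ> P\<^sup>\<sharp> = P\<^sup>\<sharp> \<circ> N\<^sup>*\<close>.\<close>

definition comp_bivector ::
    "('m, 'e, 'v::real_vector) algebroid \<Rightarrow> ('m \<Rightarrow> 'v \<Rightarrow> 'v) \<Rightarrow>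
     ('m \<Rightarrow> ('v list \<Rightarrow> real) list \<Rightarrow> real) \<Rightarrow> 'm \<Rightarrow> ('v list \<Rightarrow> real) list \<Rightarrow> real"
  where "comp_bivector A N P = (\<lambda>x \<alpha>s. if length \<alpha>s = 2 \<and> set \<alpha>s \<subseteq> alt_forms 1 (fibre A x)
    then (\<alpha>s ! 1) [N x (sharp A P (\<lambda>_. \<alpha>s ! 0) x)] else 0)"

definition compatible ::
    "('m::topological_space, 'e::real_normed_vector, 'v::real_vector) algebroid \<Rightarrow>
     ('m \<Rightarrow> ('v list \<Rightarrow> real) list \<Rightarrow> real) \<Rightarrow> ('m \<Rightarrow> 'v \<Rightarrow> 'v) \<Rightarrow> bool"
  where "compatible A P N \<longleftrightarrow>
    (\<forall>\<alpha>\<in>kforms 1 A. app N (sharp A P \<alpha>) = sharp A P (dual_map A N \<alpha>)) \<and>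
    (\<forall>\<alpha>\<in>kforms 1 A. \<forall>\<beta>\<in>kforms 1 A.
       form_bracket A (comp_bivector A N P) \<alpha> \<beta> =
       form_bracket A P (dual_map A N \<alpha>) \<beta> + form_bracket A P \<alpha> (dual_map A N \<beta>)
       - dual_map A N (form_bracket A P \<alpha> \<beta>))"

definition poisson_nijenhuis ::
    "('m::topological_space, 'e::real_normed_vector, 'v::real_vector) algebroid \<Rightarrow>
     ('m \<Rightarrow> ('v list \<Rightarrow> real) list \<Rightarrow> real) \<Rightarrow> ('m \<Rightarrow> 'v \<Rightarrow> 'v) \<Rightarrow> bool"
  where "poisson_nijenhuis A P N \<longleftrightarrow> poisson A P \<and> nijenhuis A N \<and> compatible A P N"


subsection \<open>Lie algebroid epimorphisms and projectability\<close>

definition algebroid_morphism ::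
    "('m::topological_space, 'e::real_normed_vector, 'v::real_vector) algebroid \<Rightarrow>
     ('n::topological_space, 'f::real_normed_vector, 'w::real_vector) algebroid \<Rightarrow>
     ('m \<Rightarrow> 'v \<Rightarrow> 'w) \<Rightarrow> ('m \<Rightarrow> 'n) \<Rightarrow> bool"
  where "algebroid_morphism A B \<Phi> \<pi> \<longleftrightarrow> bundle_morphism A B \<Phi> \<pi> \<and>
    (\<forall>k. \<forall>\<omega>\<in>kforms k B. differential A (pullback A \<Phi> \<pi> \<omega>) = pullback A \<Phi> \<pi> (differential B \<omega>))"

definition algebroid_epimorphism ::
    "('m::topological_space, 'e::real_normed_vector, 'v::real_vector) algebroid \<Rightarrow>
     ('n::topological_space, 'f::real_normed_vector, 'w::real_vector) algebroid \<Rightarrow>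
     ('m \<Rightarrow> 'v \<Rightarrow> 'w) \<Rightarrow> ('m \<Rightarrow> 'n) \<Rightarrow> bool"
  where "algebroid_epimorphism A B \<Phi> \<pi> \<longleftrightarrow> algebroid_morphism A B \<Phi> \<pi> \<and>
    surj \<pi> \<and> submersion (base A) (base B) \<pi> \<and> (\<forall>x. \<Phi> x ` fibre A x = fibre B (\<pi> x))"

text \<open>\<open>\<Phi> \<circ> X = Y \<circ> \<pi>\<close>\<close>

definition related ::
    "('m \<Rightarrow> 'v \<Rightarrow> 'w) \<Rightarrow> ('m \<Rightarrow> 'n) \<Rightarrow> ('m \<Rightarrow> 'v) \<Rightarrow> ('n \<Rightarrow> 'w) \<Rightarrow> bool"
  where "related \<Phi> \<pi> X Y \<longleftrightarrow> (\<forall>x. \<Phi> x (X x) = Y (\<pi> x))"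

definition projectable_sections ::
    "('m::topological_space, 'e::real_normed_vector, 'v::real_vector) algebroid \<Rightarrow>
     ('n::topological_space, 'f::real_normed_vector, 'w::real_vector) algebroid \<Rightarrow>
     ('m \<Rightarrow> 'v \<Rightarrow> 'w) \<Rightarrow> ('m \<Rightarrow> 'n) \<Rightarrow> ('m \<Rightarrow> 'v) set"
  where "projectable_sections A B \<Phi> \<pi> = {X \<in> sections A. \<exists>Y\<in>sections B. related \<Phi> \<pi> X Y}"

definition kernel_sections ::
    "('m::topological_space, 'e::real_normed_vector, 'v::real_vector) algebroid \<Rightarrow>
     ('m \<Rightarrow> 'v \<Rightarrow> 'w::real_vector) \<Rightarrow> ('m \<Rightarrow> 'v) set"
  where "kernel_sections A \<Phi> = {X \<in> sections A. \<forall>x. \<Phi> x (X x) = 0}"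

definition projectable_bivector ::
    "('m::topological_space, 'e::real_normed_vector, 'v::real_vector) algebroid \<Rightarrow>
     ('n::topological_space, 'f::real_normed_vector, 'w::real_vector) algebroid \<Rightarrow>
     ('m \<Rightarrow> 'v \<Rightarrow> 'w) \<Rightarrow> ('m \<Rightarrow> 'n) \<Rightarrow> ('m \<Rightarrow> ('v list \<Rightarrow> real) list \<Rightarrow> real) \<Rightarrow> bool"
  where "projectable_bivector A B \<Phi> \<pi> P \<longleftrightarrow>
    (\<forall>\<alpha>\<in>kforms 1 B. sharp A P (pullback A \<Phi> \<pi> \<alpha>) \<in> projectable_sections A B \<Phi> \<pi>)"

definition projected_bivector ::
    "('m::topological_space, 'e::real_normed_vector, 'v::real_vector) algebroid \<Rightarrow>
     ('n::topological_space, 'f::real_normed_vector, 'w::real_vector) algebroid \<Rightarrow>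
     ('m \<Rightarrow> 'v \<Rightarrow> 'w) \<Rightarrow> ('m \<Rightarrow> 'n) \<Rightarrow> ('m \<Rightarrow> ('v list \<Rightarrow> real) list \<Rightarrow> real) \<Rightarrow>
     'n \<Rightarrow> ('w list \<Rightarrow> real) list \<Rightarrow> real"
  where "projected_bivector A B \<Phi> \<pi> P = (THE Q. Q \<in> multisections 2 B \<and>
    (\<forall>\<alpha>\<in>kforms 1 B. related \<Phi> \<pi> (sharp A P (pullback A \<Phi> \<pi> \<alpha>)) (sharp B Q \<alpha>)))"

definition projectable_endo ::
    "('m::topological_space, 'e::real_normed_vector, 'v::real_vector) algebroid \<Rightarrow>
     ('n::topological_space, 'f::real_normed_vector, 'w::real_vector) algebroid \<Rightarrow>
     ('m \<Rightarrow> 'v \<Rightarrow> 'w) \<Rightarrow> ('m \<Rightarrow> 'n) \<Rightarrow> ('m \<Rightarrow> 'v \<Rightarrow> 'v) \<Rightarrow> bool"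
  where "projectable_endo A B \<Phi> \<pi> N \<longleftrightarrow>
    app N ` projectable_sections A B \<Phi> \<pi> \<subseteq> projectable_sections A B \<Phi> \<pi> \<and>
    app N ` kernel_sections A \<Phi> \<subseteq> kernel_sections A \<Phi>"

definition projected_endo ::
    "('m::topological_space, 'e::real_normed_vector, 'v::real_vector) algebroid \<Rightarrow>
     ('n::topological_space, 'f::real_normed_vector, 'w::real_vector) algebroid \<Rightarrow>
     ('m \<Rightarrow> 'v \<Rightarrow> 'w) \<Rightarrow> ('m \<Rightarrow> 'n) \<Rightarrow> ('m \<Rightarrow> 'v \<Rightarrow> 'v) \<Rightarrow> 'n \<Rightarrow> 'w \<Rightarrow> 'w"
  where "projected_endo A B \<Phi> \<pi> N = (THE L. bundle_morphism B B L id \<and>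
    (\<forall>Y\<in>sections B. \<forall>X\<in>sections A. related \<Phi> \<pi> X Y \<longrightarrow> related \<Phi> \<pi> (app N X) (app L Y)))"

end

theory Submission
  imports Defs
begin

text \<open>
  Every section of \<open>B\<close> lifts to a section of \<open>A\<close>: local lifts exist because \<open>\<Phi>\<close> is fibrewise onto, and they
  are glued by a partition of unity. Hence brackets, the tensors \<open>P\<close> and \<open>N\<close>, and their projections are
  determined by \<open>\<Phi>\<close>-related pairs of sections and by pullbacks of forms. Evaluating
  \<open>d(\<Phi>\<^sup>*\<omega>) = \<Phi>\<^sup>*(d\<omega>)\<close> on functions and on 1-forms shows that anchors and brackets of related sections are
  related. The Nijenhuis identity for \<open>N\<close> therefore descends. The equation \<open>[P, P] = 0\<close> is equivalent to an
  identity between anchors, brackets and the sections \<open>P\<^sup>\<sharp>\<alpha>\<close>, so it descends as well, by testing it on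
  forms \<open>\<Phi>\<^sup>*\<alpha>\<close>. Finally \<open>\<Phi>\<^sup>*\<close> is injective and intertwines the brackets \<open>[\<cdot>, \<cdot>]\<^sub>P\<close>, the brackets
  \<open>[\<cdot>, \<cdot>]\<^sub>N\<^sub>P\<close> and the transposes of \<open>N\<close> with those of the projected structures, which gives compatibility.
\<close>

subsection \<open>Functions of class \<open>C\<^sup>k\<close>\<close>

text \<open>Brackets, projectability and the differential are formulated with global sections, while
  frames, coefficients and decompositions of \<open>P\<close> are only available locally. Germs
  (\<open>smooth_at\<close>, \<open>sec_at\<close>) and bump functions bridge this gap: every germ
  extends to a global object, and derivations and brackets see only germs. The objects given by a
  definite description (the differential, \<open>sharp\<close>, the Schouten bracket, both
  projections) say nothing until existence and uniqueness are shown. For the Schouten bracket,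
  uniqueness over all decompositions holds because the cyclic sum mentions no decomposition. Local
  lifts come from Nakayama's lemma: sections of \<open>A\<close> can be made to hit a frame of
  \<open>B\<close> at one point, and the error has coefficients that vanish there. Both projections
  are defined by choosing a point over each \<open>y\<close>, with no continuity; projectability
  makes the value independent of that point and supplies smoothness. For \<open>N\<close> the choice
  of a preimage vector must not matter either, which requires extending a kernel vector to a kernel
  section.\<close>

lemma Ck_on_cong_imp:
  assumes "open S" "\<And>x. x \<in> S \<Longrightarrow> f x = g x" "Ck_on k S f"
  shows "Ck_on k S g"
  using assms(2,3)
proof (induction k arbitrary: f g)
  case 0
  then show ?case by (auto cong: continuous_on_cong)
next
  case (Suc k)
  have *: "(f has_derivative D) (at x) \<longleftrightarrow> (g has_derivative D) (at x)" if "x \<in> S" for x D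
    using assms(1) Suc.prems(1) that has_derivative_transform_within_open[of f D x UNIV S g]
      has_derivative_transform_within_open[of g D x UNIV S f] by auto
  have d: "g differentiable (at x)" if "x \<in> S" for x
    using * that Suc.prems(2) by (auto simp: differentiable_def)
  have F: "frechet_derivative f (at x) = frechet_derivative g (at x)" if "x \<in> S" for x
    using *[OF that] by (simp add: frechet_derivative_def)
  have "Ck_on k S (\<lambda>x. frechet_derivative g (at x) v)" for v
    by (rule Suc.IH[of "\<lambda>x. frechet_derivative f (at x) v"]) (use Suc.prems F in auto)
  with d show ?case by auto
qed

lemma Ck_on_cong:
  assumes "open S" "\<And>x. x \<in> S \<Longrightarrow> f x = g x"
  shows "Ck_on k S f \<longleftrightarrow> Ck_on k S g"
  using Ck_on_cong_imp[of S f g k] Ck_on_cong_imp[of S g f k] assms by auto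

lemma Ck_on_SucI:
  assumes "open S" "\<And>x. x \<in> S \<Longrightarrow> (f has_derivative f' x) (at x)"
    "\<And>v. Ck_on k S (\<lambda>x. f' x v)"
  shows "Ck_on (Suc k) S f"
proof -
  have "Ck_on k S (\<lambda>x. frechet_derivative f (at x) v)" for v
    using assms(3)[of v] frechet_derivative_at[OF assms(2)]
    by (subst Ck_on_cong[where g = "\<lambda>x. f' x v"]) (auto simp: assms(1))
  then show ?thesis
    using assms(2) by (auto simp: differentiable_def)
qed

lemma Ck_on_SucD:
  assumes "Ck_on (Suc k) S f" "x \<in> S"
  shows "(f has_derivative frechet_derivative f (at x)) (at x)"
  using assms by (auto simp flip: frechet_derivative_works)

lemma Ck_on_subset: "Ck_on k S f \<Longrightarrow> T \<subseteq> S \<Longrightarrow> Ck_on k T f"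
  by (induction k arbitrary: f) (auto intro: continuous_on_subset)

lemma Ck_on_Suc_imp: "Ck_on (Suc k) S f \<Longrightarrow> Ck_on k S f"
proof (induction k arbitrary: f)
  case 0
  then show ?case
    by (auto intro!: continuous_at_imp_continuous_on differentiable_imp_continuous_within)
qed auto

lemma Ck_on_local:
  assumes "\<And>x. x \<in> S \<Longrightarrow> \<exists>T. open T \<and> x \<in> T \<and> Ck_on k T f"
  shows "Ck_on k S f"
  using assms
proof (induction k arbitrary: f)
  case 0
  then show ?case
    by (auto intro!: continuous_at_imp_continuous_on) (metis continuous_on_eq_continuous_at)
next
  case (Suc k)
  have "f differentiable (at x)" if "x \<in> S" for x
    using Suc.prems[OF that] by auto
  moreover have "Ck_on k S (\<lambda>x. frechet_derivative f (at x) v)" for v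
    by (rule Suc.IH) (use Suc.prems in force)
  ultimately show ?case by auto
qed

lemma Ck_on_const: "open S \<Longrightarrow> Ck_on k S (\<lambda>x. c)"
proof (induction k arbitrary: c)
  case (Suc k)
  show ?case by (rule Ck_on_SucI[where f' = "\<lambda>x v. 0"]) (use Suc in auto)
qed auto

lemma Ck_on_bounded_linear:
  assumes "open S" "bounded_linear l" "Ck_on k S f"
  shows "Ck_on k S (\<lambda>x. l (f x))"
  using assms(3)
proof (induction k arbitrary: f)
  case 0
  then show ?case using assms(2)
    by (auto intro: bounded_linear.continuous_on)
next
  case (Suc k)
  show ?case
  proof (rule Ck_on_SucI[OF assms(1)])
    show "((\<lambda>x. l (f x)) has_derivative (\<lambda>v. l (frechet_derivative f (at x) v))) (at x)" if "x \<in> S" for x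
      using bounded_linear.has_derivative[OF assms(2) Ck_on_SucD[OF Suc.prems that]] by simp
    show "Ck_on k S (\<lambda>x. l (frechet_derivative f (at x) v))" for v
      using Suc by auto
  qed
qed

lemma Ck_on_add:
  assumes "open S" "Ck_on k S f" "Ck_on k S g"
  shows "Ck_on k S (\<lambda>x. f x + g x)"
  using assms(2,3)
proof (induction k arbitrary: f g)
  case 0
  then show ?case by (auto intro: continuous_intros)
next
  case (Suc k)
  show ?case
  proof (rule Ck_on_SucI[OF assms(1)])
    show "((\<lambda>x. f x + g x) has_derivative
        (\<lambda>v. frechet_derivative f (at x) v + frechet_derivative g (at x) v)) (at x)" if "x \<in> S" for x
      using has_derivative_add[OF Ck_on_SucD[OF Suc.prems(1) that] Ck_on_SucD[OF Suc.prems(2) that]] by simp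
    show "Ck_on k S (\<lambda>x. frechet_derivative f (at x) v + frechet_derivative g (at x) v)" for v
      using Suc by auto
  qed
qed

lemma Ck_on_mult:
  fixes f g :: "'a::real_normed_vector \<Rightarrow> real"
  assumes "open S" "Ck_on k S f" "Ck_on k S g"
  shows "Ck_on k S (\<lambda>x. f x * g x)"
  using assms(2,3)
proof (induction k arbitrary: f g)
  case 0
  then show ?case by (auto intro: continuous_intros)
next
  case (Suc k)
  show ?case
  proof (rule Ck_on_SucI[OF assms(1)])
    show "((\<lambda>x. f x * g x) has_derivative
        (\<lambda>v. f x * frechet_derivative g (at x) v + frechet_derivative f (at x) v * g x)) (at x)"
      if "x \<in> S" for x
      using has_derivative_mult[OF Ck_on_SucD[OF Suc.prems(1) that] Ck_on_SucD[OF Suc.prems(2) that]] by simp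
    show "Ck_on k S (\<lambda>x. f x * frechet_derivative g (at x) v + frechet_derivative f (at x) v * g x)" for v
    proof -
      have "Ck_on k S f" "Ck_on k S g"
        using Suc.prems by (auto intro: Ck_on_Suc_imp simp del: Ck_on.simps)
      moreover have "Ck_on k S (\<lambda>x. frechet_derivative f (at x) v)"
        "Ck_on k S (\<lambda>x. frechet_derivative g (at x) v)"
        using Suc.prems by simp_all
      ultimately show ?thesis
        by (intro Ck_on_add[OF assms(1)] Suc.IH)
    qed
  qed
qed

lemma Ck_on_sum:
  assumes "open S" "\<And>i. i \<in> I \<Longrightarrow> Ck_on k S (f i)"
  shows "Ck_on k S (\<lambda>x. \<Sum>i\<in>I. f i x)"
  using assms(2)
  by (induction I rule: infinite_finite_induct) (auto intro: Ck_on_add Ck_on_const assms(1))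

lemma Ck_on_inverse:
  fixes f :: "'a::real_normed_vector \<Rightarrow> real"
  assumes "open S" "Ck_on k S f" "\<And>x. x \<in> S \<Longrightarrow> f x \<noteq> 0"
  shows "Ck_on k S (\<lambda>x. inverse (f x))"
  using assms(2)
proof (induction k)
  case 0
  then show ?case using assms(3) by (auto intro: continuous_intros)
next
  case (Suc k)
  show ?case
  proof (rule Ck_on_SucI[OF assms(1)])
    show "((\<lambda>x. inverse (f x)) has_derivative
        (\<lambda>v. (- 1) * (inverse (f x) * frechet_derivative f (at x) v * inverse (f x)))) (at x)"
      if "x \<in> S" for x
      using Deriv.has_derivative_inverse[OF _ Ck_on_SucD[OF Suc.prems that]] assms(3)[OF that] by simp
    show "Ck_on k S (\<lambda>x. (- 1) * (inverse (f x) * frechet_derivative f (at x) v * inverse (f x)))" for v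
    proof -
      have "Ck_on k S (\<lambda>x. inverse (f x))"
        using Suc.IH Ck_on_Suc_imp[OF Suc.prems] by blast
      moreover have "Ck_on k S (\<lambda>x. frechet_derivative f (at x) v)"
        using Suc.prems by simp
      ultimately show ?thesis
        by (intro Ck_on_mult Ck_on_const assms(1))
    qed
  qed
qed

text \<open>The chain rule replaces \<open>h n\<close> by \<open>h (Suc n)\<close>, so the induction
  on \<open>k\<close> has to treat the whole family of iterated derivatives at once.\<close>

lemma Ck_on_comp_iterated_deriv:
  fixes f :: "'a::real_normed_vector \<Rightarrow> real" and h :: "nat \<Rightarrow> real \<Rightarrow> real"
  assumes "open S" "\<And>n t. (h n has_real_derivative h (Suc n) t) (at t)" "Ck_on k S f"
  shows "Ck_on k S (\<lambda>x. h n (f x))"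
  using assms(3)
proof (induction k arbitrary: n)
  case 0
  have "continuous_on UNIV (h n)"
    using assms(2) by (meson DERIV_isCont continuous_at_imp_continuous_on)
  then show ?case using 0 continuous_on_compose2[of UNIV "h n" S f] by auto
next
  case (Suc k)
  show ?case
  proof (rule Ck_on_SucI[OF assms(1)])
    show "((\<lambda>x. h n (f x)) has_derivative (\<lambda>v. h (Suc n) (f x) * frechet_derivative f (at x) v)) (at x)"
      if "x \<in> S" for x
      using has_derivative_compose[OF Ck_on_SucD[OF Suc.prems that] assms(2)[THEN has_field_derivative_imp_has_derivative]]
      by simp
    show "Ck_on k S (\<lambda>x. h (Suc n) (f x) * frechet_derivative f (at x) v)" for v
    proof -
      have "Ck_on k S (\<lambda>x. h (Suc n) (f x))"
        using Suc.IH Ck_on_Suc_imp[OF Suc.prems] by blast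
      moreover have "Ck_on k S (\<lambda>x. frechet_derivative f (at x) v)"
        using Suc.prems by simp
      ultimately show ?thesis
        by (intro Ck_on_mult assms(1))
    qed
  qed
qed


text \<open>\<open>Ck_on\<close> controls the derivative of \<open>g\<close> only in fixed
  directions, whereas the chain rule needs it in the direction
  \<open>frechet_derivative f (at x) v\<close>, which moves with \<open>x\<close>. Expanding that
  direction in \<open>B\<close> leaves fixed directions \<open>b\<close> with coefficients of class
  \<open>Ck_on k\<close>.\<close>

lemma Ck_on_compose:
  fixes f :: "'a::real_normed_vector \<Rightarrow> 'b::real_normed_vector" and g :: "'b \<Rightarrow> real"
    and l :: "'b \<Rightarrow> 'b \<Rightarrow> real"
  assumes "open S" "open T" "f ` S \<subseteq> T"
    and l: "\<And>b. bounded_linear (l b)" "\<And>w. w = (\<Sum>b\<in>B. l b w *\<^sub>R b)"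
    and "Ck_on k S f" "Ck_on k T g"
  shows "Ck_on k S (\<lambda>x. g (f x))"
  using assms(6-)
proof (induction k arbitrary: g)
  case 0
  then show ?case using assms(3) by (auto intro: continuous_on_compose2)
next
  case (Suc k)
  show ?case
  proof (rule Ck_on_SucI[OF assms(1)])
    fix x assume x: "x \<in> S"
    have dg: "(g has_derivative frechet_derivative g (at (f x))) (at (f x))"
      using Ck_on_SucD[OF Suc.prems(2)] x assms(3) by auto
    interpret lg: bounded_linear "frechet_derivative g (at (f x))"
      using dg by (rule has_derivative_bounded_linear)
    have "frechet_derivative g (at (f x)) w = (\<Sum>b\<in>B. l b w * frechet_derivative g (at (f x)) b)" for w
      by (subst l(2)[of w]) (simp add: lg.sum lg.scaleR)
    then have eq: "(\<lambda>v. frechet_derivative g (at (f x)) (frechet_derivative f (at x) v)) =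
        (\<lambda>v. \<Sum>b\<in>B. l b (frechet_derivative f (at x) v) * frechet_derivative g (at (f x)) b)"
      by blast
    show "((\<lambda>x. g (f x)) has_derivative (\<lambda>v. \<Sum>b\<in>B. l b (frechet_derivative f (at x) v) *
        frechet_derivative g (at (f x)) b)) (at x)"
      using has_derivative_compose[OF Ck_on_SucD[OF Suc.prems(1) x] dg] unfolding eq .
  next
    fix v
    have "Ck_on k S f"
      using Suc.prems(1) by (rule Ck_on_Suc_imp)
    then have "Ck_on k S (\<lambda>x. frechet_derivative g (at (f x)) b)" for b
      using Suc.IH[of "\<lambda>y. frechet_derivative g (at y) b"] Suc.prems(2) by simp
    moreover have "Ck_on k S (\<lambda>x. l b (frechet_derivative f (at x) v))" for b
      using Suc.prems(1) by (intro Ck_on_bounded_linear[OF assms(1) l(1)]) simp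
    ultimately show "Ck_on k S (\<lambda>x. \<Sum>b\<in>B. l b (frechet_derivative f (at x) v) *
        frechet_derivative g (at (f x)) b)"
      by (intro Ck_on_sum Ck_on_mult assms(1))
  qed
qed

subsection \<open>Bump functions on finite-dimensional normed spaces\<close>

text \<open>A box with one more generator is the continuous image of an interval times the smaller
  box. These boxes are the source of compactness both for bounding coordinates and for the supports
  of bump functions.\<close>

lemma compact_coordinate_box:
  fixes B :: "'a::real_normed_vector set"
  assumes "finite B"
  shows "compact {\<Sum>b\<in>B. u b *\<^sub>R b | u. \<forall>b\<in>B. \<bar>u b\<bar> \<le> R}"
  using assms
proof induction
  case (insert a B)
  let ?K = "{\<Sum>b\<in>B. u b *\<^sub>R b | u. \<forall>b\<in>B. \<bar>u b\<bar> \<le> R}"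
  have "{\<Sum>b\<in>insert a B. u b *\<^sub>R b | u. \<forall>b\<in>insert a B. \<bar>u b\<bar> \<le> R} =
      (\<lambda>(t, k). t *\<^sub>R a + k) ` ({-R..R} \<times> ?K)" (is "?L = ?M")
  proof
    show "?L \<subseteq> ?M"
      using insert(1,2) by (fastforce simp: abs_le_iff image_iff)
    show "?M \<subseteq> ?L"
    proof clarify
      fix t u assume t: "t \<in> {-R..R}" and u: "\<forall>b\<in>B. \<bar>u b\<bar> \<le> R"
      have "t *\<^sub>R a + (\<Sum>b\<in>B. u b *\<^sub>R b) = (\<Sum>b\<in>insert a B. (u(a := t)) b *\<^sub>R b)"
        using insert(1,2) by (auto intro!: sum.cong)
      moreover have "\<forall>b\<in>insert a B. \<bar>(u(a := t)) b\<bar> \<le> R"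
        using t u by auto
      ultimately show "\<exists>v. t *\<^sub>R a + (\<Sum>b\<in>B. u b *\<^sub>R b) = (\<Sum>b\<in>insert a B. v b *\<^sub>R b) \<and>
          (\<forall>b\<in>insert a B. \<bar>v b\<bar> \<le> R)"
        by blast
    qed
  qed
  moreover have "compact ?M"
    by (intro compact_continuous_image compact_Times insert.IH compact_Icc)
      (auto simp: case_prod_unfold intro!: continuous_intros)
  ultimately show ?case by simp
qed auto

text \<open>This is the equivalence of norms in finite dimension. In the induction only the distance
  of the new vector \<open>a\<close> from \<open>span B\<close> has to be bounded below;
  combinations of large norm are far from \<open>a\<close> anyway, and the others lie in a compact
  set that misses \<open>a\<close>.\<close>

lemma independent_coordinates_bounded:
  fixes B :: "'a::real_normed_vector set"
  assumes "finite B" "independent B"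
  shows "\<exists>C. \<forall>u. (\<Sum>b\<in>B. \<bar>u b\<bar>) \<le> C * norm (\<Sum>b\<in>B. u b *\<^sub>R b)"
  using assms
proof induction
  case (insert a B)
  then obtain C where C: "\<And>u. (\<Sum>b\<in>B. \<bar>u b\<bar>) \<le> C * norm (\<Sum>b\<in>B. u b *\<^sub>R b)"
    by (auto simp: independent_insert split: if_splits)
  \<comment> \<open>The constant supplied by the induction hypothesis may be negative (for empty
    \<open>B\<close> any value will do); the monotonicity arguments below need it
    nonnegative.\<close>
  let ?C = "\<bar>C\<bar>"
  have C': "(\<Sum>b\<in>B. \<bar>u b\<bar>) \<le> ?C * norm (\<Sum>b\<in>B. u b *\<^sub>R b)" for u
    by (rule order_trans[OF C]) (simp add: mult_right_mono)
  define K where "K = {\<Sum>b\<in>B. u b *\<^sub>R b | u. \<forall>b\<in>B. \<bar>u b\<bar> \<le> ?C * (norm a + 1)}"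
  have a: "a \<notin> span B"
    using insert by (auto simp: independent_insert split: if_splits)
  have "compact K"
    unfolding K_def using insert(1) by (rule compact_coordinate_box)
  moreover have "a \<notin> K"
    using a by (auto simp: K_def intro: span_sum span_scale span_base)
  ultimately obtain d where d: "d > 0" "\<And>v. v \<in> K \<Longrightarrow> d \<le> dist a v"
  proof -
    have "open (- K)" "a \<in> - K"
      using \<open>compact K\<close> \<open>a \<notin> K\<close> by (auto simp: compact_imp_closed open_Compl)
    then obtain d where "d > 0" "ball a d \<subseteq> - K"
      using openE by blast
    then show ?thesis
      by (intro that[of d]) (auto simp: subset_iff not_less)
  qed
  \<comment> \<open>Either the distance to \<open>a\<close> exceeds 1, or the combination has norm
    at most \<open>norm a + 1\<close>, which bounds its coordinates and puts it into
    \<open>K\<close>.\<close>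
  have far: "min d 1 \<le> norm (a - (\<Sum>b\<in>B. u b *\<^sub>R b))" for u
  proof (cases "norm (a - (\<Sum>b\<in>B. u b *\<^sub>R b)) \<le> 1")
    case True
    then have "norm (\<Sum>b\<in>B. u b *\<^sub>R b) \<le> norm a + 1"
      using norm_triangle_ineq3[of a "\<Sum>b\<in>B. u b *\<^sub>R b"] by linarith
    then have "?C * norm (\<Sum>b\<in>B. u b *\<^sub>R b) \<le> ?C * (norm a + 1)"
      by (rule mult_left_mono) simp
    then have "\<bar>u b\<bar> \<le> ?C * (norm a + 1)" if "b \<in> B" for b
      using C'[of u] member_le_sum[of b B "\<lambda>b. \<bar>u b\<bar>"] that insert(1) by auto
    then have "(\<Sum>b\<in>B. u b *\<^sub>R b) \<in> K"
      by (auto simp: K_def)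
    from d(2)[OF this] show ?thesis by (simp add: dist_norm)
  qed simp
  have key: "\<bar>t\<bar> * min d 1 \<le> norm (t *\<^sub>R a + (\<Sum>b\<in>B. u b *\<^sub>R b))" for t u
  proof (cases "t = 0")
    case False
    have "t *\<^sub>R a + (\<Sum>b\<in>B. u b *\<^sub>R b) = t *\<^sub>R (a - (\<Sum>b\<in>B. (- u b / t) *\<^sub>R b))"
      using False by (simp add: scaleR_add_right scaleR_diff_right scaleR_sum_right sum_negf)
    then show ?thesis
      using far[of "\<lambda>b. - u b / t"] by (simp add: mult_left_mono)
  qed simp
  define m where "m = min d 1"
  have m: "m > 0" using d by (simp add: m_def)
  \<comment> \<open>\<open>1 / m\<close> bounds the coordinate of \<open>a\<close>. The remaining
    part has norm at most that of the whole vector plus \<open>\<bar>u a\<bar> * norm a\<close>,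
    which gives the factor \<open>1 + norm a / m\<close> in front of \<open>?C\<close>.\<close>
  have "(\<Sum>b\<in>insert a B. \<bar>u b\<bar>) \<le> (1 / m + ?C * (1 + norm a / m)) * norm (\<Sum>b\<in>insert a B. u b *\<^sub>R b)" for u
  proof -
    let ?v = "\<Sum>b\<in>B. u b *\<^sub>R b" and ?n = "norm (u a *\<^sub>R a + (\<Sum>b\<in>B. u b *\<^sub>R b))"
    have 1: "\<bar>u a\<bar> \<le> ?n / m"
      using key[of "u a" u] m by (simp add: m_def field_simps)
    have "norm ?v \<le> ?n + \<bar>u a\<bar> * norm a"
      using norm_triangle_ineq4[of "u a *\<^sub>R a + ?v" "u a *\<^sub>R a"] by simp
    also have "\<dots> \<le> ?n + ?n / m * norm a"
      using 1 by (intro add_left_mono mult_right_mono) auto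
    finally have "?C * norm ?v \<le> ?C * (?n + ?n / m * norm a)"
      by (intro mult_left_mono) auto
    with C'[of u] have "(\<Sum>b\<in>B. \<bar>u b\<bar>) \<le> ?C * (?n + ?n / m * norm a)" by linarith
    with 1 have "\<bar>u a\<bar> + (\<Sum>b\<in>B. \<bar>u b\<bar>) \<le> ?n / m + ?C * (?n + ?n / m * norm a)" by linarith
    also have "\<dots> = (1 / m + ?C * (1 + norm a / m)) * ?n"
      by (simp add: algebra_simps)
    finally show ?thesis using insert(1,2) by simp
  qed
  then show ?case by blast
qed auto

text \<open>A spanning set yields coordinates that are a priori only algebraic functionals; the
  preceding bound makes them continuous, so that they can be used as smooth functions.\<close>

lemma finite_dimensional_coordinates:
  fixes S :: "'a::real_normed_vector set"
  assumes "finite S" "span S = UNIV"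
  obtains B and l where "finite B"
    "\<And>b. bounded_linear (l b :: 'a \<Rightarrow> real)" "\<And>w. w = (\<Sum>b\<in>B. l b w *\<^sub>R b)"
proof -
  obtain B where B: "B \<subseteq> S" "independent B" "S \<subseteq> span B"
    using maximal_independent_subset[of S] by blast
  have fin: "finite B" using B(1) assms(1) finite_subset by auto
  have sp: "span B = UNIV"
    using B(3) assms(2) by (metis span_mono span_span top.extremum_uniqueI)
  define l where "l = (\<lambda>b w. representation B w b)"
  have rep: "w = (\<Sum>b\<in>B. l b w *\<^sub>R b)" for w
    using sum_representation_eq[OF B(2), of w B] fin sp by (simp add: l_def)
  obtain C where C: "\<And>u. (\<Sum>b\<in>B. \<bar>u b\<bar>) \<le> C * norm (\<Sum>b\<in>B. u b *\<^sub>R b)"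
    using independent_coordinates_bounded[OF fin B(2)] by auto
  have "bounded_linear (l b)" for b
  proof (rule bounded_linear_intro)
    show "l b (x + y) = l b x + l b y" for x y
      using representation_add[OF B(2)] sp by (simp add: l_def)
    show "l b (r *\<^sub>R x) = r *\<^sub>R l b x" for r x
      using representation_scale[OF B(2)] sp by (simp add: l_def)
    show "norm (l b x) \<le> norm x * \<bar>C\<bar>" for x
    proof (cases "b \<in> B")
      case True
      have "\<bar>l b x\<bar> \<le> (\<Sum>b\<in>B. \<bar>l b x\<bar>)"
        using True fin by (intro member_le_sum) auto
      also have "\<dots> \<le> C * norm x"
        using C[of "\<lambda>b. l b x"] rep[of x] by simp
      also have "\<dots> \<le> norm x * \<bar>C\<bar>"
        by (simp add: mult.commute[of "norm x"] mult_right_mono)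
      finally show ?thesis by simp
    next
      case False
      then have "l b x = 0"
        using representation_ne_zero[of B x b] by (auto simp: l_def)
      then show ?thesis by simp
    qed
  qed
  with that fin rep show ?thesis by blast
qed

text \<open>The functions \<open>p(1/t) e\<^bsup>-1/t\<^esup>\<close>, extended by \<open>0\<close> to \<open>t \<le> 0\<close>, form a family that is closed under
  differentiation, which makes all of them smooth.\<close>

definition exp_flat :: "real poly \<Rightarrow> real \<Rightarrow> real"
  where "exp_flat p t = (if t > 0 then poly p (1 / t) * exp (- 1 / t) else 0)"

lemma poly_times_exp_minus_tendsto_0: "((\<lambda>x::real. poly p x * exp (- x)) \<longlongrightarrow> 0) at_top"
proof -
  have "((\<lambda>x. \<Sum>i\<le>degree p. coeff p i * (x ^ i / exp x)) \<longlongrightarrow> (\<Sum>i\<le>degree p. coeff p i * 0)) at_top"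
    by (intro tendsto_sum tendsto_mult tendsto_const tendsto_power_div_exp_0)
  then show ?thesis
    by (simp add: poly_altdef sum_distrib_right exp_minus divide_inverse mult.assoc)
qed

text \<open>Writing s = 1/t, the derivative of p(s) exp(-s) is -s^2 (p'(s) - p(s)) exp(-s); this is
  where the polynomial \<open>[:0, 0, 1:] * (p - pderiv p)\<close> comes from.\<close>

lemma exp_flat_deriv:
  "(exp_flat p has_real_derivative exp_flat ([:0, 0, 1:] * (p - pderiv p)) t) (at t)"
proof -
  consider "t > 0" | "t < 0" | "t = 0" by linarith
  then show ?thesis
  proof cases
    case 1
    have "((\<lambda>t. poly p (1 / t) * exp (- 1 / t)) has_real_derivative
        exp_flat ([:0, 0, 1:] * (p - pderiv p)) t) (at t)"
      using 1 by (auto intro!: derivative_eq_intros poly_DERIV[THEN DERIV_chain2]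
          simp: exp_flat_def field_simps power2_eq_square)
    then show ?thesis
      by (rule has_field_derivative_transform_within_open[of _ _ _ "{0<..}"])
        (use 1 in \<open>auto simp: exp_flat_def\<close>)
  next
    case 2
    have "((\<lambda>t. 0) has_real_derivative exp_flat ([:0, 0, 1:] * (p - pderiv p)) t) (at t)"
      using 2 by (auto simp: exp_flat_def)
    then show ?thesis
      by (rule has_field_derivative_transform_within_open[of _ _ _ "{..<0}"])
        (use 2 in \<open>auto simp: exp_flat_def\<close>)
  next
    case 3
    have "((\<lambda>h. exp_flat p h / h) \<longlongrightarrow> 0) (at_right 0)"
    proof -
      \<comment> \<open>For h > 0 the difference quotient at 0 is again a polynomial in 1/h times
        exp(-1/h): dividing by h multiplies \<open>p\<close> by its variable, which is
        \<open>pCons 0 p\<close>.\<close>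
      have "((\<lambda>h::real. poly (pCons 0 p) (1 / h) * exp (- (1 / h))) \<longlongrightarrow> 0) (at_right 0)"
        by (rule filterlim_compose[OF poly_times_exp_minus_tendsto_0])
          (simp add: filterlim_inverse_at_top_right flip: inverse_eq_divide)
      then show ?thesis
        by (rule Lim_transform_eventually)
          (auto simp: exp_flat_def eventually_at_right_field intro!: exI[of _ 1])
    qed
    moreover have "((\<lambda>h. exp_flat p h / h) \<longlongrightarrow> 0) (at_left 0)"
      by (rule Lim_transform_eventually[OF tendsto_const])
        (auto simp: exp_flat_def eventually_at_left_field intro!: exI[of _ "-1"])
    ultimately have "((\<lambda>h. exp_flat p h / h) \<longlongrightarrow> 0) (at 0)"
      by (simp add: filterlim_split_at)
    then show ?thesis
      using 3 by (simp add: DERIV_def exp_flat_def)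
  qed
qed

lemma Ck_on_exp_flat:
  fixes f :: "'a::real_normed_vector \<Rightarrow> real"
  assumes "open S" "Ck_on k S f"
  shows "Ck_on k S (\<lambda>x. exp_flat 1 (f x))"
proof -
  define h where "h = (\<lambda>n::nat. exp_flat (((\<lambda>p. [:0, 0, 1:] * (p - pderiv p)) ^^ n) 1))"
  have "(h n has_real_derivative h (Suc n) t) (at t)" for n t
    using exp_flat_deriv by (simp add: h_def)
  from Ck_on_comp_iterated_deriv[of S h k f 0, OF assms(1) this assms(2)]
  show ?thesis by (simp add: h_def)
qed

lemma exp_flat_1: "exp_flat 1 t = 0 \<longleftrightarrow> t \<le> 0" "exp_flat 1 t \<ge> 0"
  by (auto simp: exp_flat_def)

text \<open>The norm may fail to be differentiable, so the distance from \<open>y\<close> is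
  measured by \<open>r\<close>, a sum of squared coordinates. \<open>K\<close> and \<open>V\<close>
  are sublevel sets of \<open>r\<close>, and \<open>f\<close> is the usual cutoff quotient of flat
  exponentials of an affine function of \<open>r\<close>.\<close>

lemma smooth_bump_finite_dimensional:
  fixes F S :: "'a::real_normed_vector set"
  assumes "finite F" "span F = UNIV" "open S" "y \<in> S"
  obtains f :: "'a \<Rightarrow> real" and K V where "smooth_on UNIV f" "compact K" "K \<subseteq> S"
    "\<And>x. x \<notin> K \<Longrightarrow> f x = 0" "open V" "y \<in> V" "\<And>x. x \<in> V \<Longrightarrow> f x = 1"
proof -
  obtain B and l :: "'a \<Rightarrow> 'a \<Rightarrow> real" where B: "finite B"
    and l: "\<And>b. bounded_linear (l b)" "\<And>w. w = (\<Sum>b\<in>B. l b w *\<^sub>R b)"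
    using finite_dimensional_coordinates[OF assms(1,2)] by metis
  define r where "r = (\<lambda>x. \<Sum>b\<in>B. (l b (x - y))\<^sup>2)"
  have lC: "Ck_on k UNIV (\<lambda>x. l b (x - y))" for k b
  proof -
    have "Ck_on k UNIV (\<lambda>x::'a. x)"
    proof (cases k)
      case (Suc j)
      have "Ck_on (Suc j) UNIV (\<lambda>x::'a. x)"
        by (rule Ck_on_SucI[where f' = "\<lambda>x v. v"]) (auto intro: Ck_on_const)
      with Suc show ?thesis by blast
    qed auto
    then have "Ck_on k UNIV (\<lambda>x. x + - y)"
      by (intro Ck_on_add Ck_on_const) auto
    then show ?thesis
      using Ck_on_bounded_linear[OF open_UNIV l(1), of k "\<lambda>x. x + - y" b] by simp
  qed
  have rC: "Ck_on k UNIV r" for k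
    unfolding r_def power2_eq_square by (intro Ck_on_sum Ck_on_mult lC) auto
  have "continuous_on UNIV r"
    using rC[of 0] by simp
  \<comment> \<open>A vector whose coordinates are bounded by R has norm at most
    \<open>R * c\<close>; the summand 1 keeps \<open>c\<close> positive when \<open>B\<close> is
    empty.\<close>
  define c where "c = (\<Sum>b\<in>B. norm b) + 1"
  have c: "c > 0" unfolding c_def by (smt (verit) norm_ge_zero sum_nonneg)
  obtain e where e: "e > 0" "ball y e \<subseteq> S"
    using assms(3,4) openE by blast
  \<comment> \<open>Chosen so that \<open>r x \<le> 2 * \<rho>\<close> bounds each coordinate by
    \<open>e / (2 * c)\<close>, which keeps \<open>K\<close> strictly inside
    \<open>ball y e\<close>.\<close>
  define \<rho> where "\<rho> = (e / (2 * c))\<^sup>2 / 2"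
  have \<rho>: "\<rho> > 0" using e c by (simp add: \<rho>_def)
  have sq: "sqrt (2 * \<rho>) = e / (2 * c)"
    using e c by (simp add: \<rho>_def real_sqrt_divide)
  define K where "K = {x. r x \<le> 2 * \<rho>}"
  have coord: "\<bar>l b (x - y)\<bar> \<le> sqrt (2 * \<rho>)" if "x \<in> K" "b \<in> B" for b x
  proof -
    have "(l b (x - y))\<^sup>2 \<le> r x"
      unfolding r_def using that B by (intro member_le_sum) auto
    then have "(l b (x - y))\<^sup>2 \<le> 2 * \<rho>" using that by (simp add: K_def)
    then show ?thesis using real_le_rsqrt by (metis power2_abs)
  qed
  have "K \<subseteq> S"
  proof
    fix x assume x: "x \<in> K"
    have "norm (x - y) = norm (\<Sum>b\<in>B. l b (x - y) *\<^sub>R b)"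
      using l(2)[of "x - y"] by simp
    also have "\<dots> \<le> (\<Sum>b\<in>B. \<bar>l b (x - y)\<bar> * norm b)"
      by (rule norm_sum[THEN order_trans]) simp
    also have "\<dots> \<le> (\<Sum>b\<in>B. sqrt (2 * \<rho>) * norm b)"
      using coord[OF x] by (intro sum_mono mult_right_mono) auto
    also have "\<dots> \<le> sqrt (2 * \<rho>) * c"
      using \<rho> by (simp add: c_def distrib_left sum_distrib_left)
    also have "\<dots> < e"
      using sq c e by simp
    finally show "x \<in> S"
      using e(2) by (auto simp: dist_norm norm_minus_commute)
  qed
  moreover have "compact K"
  proof -
    let ?b = "{\<Sum>b\<in>B. u b *\<^sub>R b | u. \<forall>b\<in>B. \<bar>u b\<bar> \<le> sqrt (2 * \<rho>)}"
    have "K = ((+) y ` ?b) \<inter> K"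
    proof -
      have "x \<in> (+) y ` ?b" if "x \<in> K" for x
      proof (rule image_eqI)
        show "x = y + (x - y)" by simp
        show "x - y \<in> ?b"
          unfolding mem_Collect_eq
          by (rule exI[of _ "\<lambda>b. l b (x - y)"]) (intro conjI ballI l(2) coord[OF that])
      qed
      then show ?thesis by blast
    qed
    moreover have "closed K"
      unfolding K_def using \<open>continuous_on UNIV r\<close>
      by (intro closed_Collect_le continuous_on_const)
    moreover have "compact ((+) y ` ?b)"
      using compact_coordinate_box[OF B] by (rule compact_translation)
    ultimately show ?thesis
      using compact_Int_closed[of "(+) y ` ?b" K] by simp
  qed
  moreover
  \<comment> \<open>\<open>s\<close> is at most 0 outside \<open>K\<close> and greater than 1 where
    \<open>r\<close> is below \<rho>. Hence the numerator of \<open>f\<close> vanishes outside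
    \<open>K\<close>, and near \<open>y\<close> the second summand of the denominator
    vanishes.\<close>
  define s where "s = (\<lambda>x. 2 + (- 1 / \<rho>) * r x)"
  define f where "f = (\<lambda>x. exp_flat 1 (s x) * inverse (exp_flat 1 (s x) + exp_flat 1 (1 + (- 1) * s x)))"
  \<comment> \<open>The numbers t and 1 - t are never both nonpositive, so one of the two summands
    is positive.\<close>
  have pos: "exp_flat 1 t + exp_flat 1 (1 + (- 1) * t) \<noteq> 0" for t
    using exp_flat_1[of t] exp_flat_1[of "1 + (- 1) * t"] by (smt (verit))
  have sC: "Ck_on k UNIV s" for k
    unfolding s_def by (intro Ck_on_add Ck_on_mult Ck_on_const rC) auto
  have "smooth_on UNIV f"
    unfolding smooth_on_def f_def
    by (intro allI Ck_on_mult Ck_on_inverse Ck_on_add Ck_on_exp_flat Ck_on_const sC pos) auto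
  moreover have "f x = 0" if "x \<notin> K" for x
  proof -
    have "s x \<le> 0" using that \<rho> by (auto simp: K_def s_def field_simps)
    then show ?thesis using exp_flat_1 by (simp add: f_def)
  qed
  moreover have "open {x. r x < \<rho>}"
    using \<open>continuous_on UNIV r\<close> by (intro open_Collect_less continuous_on_const)
  moreover have "y \<in> {x. r x < \<rho>}"
    using \<rho> l(1) by (simp add: r_def linear_0 bounded_linear.linear)
  moreover have "f x = 1" if "x \<in> {x. r x < \<rho>}" for x
  proof -
    have "1 + (- 1) * s x \<le> 0" using that \<rho> by (auto simp: s_def field_simps)
    then have "exp_flat 1 (1 + (- 1) * s x) = 0" using exp_flat_1 by blast
    then show ?thesis using pos[of "s x"] by (simp add: f_def)
  qed
  ultimately show ?thesis
    using that by blast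
qed

subsection \<open>Germs of smooth functions on a manifold\<close>

lemma smooth_on_cong:
  assumes "open S" "\<And>x. x \<in> S \<Longrightarrow> f x = g x"
  shows "smooth_on S f \<longleftrightarrow> smooth_on S g"
  using Ck_on_cong[OF assms] by (simp add: smooth_on_def)

lemma smooth_on_subset: "smooth_on S f \<Longrightarrow> T \<subseteq> S \<Longrightarrow> smooth_on T f"
  by (auto simp: smooth_on_def intro: Ck_on_subset)

lemma smooth_on_local:
  assumes "\<And>x. x \<in> S \<Longrightarrow> \<exists>T. open T \<and> x \<in> T \<and> smooth_on T f"
  shows "smooth_on S f"
  unfolding smooth_on_def
proof (intro allI Ck_on_local)
  fix k x assume "x \<in> S"
  then show "\<exists>T. open T \<and> x \<in> T \<and> Ck_on k T f"
    using assms by (meson smooth_on_def)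
qed

lemma smooth_on_compose:
  fixes f :: "'a::real_normed_vector \<Rightarrow> 'b::real_normed_vector" and g :: "'b \<Rightarrow> real"
  assumes "finite F" "span F = (UNIV :: 'b set)" "open S" "open T" "f ` S \<subseteq> T"
    "smooth_on S f" "smooth_on T g"
  shows "smooth_on S (\<lambda>x. g (f x))"
proof -
  obtain B and l :: "'b \<Rightarrow> 'b \<Rightarrow> real" where
    l: "\<And>b. bounded_linear (l b)" "\<And>w. w = (\<Sum>b\<in>B. l b w *\<^sub>R b)"
    using finite_dimensional_coordinates[OF assms(1,2)] by metis
  show ?thesis
    unfolding smooth_on_def
  proof
    fix k
    show "Ck_on k S (\<lambda>x. g (f x))"
      by (rule Ck_on_compose[OF assms(3-5) l]) (use assms(6,7) in \<open>auto simp: smooth_on_def\<close>)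
  qed
qed

text \<open>The germ version of \<open>smooth_fun_on\<close>: combined with the filters
  \<open>nhds x\<close> it allows local identities to be used without naming their domains.\<close>

definition smooth_at ::
    "('m::topological_space, 'e::real_normed_vector) atlas \<Rightarrow> 'm \<Rightarrow> ('m \<Rightarrow> real) \<Rightarrow> bool"
  where "smooth_at M x f \<longleftrightarrow> (\<exists>W. open W \<and> x \<in> W \<and> smooth_fun_on M W f)"

lemma smooth_fun_on_mono: "smooth_fun_on M W f \<Longrightarrow> V \<subseteq> W \<Longrightarrow> smooth_fun_on M V f"
  unfolding smooth_fun_on_def by (blast intro: smooth_on_subset)

context
  fixes M :: "('m::{t2_space,second_countable_topology}, 'e::real_normed_vector) atlas"
  assumes M: "smooth_manifold M"
begin

lemma manifold_finite_dimensional: "\<exists>F::'e set. finite F \<and> span F = UNIV"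
  using M by (simp add: smooth_manifold_def)

lemma chart_exists: "\<exists>U \<phi>. (U, \<phi>) \<in> M \<and> x \<in> U"
proof -
  have "x \<in> (\<Union>(U, \<phi>)\<in>M. U)"
    using M by (simp add: smooth_manifold_def)
  then show ?thesis by auto
qed

lemma chartD:
  assumes "(U, \<phi>) \<in> M"
  shows "open U" "open (\<phi> ` U)" "inj_on \<phi> U" "homeomorphism U (\<phi> ` U) \<phi> (inv_into U \<phi>)"
  using M assms by (auto simp: smooth_manifold_def)

lemma chart_transition:
  assumes "(U, \<phi>) \<in> M" "(V, \<psi>) \<in> M"
  shows "smooth_on (\<phi> ` (U \<inter> V)) (\<lambda>z. \<psi> (inv_into U \<phi> z))"
  using M assms by (fastforce simp: smooth_manifold_def comp_def)

lemma chart_inv: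
  assumes "(U, \<phi>) \<in> M" "x \<in> U"
  shows "inv_into U \<phi> (\<phi> x) = x"
  using chartD(3)[OF assms(1)] assms(2) by simp

lemma open_chart_image:
  assumes "(U, \<phi>) \<in> M" "open W"
  shows "open (\<phi> ` (U \<inter> W))"
proof -
  have "openin (top_of_set (\<phi> ` U)) (\<phi> ` (U \<inter> W))"
    using homeomorphism_imp_open_map[OF chartD(4)[OF assms(1)]] assms by blast
  then show ?thesis
    using chartD(2)[OF assms(1)] by (metis openin_open_eq)
qed

lemma smooth_fun_on_cong:
  assumes "open W" "\<And>x. x \<in> W \<Longrightarrow> f x = g x" "smooth_fun_on M W f"
  shows "smooth_fun_on M W g"
  unfolding smooth_fun_on_def
proof clarify
  fix U \<phi> assume U: "(U, \<phi>) \<in> M"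
  have "smooth_on (\<phi> ` (U \<inter> W)) (f \<circ> inv_into U \<phi>)"
    using assms(3) U by (auto simp: smooth_fun_on_def)
  then show "smooth_on (\<phi> ` (U \<inter> W)) (g \<circ> inv_into U \<phi>)"
    by (subst smooth_on_cong[OF open_chart_image[OF U assms(1)], of _ "f \<circ> inv_into U \<phi>"])
      (use assms(2) chart_inv[OF U] in auto)
qed

lemma smooth_fun_on_local:
  assumes "\<And>x. x \<in> W \<Longrightarrow> smooth_at M x f"
  shows "smooth_fun_on M W f"
  unfolding smooth_fun_on_def
proof (clarify intro!: smooth_on_local)
  fix U \<phi> x assume U: "(U, \<phi>) \<in> M" and x: "x \<in> U" "x \<in> W"
  obtain V where V: "open V" "x \<in> V" "smooth_fun_on M V f"
    using assms[OF x(2)] by (auto simp: smooth_at_def)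
  then have "smooth_on (\<phi> ` (U \<inter> V)) (f \<circ> inv_into U \<phi>)"
    using U by (auto simp: smooth_fun_on_def)
  then show "\<exists>T. open T \<and> \<phi> x \<in> T \<and> smooth_on T (f \<circ> inv_into U \<phi>)"
    using open_chart_image[OF U V(1)] x V(2) by blast
qed

lemma smooth_fun_on_iff: "open W \<Longrightarrow> smooth_fun_on M W f \<longleftrightarrow> (\<forall>x\<in>W. smooth_at M x f)"
  using smooth_fun_on_local smooth_at_def by blast

lemma smooth_functions_iff: "f \<in> smooth_functions M \<longleftrightarrow> (\<forall>x. smooth_at M x f)"
  using smooth_fun_on_iff[of UNIV f] by (simp add: smooth_functions_def)

lemma smooth_at_eventually: "smooth_at M x f \<Longrightarrow> \<forall>\<^sub>F y in nhds x. smooth_at M y f"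
  by (auto simp: smooth_at_def eventually_nhds)

lemma smooth_at_cong:
  assumes "smooth_at M x f" "\<forall>\<^sub>F y in nhds x. f y = g y"
  shows "smooth_at M x g"
proof -
  obtain W where W: "open W" "x \<in> W" "smooth_fun_on M W f"
    using assms(1) by (auto simp: smooth_at_def)
  obtain V where V: "open V" "x \<in> V" "\<And>y. y \<in> V \<Longrightarrow> f y = g y"
    using assms(2) by (auto simp: eventually_nhds)
  have "smooth_fun_on M (W \<inter> V) g"
    by (rule smooth_fun_on_cong[of _ f]) (use W V in \<open>auto intro: smooth_fun_on_mono\<close>)
  then show ?thesis
    using W V by (auto simp: smooth_at_def)
qed

lemma smooth_at_const [simp]: "smooth_at M x (\<lambda>y. c)"
proof -
  have "smooth_fun_on M UNIV (\<lambda>y. c)"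
    unfolding smooth_fun_on_def
  proof clarify
    fix U \<phi> assume U: "(U, \<phi>) \<in> M"
    show "smooth_on (\<phi> ` (U \<inter> UNIV)) ((\<lambda>y. c) \<circ> inv_into U \<phi>)"
      unfolding smooth_on_def comp_def by (intro allI Ck_on_const open_chart_image U open_UNIV)
  qed
  then show ?thesis
    using smooth_fun_on_iff[OF open_UNIV] by blast
qed

lemma smooth_at_binop:
  assumes "\<And>k (S::'e set) f g. open S \<Longrightarrow> Ck_on k S f \<Longrightarrow> Ck_on k S g \<Longrightarrow> Ck_on k S (\<lambda>y. F (f y) (g y))"
    and "smooth_at M x f" "smooth_at M x g"
  shows "smooth_at M x (\<lambda>y. F (f y) (g y))"
proof -
  obtain W where W: "open W" "x \<in> W" "smooth_fun_on M W f"
    using assms(2) by (auto simp: smooth_at_def)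
  obtain V where V: "open V" "x \<in> V" "smooth_fun_on M V g"
    using assms(3) by (auto simp: smooth_at_def)
  have "smooth_fun_on M (W \<inter> V) (\<lambda>y. F (f y) (g y))"
    unfolding smooth_fun_on_def smooth_on_def
  proof clarify
    fix U \<phi> k assume U: "(U, \<phi>) \<in> M"
    have "smooth_on (\<phi> ` (U \<inter> (W \<inter> V))) (f \<circ> inv_into U \<phi>)"
      "smooth_on (\<phi> ` (U \<inter> (W \<inter> V))) (g \<circ> inv_into U \<phi>)"
      using W(3) V(3) U smooth_fun_on_mono unfolding smooth_fun_on_def
      by (fastforce intro: smooth_on_subset)+
    then have "Ck_on k (\<phi> ` (U \<inter> (W \<inter> V))) (\<lambda>z. F ((f \<circ> inv_into U \<phi>) z) ((g \<circ> inv_into U \<phi>) z))"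
      using W V unfolding smooth_on_def comp_def by (intro assms(1) open_chart_image U) auto
    then show "Ck_on k (\<phi> ` (U \<inter> (W \<inter> V))) ((\<lambda>y. F (f y) (g y)) \<circ> inv_into U \<phi>)"
      by (simp add: comp_def)
  qed
  then show ?thesis
    using W V by (auto simp: smooth_at_def)
qed

lemma smooth_at_add: "smooth_at M x f \<Longrightarrow> smooth_at M x g \<Longrightarrow> smooth_at M x (\<lambda>y. f y + g y)"
  by (rule smooth_at_binop) (auto intro: Ck_on_add)

lemma smooth_at_mult: "smooth_at M x f \<Longrightarrow> smooth_at M x g \<Longrightarrow> smooth_at M x (\<lambda>y. f y * g y)"
  by (rule smooth_at_binop) (auto intro: Ck_on_mult)

lemma smooth_at_sum: "(\<And>i. i \<in> I \<Longrightarrow> smooth_at M x (f i)) \<Longrightarrow> smooth_at M x (\<lambda>y. \<Sum>i\<in>I. f i y)"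
  by (induction I rule: infinite_finite_induct) (auto intro: smooth_at_add)

lemma smooth_at_minus: "smooth_at M x f \<Longrightarrow> smooth_at M x (\<lambda>y. - f y)"
  using smooth_at_mult[OF smooth_at_const[of x "-1"]] by simp

lemma smooth_at_diff: "smooth_at M x f \<Longrightarrow> smooth_at M x g \<Longrightarrow> smooth_at M x (\<lambda>y. f y - g y)"
  using smooth_at_add[OF _ smooth_at_minus] by simp

lemma smooth_at_continuous:
  assumes "smooth_at M x f"
  shows "isCont f x"
proof -
  obtain W where W: "open W" "x \<in> W" "smooth_fun_on M W f"
    using assms by (auto simp: smooth_at_def)
  obtain U \<phi> where U: "(U, \<phi>) \<in> M" "x \<in> U"
    using chart_exists by blast
  have "continuous_on (\<phi> ` (U \<inter> W)) (f \<circ> inv_into U \<phi>)"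
    using W(3) U(1) unfolding smooth_fun_on_def smooth_on_def by (metis (no_types, lifting) Ck_on.simps(1) case_prodD)
  moreover have "continuous_on (U \<inter> W) \<phi>"
    using chartD(4)[OF U(1)] by (auto simp: homeomorphism_def intro: continuous_on_subset)
  ultimately have "continuous_on (U \<inter> W) ((f \<circ> inv_into U \<phi>) \<circ> \<phi>)"
    by (metis continuous_on_compose)
  then have "continuous_on (U \<inter> W) f"
    by (rule continuous_on_eq) (use chart_inv[OF U(1)] in auto)
  then show ?thesis
    using U(2) W(1,2) chartD(1)[OF U(1)] continuous_on_eq_continuous_at[of "U \<inter> W" f] by blast
qed

lemma smooth_at_inverse:
  assumes "smooth_at M x f" "f x \<noteq> 0"
  shows "smooth_at M x (\<lambda>y. inverse (f y))"
proof -
  obtain W where W: "open W" "x \<in> W" "smooth_fun_on M W f"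
    using assms by (auto simp: smooth_at_def)
  have "\<forall>\<^sub>F y in nhds x. f y \<noteq> 0"
    using smooth_at_continuous[OF assms(1)] assms(2)
    by (simp add: tendsto_imp_eventually_ne isCont_def eventually_nhds_conv_at)
  then obtain V where V: "open V" "x \<in> V" "\<And>y. y \<in> V \<Longrightarrow> f y \<noteq> 0"
    by (auto simp: eventually_nhds)
  have "smooth_fun_on M (W \<inter> V) (\<lambda>y. inverse (f y))"
    unfolding smooth_fun_on_def smooth_on_def
  proof clarify
    fix U \<phi> k assume U: "(U, \<phi>) \<in> M"
    have "smooth_on (\<phi> ` (U \<inter> (W \<inter> V))) (f \<circ> inv_into U \<phi>)"
      using W(3) U unfolding smooth_fun_on_def
      by (fastforce intro: smooth_on_subset)
    then have "Ck_on k (\<phi> ` (U \<inter> (W \<inter> V))) (\<lambda>z. inverse ((f \<circ> inv_into U \<phi>) z))"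
      using W V chart_inv[OF U] unfolding smooth_on_def comp_def
      by (intro Ck_on_inverse open_chart_image U) auto
    then show "Ck_on k (\<phi> ` (U \<inter> (W \<inter> V))) ((\<lambda>y. inverse (f y)) \<circ> inv_into U \<phi>)"
      by (simp add: comp_def)
  qed
  then show ?thesis
    using W V by (auto simp: smooth_at_def)
qed

lemma smooth_map_id: "smooth_map M M id"
  unfolding smooth_map_def
  using chart_transition by (auto simp: comp_def)

lemma smooth_fun_on_chart:
  assumes "(U, \<phi>) \<in> M" "smooth_on UNIV g"
  shows "smooth_fun_on M U (\<lambda>x. g (\<phi> x))"
  unfolding smooth_fun_on_def
proof clarify
  fix V \<psi> assume V: "(V, \<psi>) \<in> M"
  obtain F :: "'e set" where F: "finite F" "span F = UNIV"
    using manifold_finite_dimensional by blast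
  show "smooth_on (\<psi> ` (V \<inter> U)) ((\<lambda>x. g (\<phi> x)) \<circ> inv_into V \<psi>)"
    using smooth_on_compose[OF F open_chart_image[OF V chartD(1)[OF assms(1)]] open_UNIV _
        chart_transition[OF V assms(1)] assms(2)]
    by (simp add: comp_def)
qed

text \<open>A bump function on the model space is transported through a chart and extended by 0. It
  is required to vanish near each point outside \<open>W\<close>, not just at that point, so that
  its product with anything smooth on \<open>W\<close> is smooth everywhere.\<close>

lemma smooth_bump_exists:
  assumes "open W" "x \<in> W"
  obtains g where "g \<in> smooth_functions M" "\<forall>\<^sub>F y in nhds x. g y = 1"
    "\<And>y. y \<notin> W \<Longrightarrow> \<forall>\<^sub>F z in nhds y. g z = 0"
proof -
  obtain U \<phi> where U: "(U, \<phi>) \<in> M" "x \<in> U"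
    using chart_exists by blast
  obtain F :: "'e set" where F: "finite F" "span F = UNIV"
    using manifold_finite_dimensional by blast
  obtain f :: "'e \<Rightarrow> real" and K V where f: "smooth_on UNIV f" "compact K" "K \<subseteq> \<phi> ` (U \<inter> W)"
    "\<And>x. x \<notin> K \<Longrightarrow> f x = 0" "open V" "\<phi> x \<in> V" "\<And>x. x \<in> V \<Longrightarrow> f x = 1"
    using smooth_bump_finite_dimensional[OF F open_chart_image[OF U(1) assms(1)], of "\<phi> x"]
      U(2) assms(2) by auto
  define g where "g = (\<lambda>y. if y \<in> U then f (\<phi> y) else 0)"
  define C where "C = inv_into U \<phi> ` K"
  have "continuous_on K (inv_into U \<phi>)"
    using chartD(4)[OF U(1)] f(3) by (auto simp: homeomorphism_def intro: continuous_on_subset)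
  \<comment> \<open>The support is compact in the chart domain and hence closed in the whole
    manifold, by the Hausdorff property; this makes the extension by 0 smooth at boundary points of
    \<open>U\<close>.\<close>
  then have "closed C"
    unfolding C_def using f(2) by (intro compact_imp_closed compact_continuous_image)
  have C: "C \<subseteq> U \<inter> W"
    using f(3) chart_inv[OF U(1)] by (auto simp: C_def)
  have g0: "g y = 0" if "y \<notin> C" for y
  proof (cases "y \<in> U")
    case True
    then have "\<phi> y \<notin> K"
      using that chart_inv[OF U(1) True] by (force simp: C_def)
    then show ?thesis using f(4) by (simp add: g_def)
  qed (simp add: g_def)
  have ev0: "\<forall>\<^sub>F z in nhds y. g z = 0" if "y \<notin> C" for y
    using \<open>closed C\<close> that g0 by (auto simp: eventually_nhds intro!: exI[of _ "- C"])
  have "smooth_at M y g" for y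
  proof (cases "y \<in> U")
    case True
    have "smooth_fun_on M U g"
      by (rule smooth_fun_on_cong[OF chartD(1)[OF U(1)] _ smooth_fun_on_chart[OF U(1) f(1)]])
        (simp add: g_def)
    then show ?thesis
      using True chartD(1)[OF U(1)] by (auto simp: smooth_at_def)
  next
    case False
    then have "\<forall>\<^sub>F z in nhds y. 0 = g z"
      using ev0[of y] C by (auto elim: eventually_mono)
    with smooth_at_const show ?thesis by (rule smooth_at_cong)
  qed
  moreover have "\<forall>\<^sub>F y in nhds x. g y = 1"
  proof -
    have "continuous_on U \<phi>"
      using chartD(4)[OF U(1)] by (simp add: homeomorphism_def)
    then have "open (\<phi> -` V \<inter> U)"
      using f(5) continuous_on_open_vimage[OF chartD(1)[OF U(1)]] by blast
    moreover have "x \<in> \<phi> -` V \<inter> U"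
      using U(2) f(6) by simp
    moreover have "g y = 1" if "y \<in> \<phi> -` V \<inter> U" for y
      using that f(7) by (simp add: g_def)
    ultimately show ?thesis by (auto simp: eventually_nhds)
  qed
  ultimately show ?thesis
    using that[of g] ev0 C by (auto simp: smooth_functions_iff)
qed

lemma smooth_function_extension:
  assumes "smooth_at M x f"
  obtains h where "h \<in> smooth_functions M" "\<forall>\<^sub>F y in nhds x. h y = f y"
proof -
  obtain W where W: "open W" "x \<in> W" "\<And>y. y \<in> W \<Longrightarrow> smooth_at M y f"
    using smooth_at_eventually[OF assms] by (auto simp: eventually_nhds)
  obtain g where g: "g \<in> smooth_functions M" "\<forall>\<^sub>F y in nhds x. g y = 1"
    "\<And>y. y \<notin> W \<Longrightarrow> \<forall>\<^sub>F z in nhds y. g z = 0"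
    using smooth_bump_exists[OF W(1,2)] by blast
  have "smooth_at M y (\<lambda>y. g y * f y)" for y
  proof (cases "y \<in> W")
    case True
    then show ?thesis using g(1) W(3) by (simp add: smooth_functions_iff smooth_at_mult)
  next
    case False
    have "\<forall>\<^sub>F z in nhds y. 0 = g z * f z"
      using g(3)[OF False] by (rule eventually_mono) auto
    with smooth_at_const show ?thesis by (rule smooth_at_cong)
  qed
  moreover have "\<forall>\<^sub>F y in nhds x. g y * f y = f y"
    using g(2) by (rule eventually_mono) auto
  ultimately show ?thesis
    using that[of "\<lambda>y. g y * f y"] by (auto simp: smooth_functions_iff)
qed

lemma smooth_functions_add:
  "f \<in> smooth_functions M \<Longrightarrow> g \<in> smooth_functions M \<Longrightarrow> (\<lambda>y. f y + g y) \<in> smooth_functions M"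
  by (simp add: smooth_functions_iff smooth_at_add)

lemma smooth_functions_mult:
  "f \<in> smooth_functions M \<Longrightarrow> g \<in> smooth_functions M \<Longrightarrow> (\<lambda>y. f y * g y) \<in> smooth_functions M"
  by (simp add: smooth_functions_iff smooth_at_mult)

lemma smooth_functions_diff:
  "f \<in> smooth_functions M \<Longrightarrow> g \<in> smooth_functions M \<Longrightarrow> (\<lambda>y. f y - g y) \<in> smooth_functions M"
  by (simp add: smooth_functions_iff smooth_at_diff)

lemma smooth_functions_const: "(\<lambda>y. c) \<in> smooth_functions M"
  by (simp add: smooth_functions_iff)

lemma smooth_functions_sum:
  "(\<And>i. i \<in> I \<Longrightarrow> f i \<in> smooth_functions M) \<Longrightarrow> (\<lambda>y. \<Sum>i\<in>I. f i y) \<in> smooth_functions M"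
  by (auto simp: smooth_functions_iff intro!: smooth_at_sum)

section \<open>Tangent vectors as derivations at a point\<close>

context
  fixes D x
  assumes D: "D \<in> tangent_space M x"
begin

lemma tangent_add:
  "f \<in> smooth_functions M \<Longrightarrow> g \<in> smooth_functions M \<Longrightarrow> D (\<lambda>y. f y + g y) = D f + D g"
  using D by (simp add: tangent_space_def)

lemma tangent_mult:
  "f \<in> smooth_functions M \<Longrightarrow> g \<in> smooth_functions M \<Longrightarrow> D (\<lambda>y. f y * g y) = D f * g x + f x * D g"
  using D by (simp add: tangent_space_def)

lemma tangent_scale: "f \<in> smooth_functions M \<Longrightarrow> D (\<lambda>y. c * f y) = c * D f"
  using D by (simp add: tangent_space_def)

lemma tangent_zero: "D (\<lambda>y. 0) = 0"
  using tangent_scale[OF smooth_functions_const, of 0] by simp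

lemma tangent_diff:
  assumes "f \<in> smooth_functions M" "g \<in> smooth_functions M"
  shows "D (\<lambda>y. f y - g y) = D f - D g"
proof -
  have "(\<lambda>y. (-1) * g y) \<in> smooth_functions M"
    using assms(2) smooth_functions_const by (intro smooth_functions_mult)
  from tangent_add[OF assms(1) this] tangent_scale[OF assms(2), of "-1"] show ?thesis by simp
qed

lemma tangent_sum:
  "(\<And>i. i \<in> I \<Longrightarrow> f i \<in> smooth_functions M) \<Longrightarrow> D (\<lambda>y. \<Sum>i\<in>I. f i y) = (\<Sum>i\<in>I. D (f i))"
proof (induction I rule: infinite_finite_induct)
  case (insert a I)
  then show ?case
    using tangent_add[of "f a" "\<lambda>y. \<Sum>i\<in>I. f i y"] smooth_functions_sum[of I f] by simp
qed (auto simp: tangent_zero)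

text \<open>For a bump function \<open>h\<close> with value 1 at \<open>x\<close> that vanishes
  wherever \<open>f\<close> and \<open>g\<close> may differ, the product \<open>h * (f - g)\<close>
  is identically 0. The Leibniz rule at \<open>x\<close> then leaves only
  \<open>D (f - g) = 0\<close>.\<close>

lemma tangent_local:
  assumes f: "f \<in> smooth_functions M" and g: "g \<in> smooth_functions M"
    and eq: "\<forall>\<^sub>F y in nhds x. f y = g y"
  shows "D f = D g"
proof -
  obtain W where W: "open W" "x \<in> W" "\<And>y. y \<in> W \<Longrightarrow> f y = g y"
    using eq by (auto simp: eventually_nhds)
  obtain h where h: "h \<in> smooth_functions M" "\<forall>\<^sub>F y in nhds x. h y = 1"
    "\<And>y. y \<notin> W \<Longrightarrow> \<forall>\<^sub>F z in nhds y. h z = 0"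
    using smooth_bump_exists[OF W(1,2)] by blast
  let ?u = "\<lambda>y. f y - g y"
  have u: "?u \<in> smooth_functions M" using f g by (rule smooth_functions_diff)
  have "h y * ?u y = 0" for y
    using W(3)[of y] h(3)[of y, THEN eventually_nhds_x_imp_x] by (cases "y \<in> W") auto
  then have "(\<lambda>y. h y * ?u y) = (\<lambda>y. 0)" by blast
  then have "D (\<lambda>y. h y * ?u y) = 0"
    using tangent_zero by simp
  moreover have "h x = 1" using h(2) by (rule eventually_nhds_x_imp_x)
  moreover have "f x = g x" using eq by (rule eventually_nhds_x_imp_x)
  ultimately have "D ?u = 0"
    using tangent_mult[OF h(1) u] by simp
  then show ?thesis using tangent_diff[OF f g] by simp
qed

end

end

lemma smooth_at_compose:
  fixes M :: "('m::{t2_space,second_countable_topology}, 'e::real_normed_vector) atlas"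
    and N :: "('n::{t2_space,second_countable_topology}, 'f::real_normed_vector) atlas"
  assumes M: "smooth_manifold M" and N: "smooth_manifold N"
    and f: "smooth_map M N f" and g: "smooth_at N (f x) g"
  shows "smooth_at M x (\<lambda>y. g (f y))"
proof -
  obtain W where W: "open W" "f x \<in> W" "smooth_fun_on N W g"
    using g by (auto simp: smooth_at_def)
  obtain V \<psi> where V: "(V, \<psi>) \<in> N" "f x \<in> V"
    using chart_exists[OF N] by blast
  obtain F :: "'f set" where F: "finite F" "span F = UNIV"
    using manifold_finite_dimensional[OF N] by blast
  have f_open: "open (f -` T)" if "open T" for T
    using f that using continuous_on_open_vimage[OF open_UNIV, of f] by (simp add: smooth_map_def)
  have "smooth_fun_on M (f -` (V \<inter> W)) (\<lambda>y. g (f y))"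
    unfolding smooth_fun_on_def
  proof clarify
    fix U \<phi> assume U: "(U, \<phi>) \<in> M"
    let ?S = "\<phi> ` (U \<inter> f -` (V \<inter> W))"
    have S: "open ?S"
      using chartD(1)[OF N V(1)] W(1) by (intro open_chart_image[OF M U] f_open open_Int)
    have "smooth_on (\<phi> ` (U \<inter> f -` V)) (\<psi> \<circ> f \<circ> inv_into U \<phi>)"
      using f U V(1) by (auto simp: smooth_map_def)
    then have 1: "smooth_on ?S (\<psi> \<circ> f \<circ> inv_into U \<phi>)"
      by (rule smooth_on_subset) auto
    have 2: "smooth_on (\<psi> ` (V \<inter> W)) (g \<circ> inv_into V \<psi>)"
      using W(3) V(1) by (auto simp: smooth_fun_on_def)
    have "smooth_on ?S (\<lambda>z. (g \<circ> inv_into V \<psi>) ((\<psi> \<circ> f \<circ> inv_into U \<phi>) z))"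
      using chart_inv[OF M U]
      by (intro smooth_on_compose[OF F S open_chart_image[OF N V(1) W(1)] _ 1 2]) auto
    then show "smooth_on ?S ((\<lambda>y. g (f y)) \<circ> inv_into U \<phi>)"
      by (subst smooth_on_cong[OF S, where g = "\<lambda>z. (g \<circ> inv_into V \<psi>) ((\<psi> \<circ> f \<circ> inv_into U \<phi>) z)"])
        (use chart_inv[OF M U] chart_inv[OF N V(1)] in auto)
  qed
  moreover have "open (f -` (V \<inter> W))"
    using f_open chartD(1)[OF N V(1)] W(1) by blast
  ultimately show ?thesis
    using V W by (auto simp: smooth_at_def)
qed

subsection \<open>Alternating forms on a vector space\<close>

declare One_nat_def [simp del]

lemma sum_fun_apply: "(\<Sum>i\<in>I. f i) x = (\<Sum>i\<in>I. f i x)"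
  by (induction I rule: infinite_finite_induct) auto

lemma basis_of_subspace: "basis_of V n b \<Longrightarrow> subspace V"
  by (auto simp: basis_of_def)

lemma basis_of_mem: "basis_of V n b \<Longrightarrow> i < n \<Longrightarrow> b i \<in> V"
  by (auto simp: basis_of_def intro: span_base)

lemma basis_of_coords:
  assumes "basis_of V n b"
  obtains l where "\<And>v. v \<in> V \<Longrightarrow> v = (\<Sum>i<n. l i v *\<^sub>R b i)"
    "\<And>i c. i < n \<Longrightarrow> l i (\<Sum>j<n. c j *\<^sub>R b j) = c i"
    "\<And>i v w s t. v \<in> V \<Longrightarrow> w \<in> V \<Longrightarrow> l i (s *\<^sub>R v + t *\<^sub>R w) = s * l i v + t * l i w"
proof -
  let ?B = "b ` {..<n}"
  have inj: "inj_on b {..<n}" and ind: "independent ?B" and sp: "span ?B = V"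
    using assms by (auto simp: basis_of_def)
  define l where "l = (\<lambda>i v. representation ?B v (b i))"
  have 1: "v = (\<Sum>i<n. l i v *\<^sub>R b i)" if "v \<in> V" for v
    using sum_representation_eq[OF ind, of v ?B] that sp
      sum.reindex[OF inj, of "\<lambda>u. representation ?B v u *\<^sub>R u"]
    by (simp add: l_def comp_def)
  have 3: "l i (s *\<^sub>R v + t *\<^sub>R w) = s * l i v + t * l i w" if "v \<in> V" "w \<in> V" for i v w s t
  proof -
    have "v \<in> span ?B" "w \<in> span ?B" using that sp by auto
    then show ?thesis
      by (simp add: l_def representation_add[OF ind] representation_scale[OF ind] span_scale)
  qed
  have 2: "l i (\<Sum>j<n. c j *\<^sub>R b j) = c i" if i: "i < n" for i c
  proof -
    have mem: "b j \<in> span ?B" if "j < n" for j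
      using that by (auto intro: span_base)
    have "l i (\<Sum>j<n. c j *\<^sub>R b j) = (\<Sum>j<n. representation ?B (c j *\<^sub>R b j) (b i))"
      unfolding l_def by (subst representation_sum[OF ind]) (auto intro: span_scale mem)
    also have "\<dots> = (\<Sum>j<n. if j = i then c i else 0)"
      using i inj by (intro sum.cong)
        (auto simp: representation_scale[OF ind] mem representation_basis[OF ind] inj_on_def)
    also have "\<dots> = c i" using i by simp
    finally show ?thesis .
  qed
  show ?thesis using that 1 2 3 by blast
qed

lemma basis_of_unique:
  assumes "basis_of V n b" "(\<Sum>j<n. c j *\<^sub>R b j) = (\<Sum>j<n. d j *\<^sub>R b j)" "i < n"
  shows "c i = d i"
  using basis_of_coords[OF assms(1)] assms(2,3) by metis

definition covector :: "'v set \<Rightarrow> ('v \<Rightarrow> real) \<Rightarrow> 'v list \<Rightarrow> real"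
  where "covector V l vs = (case vs of [v] \<Rightarrow> if v \<in> V then l v else 0 | _ \<Rightarrow> 0)"

lemma covector_simps [simp]: "v \<in> V \<Longrightarrow> covector V l [v] = l v"
  by (simp add: covector_def)

lemma covector_in_alt_forms:
  assumes "subspace V"
    "\<And>v w s t. v \<in> V \<Longrightarrow> w \<in> V \<Longrightarrow> l (s *\<^sub>R v + t *\<^sub>R w) = s * l v + t * l w"
  shows "covector V l \<in> alt_forms 1 V"
proof -
  have "covector V l vs = 0" if "\<not> (length vs = 1 \<and> set vs \<subseteq> V) \<or> \<not> distinct vs" for vs
    using that by (auto simp: covector_def split: list.split)
  then show ?thesis
    using assms subspace_add[OF assms(1)] subspace_scale[OF assms(1)]
    by (auto simp: alt_forms_def)
qed

lemma alt_forms_support: "\<omega> \<in> alt_forms k V \<Longrightarrow> \<not> (length vs = k \<and> set vs \<subseteq> V) \<Longrightarrow> \<omega> vs = 0"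
  by (simp add: alt_forms_def)

lemma alt_forms_linear:
  assumes "\<omega> \<in> alt_forms k V" "v \<in> V" "w \<in> V"
    "length us + 1 + length ws = k" "set us \<subseteq> V" "set ws \<subseteq> V"
  shows "\<omega> (us @ (s *\<^sub>R v + t *\<^sub>R w) # ws) = s * \<omega> (us @ v # ws) + t * \<omega> (us @ w # ws)"
proof -
  have "\<forall>us ws. \<forall>v\<in>V. \<forall>w\<in>V. \<forall>a b. length us + 1 + length ws = k \<and> set us \<subseteq> V \<and> set ws \<subseteq> V \<longrightarrow>
       \<omega> (us @ (a *\<^sub>R v + b *\<^sub>R w) # ws) = a * \<omega> (us @ v # ws) + b * \<omega> (us @ w # ws)"
    using assms(1) by (simp add: alt_forms_def)
  from this[rule_format, OF assms(2,3), of us ws s t] assms(4-6) show ?thesis by blast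
qed

lemma alt_forms_1_linear:
  assumes "\<alpha> \<in> alt_forms 1 V" "v \<in> V" "w \<in> V"
  shows "\<alpha> [s *\<^sub>R v + t *\<^sub>R w] = s * \<alpha> [v] + t * \<alpha> [w]"
  using alt_forms_linear[OF assms, of "[]" "[]"] by simp

lemma alt_forms_1_eqI:
  assumes "\<alpha> \<in> alt_forms 1 V" "\<beta> \<in> alt_forms 1 V" "\<And>v. v \<in> V \<Longrightarrow> \<alpha> [v] = \<beta> [v]"
  shows "\<alpha> = \<beta>"
proof
  fix vs
  show "\<alpha> vs = \<beta> vs"
  proof (cases "length vs = 1 \<and> set vs \<subseteq> V")
    case True
    then obtain v where "vs = [v]" "v \<in> V" by (auto simp: length_Suc_conv One_nat_def)
    then show ?thesis using assms(3) by simp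
  qed (use alt_forms_support[OF assms(1)] alt_forms_support[OF assms(2)] in auto)
qed

context
  fixes V :: "'v::real_vector set"
  assumes V: "subspace V"
begin

lemma alt_forms_1_add: "\<alpha> \<in> alt_forms 1 V \<Longrightarrow> v \<in> V \<Longrightarrow> w \<in> V \<Longrightarrow> \<alpha> [v + w] = \<alpha> [v] + \<alpha> [w]"
  using alt_forms_1_linear[of \<alpha> V v w 1 1] by simp

lemma alt_forms_1_scale: "\<alpha> \<in> alt_forms 1 V \<Longrightarrow> v \<in> V \<Longrightarrow> \<alpha> [s *\<^sub>R v] = s * \<alpha> [v]"
  using alt_forms_1_linear[of \<alpha> V v v s 0] by simp

lemma alt_forms_1_zero: "\<alpha> \<in> alt_forms 1 V \<Longrightarrow> \<alpha> [0] = 0"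
  using alt_forms_1_scale[of \<alpha> 0 0] subspace_0[OF V] by simp

lemma alt_forms_1_diff: "\<alpha> \<in> alt_forms 1 V \<Longrightarrow> v \<in> V \<Longrightarrow> w \<in> V \<Longrightarrow> \<alpha> [v - w] = \<alpha> [v] - \<alpha> [w]"
  using alt_forms_1_linear[of \<alpha> V v w 1 "-1"] by simp

lemma alt_forms_1_minus: "\<alpha> \<in> alt_forms 1 V \<Longrightarrow> v \<in> V \<Longrightarrow> \<alpha> [- v] = - \<alpha> [v]"
  using alt_forms_1_scale[of \<alpha> v "-1"] by simp

lemma alt_forms_1_sum:
  assumes "\<alpha> \<in> alt_forms 1 V"
  shows "(\<And>i. i \<in> I \<Longrightarrow> v i \<in> V) \<Longrightarrow> \<alpha> [\<Sum>i\<in>I. c i *\<^sub>R v i] = (\<Sum>i\<in>I. c i * \<alpha> [v i])"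
proof (induction I rule: infinite_finite_induct)
  case (insert a I)
  have "(\<Sum>i\<in>I. c i *\<^sub>R v i) \<in> V"
    using insert.prems by (intro subspace_sum V subspace_scale) auto
  then show ?case
    using insert alt_forms_1_add[OF assms, of "c a *\<^sub>R v a"] alt_forms_1_scale[OF assms] V
    by (simp add: subspace_scale)
qed (simp_all add: alt_forms_1_zero[OF assms])

lemma alt_forms_1_subspace: "subspace (alt_forms 1 V)"
proof -
  have "(0 :: 'v list \<Rightarrow> real) \<in> alt_forms 1 V"
    by (simp add: alt_forms_def)
  moreover have "\<alpha> + \<beta> \<in> alt_forms 1 V" if "\<alpha> \<in> alt_forms 1 V" "\<beta> \<in> alt_forms 1 V" for \<alpha> \<beta>
    using that unfolding alt_forms_def by (auto simp: algebra_simps)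
  moreover have "c *\<^sub>R \<alpha> \<in> alt_forms 1 V" if "\<alpha> \<in> alt_forms 1 V" for c \<alpha>
    using that unfolding alt_forms_def by (auto simp: scaleR_fun_def algebra_simps)
  ultimately show ?thesis by (simp add: subspace_def)
qed

lemma alt_forms_2_linear_1:
  assumes "\<omega> \<in> alt_forms 2 V" "v \<in> V" "w \<in> V" "u \<in> V"
  shows "\<omega> [s *\<^sub>R v + t *\<^sub>R w, u] = s * \<omega> [v, u] + t * \<omega> [w, u]"
  using alt_forms_linear[OF assms(1-3), of "[]" "[u]"] assms(4) by simp

lemma alt_forms_2_linear_2:
  assumes "\<omega> \<in> alt_forms 2 V" "v \<in> V" "w \<in> V" "u \<in> V"
  shows "\<omega> [u, s *\<^sub>R v + t *\<^sub>R w] = s * \<omega> [u, v] + t * \<omega> [u, w]"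
  using alt_forms_linear[OF assms(1-3), of "[u]" "[]"] assms(4) by simp

lemma alt_forms_2_self: "\<omega> \<in> alt_forms 2 V \<Longrightarrow> \<omega> [v, v] = 0"
  by (simp add: alt_forms_def)

lemma alt_forms_2_skew:
  assumes "\<omega> \<in> alt_forms 2 V" "v \<in> V" "w \<in> V"
  shows "\<omega> [v, w] = - \<omega> [w, v]"
proof -
  have "v + w \<in> V" using assms V by (simp add: subspace_add)
  then have "\<omega> [v + w, v + w] = \<omega> [v, v] + \<omega> [v, w] + (\<omega> [w, v] + \<omega> [w, w])"
    using alt_forms_2_linear_1[OF assms(1-3), of "v + w" 1 1]
      alt_forms_2_linear_2[OF assms(1-3), of v 1 1] alt_forms_2_linear_2[OF assms(1-3), of w 1 1] assms
    by simp
  then show ?thesis using alt_forms_2_self[OF assms(1)] by simp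
qed

lemma alt_forms_2_zero: "\<omega> \<in> alt_forms 2 V \<Longrightarrow> u \<in> V \<Longrightarrow> \<omega> [u, 0] = 0" "\<omega> \<in> alt_forms 2 V \<Longrightarrow> u \<in> V \<Longrightarrow> \<omega> [0, u] = 0"
  using alt_forms_2_linear_2[of \<omega> 0 0 u 0 0] alt_forms_2_linear_1[of \<omega> 0 0 u 0 0] subspace_0[OF V] by simp_all

lemma alt_forms_2_sum:
  assumes "\<omega> \<in> alt_forms 2 V" "u \<in> V"
  shows "(\<And>i. i \<in> I \<Longrightarrow> v i \<in> V) \<Longrightarrow> \<omega> [u, \<Sum>i\<in>I. c i *\<^sub>R v i] = (\<Sum>i\<in>I. c i * \<omega> [u, v i])"
    and "(\<And>i. i \<in> I \<Longrightarrow> v i \<in> V) \<Longrightarrow> \<omega> [\<Sum>i\<in>I. c i *\<^sub>R v i, u] = (\<Sum>i\<in>I. c i * \<omega> [v i, u])"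
proof -
  show *: "(\<And>i. i \<in> I \<Longrightarrow> v i \<in> V) \<Longrightarrow> \<omega> [u, \<Sum>i\<in>I. c i *\<^sub>R v i] = (\<Sum>i\<in>I. c i * \<omega> [u, v i])"
  proof (induction I rule: infinite_finite_induct)
    case (insert a I)
    have "(\<Sum>i\<in>I. c i *\<^sub>R v i) \<in> V"
      using insert.prems by (intro subspace_sum V subspace_scale) auto
    then show ?case
      using insert alt_forms_2_linear_2[OF assms(1), of "v a" "\<Sum>i\<in>I. c i *\<^sub>R v i" u "c a" 1] assms
      by simp
  qed (simp_all add: alt_forms_2_zero[OF assms])
  assume I: "\<And>i. i \<in> I \<Longrightarrow> v i \<in> V"
  then have "(\<Sum>i\<in>I. c i *\<^sub>R v i) \<in> V"
    by (intro subspace_sum V subspace_scale) auto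
  then have "\<omega> [\<Sum>i\<in>I. c i *\<^sub>R v i, u] = - \<omega> [u, \<Sum>i\<in>I. c i *\<^sub>R v i]"
    using assms by (intro alt_forms_2_skew)
  also have "\<dots> = - (\<Sum>i\<in>I. c i * \<omega> [u, v i])"
    using * I by simp
  also have "\<dots> = (\<Sum>i\<in>I. c i * \<omega> [v i, u])"
    using I alt_forms_2_skew[OF assms(1) assms(2)] by (simp add: flip: sum_negf)
  finally show "\<omega> [\<Sum>i\<in>I. c i *\<^sub>R v i, u] = (\<Sum>i\<in>I. c i * \<omega> [v i, u])" .
qed

end

definition bilinear_form :: "'v set \<Rightarrow> ('v \<Rightarrow> 'v \<Rightarrow> real) \<Rightarrow> 'v list \<Rightarrow> real"
  where "bilinear_form V b vs = (case vs of [v, w] \<Rightarrow> if v \<in> V \<and> w \<in> V then b v w else 0 | _ \<Rightarrow> 0)"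

lemma bilinear_form_simps [simp]: "v \<in> V \<Longrightarrow> w \<in> V \<Longrightarrow> bilinear_form V b [v, w] = b v w"
  by (simp add: bilinear_form_def)

lemma bilinear_form_in_alt_forms:
  assumes V: "subspace V"
    and lin: "\<And>u v w s t. u \<in> V \<Longrightarrow> v \<in> V \<Longrightarrow> w \<in> V \<Longrightarrow> b (s *\<^sub>R v + t *\<^sub>R w) u = s * b v u + t * b w u"
      "\<And>u v w s t. u \<in> V \<Longrightarrow> v \<in> V \<Longrightarrow> w \<in> V \<Longrightarrow> b u (s *\<^sub>R v + t *\<^sub>R w) = s * b u v + t * b u w"
    and self: "\<And>v. v \<in> V \<Longrightarrow> b v v = 0"
  shows "bilinear_form V b \<in> alt_forms 2 V"
  unfolding alt_forms_def mem_Collect_eq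
proof (intro conjI allI impI ballI)
  fix vs :: "'a list"
  show "bilinear_form V b vs = 0" if "\<not> (length vs = 2 \<and> set vs \<subseteq> V)"
    using that by (auto simp: bilinear_form_def split: list.split)
  show "bilinear_form V b vs = 0" if "\<not> distinct vs"
    using that self by (auto simp: bilinear_form_def split: list.split)
next
  fix us ws :: "'a list" and v w s t
  assume vw: "v \<in> V" "w \<in> V" and A: "length us + 1 + length ws = 2 \<and> set us \<subseteq> V \<and> set ws \<subseteq> V"
  then consider u where "us = []" "ws = [u]" "u \<in> V" | u where "us = [u]" "ws = []" "u \<in> V"
    by (cases us; cases ws) auto
  then show "bilinear_form V b (us @ (s *\<^sub>R v + t *\<^sub>R w) # ws) =
      s * bilinear_form V b (us @ v # ws) + t * bilinear_form V b (us @ w # ws)"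
    using vw lin subspace_add[OF V subspace_scale[OF V] subspace_scale[OF V]]
    by cases auto
qed

lemma alt_forms_2_eqI:
  assumes "\<alpha> \<in> alt_forms 2 V" "\<beta> \<in> alt_forms 2 V"
    "\<And>v w. v \<in> V \<Longrightarrow> w \<in> V \<Longrightarrow> \<alpha> [v, w] = \<beta> [v, w]"
  shows "\<alpha> = \<beta>"
proof
  fix vs
  show "\<alpha> vs = \<beta> vs"
  proof (cases "length vs = 2 \<and> set vs \<subseteq> V")
    case True
    then obtain v w where "vs = [v, w]" "v \<in> V" "w \<in> V"
      by (auto simp: length_Suc_conv numeral_2_eq_2)
    then show ?thesis using assms(3) by simp
  qed (use alt_forms_support[OF assms(1)] alt_forms_support[OF assms(2)] in auto)
qed

lemma alt_forms_0_iff: "\<omega> \<in> alt_forms 0 V \<longleftrightarrow> (\<forall>vs. vs \<noteq> [] \<longrightarrow> \<omega> vs = 0)"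
  unfolding alt_forms_def by (auto, metis distinct.simps(1))

section \<open>Dual bases and the expansions they give\<close>

definition dual_bases where
  "dual_bases V n b \<epsilon> \<longleftrightarrow> basis_of V n b \<and> (\<forall>i<n. \<epsilon> i \<in> alt_forms 1 V) \<and>
    (\<forall>i<n. \<forall>j<n. \<epsilon> i [b j] = (if i = j then 1 else 0))"

lemma dual_basis_exists:
  assumes "basis_of V n b"
  shows "\<exists>\<epsilon>. dual_bases V n b \<epsilon>"
proof -
  obtain l where "\<And>v. v \<in> V \<Longrightarrow> v = (\<Sum>i<n. l i v *\<^sub>R b i)"
    and l: "\<And>i c. i < n \<Longrightarrow> l i (\<Sum>j<n. c j *\<^sub>R b j) = c i"
    "\<And>i v w s t. v \<in> V \<Longrightarrow> w \<in> V \<Longrightarrow> l i (s *\<^sub>R v + t *\<^sub>R w) = s * l i v + t * l i w"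
    by (rule basis_of_coords[OF assms], rule that)
  have "l i (b j) = (if i = j then 1 else 0)" if "i < n" "j < n" for i j
  proof -
    have "b j = (\<Sum>k<n. (if k = j then 1 else 0) *\<^sub>R b k)"
      using that(2) by (simp add: if_distrib[of "\<lambda>c. c *\<^sub>R _"] cong: if_cong)
    then show ?thesis using l(1)[OF that(1), of "\<lambda>k. if k = j then 1 else 0"] by simp
  qed
  then show ?thesis
    using assms basis_of_mem[OF assms] unfolding dual_bases_def
    by (intro exI[of _ "\<lambda>i. covector V (l i)"] conjI allI impI)
      (auto intro!: covector_in_alt_forms basis_of_subspace l(2))
qed

context
  fixes V :: "'v::real_vector set" and n b \<epsilon>
  assumes db: "dual_bases V n b \<epsilon>"
begin

lemma dual_bases_subspace: "subspace V"
  using db basis_of_subspace unfolding dual_bases_def by blast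

lemma dual_bases_mem: "i < n \<Longrightarrow> b i \<in> V" "i < n \<Longrightarrow> \<epsilon> i \<in> alt_forms 1 V"
  using db basis_of_mem by (auto simp: dual_bases_def)

lemma dual_bases_pairing: "i < n \<Longrightarrow> j < n \<Longrightarrow> \<epsilon> i [b j] = (if i = j then 1 else 0)"
  using db by (simp add: dual_bases_def)

lemma dual_bases_coord:
  assumes "i < n"
  shows "\<epsilon> i [\<Sum>j<n. c j *\<^sub>R b j] = c i"
proof -
  have "\<epsilon> i [\<Sum>j<n. c j *\<^sub>R b j] = (\<Sum>j<n. c j * \<epsilon> i [b j])"
    using assms dual_bases_mem by (intro alt_forms_1_sum[OF dual_bases_subspace]) auto
  also have "\<dots> = (\<Sum>j<n. if j = i then c i else 0)"
    using dual_bases_pairing[OF assms] by (intro sum.cong) auto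
  finally show ?thesis using assms by simp
qed

lemma dual_bases_vector:
  assumes "v \<in> V"
  shows "(\<Sum>i<n. \<epsilon> i [v] *\<^sub>R b i) = v"
proof -
  obtain c where v: "v = (\<Sum>i<n. c i *\<^sub>R b i)"
    using basis_of_coords[of V n b] db assms unfolding dual_bases_def by metis
  show ?thesis
    unfolding v by (intro sum.cong refl) (simp add: dual_bases_coord)
qed

lemma dual_bases_form:
  assumes \<alpha>: "\<alpha> \<in> alt_forms 1 V"
  shows "(\<Sum>i<n. \<alpha> [b i] *\<^sub>R \<epsilon> i) = \<alpha>"
proof (rule alt_forms_1_eqI[OF _ \<alpha>])
  show "(\<Sum>i<n. \<alpha> [b i] *\<^sub>R \<epsilon> i) \<in> alt_forms 1 V"
    using dual_bases_mem by (intro subspace_sum subspace_scale alt_forms_1_subspace dual_bases_subspace) auto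
  fix v assume v: "v \<in> V"
  have "\<alpha> [v] = (\<Sum>i<n. \<epsilon> i [v] * \<alpha> [b i])"
    using alt_forms_1_sum[OF dual_bases_subspace \<alpha>, of "{..<n}" b "\<lambda>i. \<epsilon> i [v]"] dual_bases_mem(1)
    by (simp add: dual_bases_vector[OF v])
  then show "(\<Sum>i<n. \<alpha> [b i] *\<^sub>R \<epsilon> i) [v] = \<alpha> [v]"
    by (simp add: scaleR_fun_def mult.commute sum_fun_apply)
qed

lemma dual_bases_bilinear:
  assumes \<omega>: "\<omega> \<in> alt_forms 2 (alt_forms 1 V)" and \<alpha>: "\<alpha> \<in> alt_forms 1 V" and \<beta>: "\<beta> \<in> alt_forms 1 V"
  shows "\<omega> [\<alpha>, \<beta>] = (\<Sum>i<n. \<Sum>j<n. \<alpha> [b i] * (\<beta> [b j] * \<omega> [\<epsilon> i, \<epsilon> j]))"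
proof -
  have D: "subspace (alt_forms 1 V)" by (rule alt_forms_1_subspace[OF dual_bases_subspace])
  have "\<omega> [\<alpha>, \<beta>] = (\<Sum>i<n. \<alpha> [b i] * \<omega> [\<epsilon> i, \<beta>])"
    using alt_forms_2_sum(2)[OF D \<omega> \<beta>, of "{..<n}" \<epsilon> "\<lambda>i. \<alpha> [b i]"] dual_bases_mem(2)
    by (simp add: dual_bases_form[OF \<alpha>])
  also have "\<dots> = (\<Sum>i<n. \<alpha> [b i] * (\<Sum>j<n. \<beta> [b j] * \<omega> [\<epsilon> i, \<epsilon> j]))"
    using alt_forms_2_sum(1)[OF D \<omega> dual_bases_mem(2), of _ "{..<n}" \<epsilon> "\<lambda>i. \<beta> [b i]"] dual_bases_mem(2)
    by (intro sum.cong refl) (simp add: dual_bases_form[OF \<beta>])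
  finally show ?thesis by (simp add: sum_distrib_left)
qed

end

subsection \<open>Germs of sections, and extension to global sections and forms\<close>

text \<open>Only one frame around \<open>x\<close> is asked for, which keeps the condition easy to
  establish; coefficients in any other frame follow by a change of frame.\<close>

definition sec_at ::
    "('m::topological_space, 'e::real_normed_vector, 'v::real_vector, 'z) vbundle_scheme \<Rightarrow> 'm \<Rightarrow> ('m \<Rightarrow> 'v) \<Rightarrow> bool"
  where "sec_at E x s \<longleftrightarrow> (\<exists>(U, e)\<in>frames E. x \<in> U \<and> (\<exists>c. (\<forall>i<bdl_rank E. smooth_at (base E) x (c i)) \<and>
    (\<forall>\<^sub>F y in nhds x. s y = (\<Sum>i<bdl_rank E. c i y *\<^sub>R e i y))))"

context
  fixes E :: "('m::{t2_space,second_countable_topology}, 'e::real_normed_vector, 'v::real_vector, 'z) vbundle_scheme"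
  assumes E: "vector_bundle E"
begin

lemma bundle_base: "smooth_manifold (base E)"
  using E by (simp add: vector_bundle_def)

lemma frame_exists: "\<exists>U e. (U, e) \<in> frames E \<and> x \<in> U"
proof -
  have "x \<in> (\<Union>(U, e)\<in>frames E. U)"
    using E by (simp add: vector_bundle_def)
  then show ?thesis by auto
qed

lemma frameD:
  assumes "(U, e) \<in> frames E"
  shows "open U" "x \<in> U \<Longrightarrow> basis_of (fibre E x) (bdl_rank E) (\<lambda>i. e i x)"
  using E assms by (auto simp: vector_bundle_def)

lemma frame_change:
  assumes "(U, e) \<in> frames E" "(V, b) \<in> frames E" "i < bdl_rank E"
  shows "smooth_comb (base E) (U \<inter> V) (bdl_rank E) e (b i)"
proof -
  have "\<forall>p\<in>frames E. \<forall>q\<in>frames E. \<forall>i<bdl_rank E.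
      smooth_comb (base E) (fst p \<inter> fst q) (bdl_rank E) (snd p) (snd q i)"
    using E by (simp add: vector_bundle_def case_prod_unfold)
  from bspec[OF bspec[OF this assms(1)] assms(2)] assms(3) show ?thesis by simp
qed

lemma fibre_subspace: "subspace (fibre E x)"
  using frame_exists[of x] frameD(2) basis_of_subspace by blast

text \<open>The coefficients in the new frame are the old ones multiplied by the transition matrix,
  whose entries are smooth.\<close>

lemma sec_at_in_frame:
  assumes "sec_at E x s" "(V, b) \<in> frames E" "x \<in> V"
  shows "\<exists>c. (\<forall>i<bdl_rank E. smooth_at (base E) x (c i)) \<and>
    (\<forall>\<^sub>F y in nhds x. s y = (\<Sum>i<bdl_rank E. c i y *\<^sub>R b i y))"
proof -
  let ?n = "bdl_rank E"
  obtain U e c where U: "(U, e) \<in> frames E" "x \<in> U"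
    and c: "\<And>i. i < ?n \<Longrightarrow> smooth_at (base E) x (c i)" "\<forall>\<^sub>F y in nhds x. s y = (\<Sum>i<?n. c i y *\<^sub>R e i y)"
    using assms(1) unfolding sec_at_def by auto
  have "\<exists>d. \<forall>i<?n. (\<forall>j<?n. smooth_fun_on (base E) (V \<inter> U) (d i j)) \<and>
      (\<forall>y\<in>V \<inter> U. e i y = (\<Sum>j<?n. d i j y *\<^sub>R b j y))"
    using frame_change[OF assms(2) U(1)] unfolding smooth_comb_def by metis
  then obtain d where d: "\<And>i j. i < ?n \<Longrightarrow> j < ?n \<Longrightarrow> smooth_fun_on (base E) (V \<inter> U) (d i j)"
    "\<And>i y. i < ?n \<Longrightarrow> y \<in> V \<inter> U \<Longrightarrow> e i y = (\<Sum>j<?n. d i j y *\<^sub>R b j y)"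
    by blast
  have VU: "open (V \<inter> U)" "x \<in> V \<inter> U"
    using frameD(1)[OF assms(2)] frameD(1)[OF U(1)] U(2) assms(3) by auto
  have "smooth_at (base E) x (\<lambda>y. \<Sum>i<?n. c i y * d i j y)" if "j < ?n" for j
    using c(1) d(1)[OF _ that] VU by (intro smooth_at_sum[OF bundle_base] smooth_at_mult[OF bundle_base]) (auto simp: smooth_at_def)
  moreover have "\<forall>\<^sub>F y in nhds x. s y = (\<Sum>j<?n. (\<Sum>i<?n. c i y * d i j y) *\<^sub>R b j y)"
    using c(2) eventually_nhds_in_open[OF VU]
  proof eventually_elim
    case (elim y)
    have "s y = (\<Sum>i<?n. c i y *\<^sub>R (\<Sum>j<?n. d i j y *\<^sub>R b j y))"
      using elim d(2) by simp
    also have "\<dots> = (\<Sum>i<?n. \<Sum>j<?n. (c i y * d i j y) *\<^sub>R b j y)"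
      by (simp add: scaleR_sum_right)
    also have "\<dots> = (\<Sum>j<?n. (\<Sum>i<?n. c i y * d i j y) *\<^sub>R b j y)"
      by (subst sum.swap) (simp add: scaleR_sum_left)
    finally show ?case .
  qed
  ultimately show ?thesis by (intro exI[of _ "\<lambda>j y. \<Sum>i<?n. c i y * d i j y"]) auto
qed

lemma sec_atI:
  assumes "(U, e) \<in> frames E" "x \<in> U" "\<And>i. i < bdl_rank E \<Longrightarrow> smooth_at (base E) x (c i)"
    "\<forall>\<^sub>F y in nhds x. s y = (\<Sum>i<bdl_rank E. c i y *\<^sub>R e i y)"
  shows "sec_at E x s"
  unfolding sec_at_def using assms by (intro bexI[of _ "(U, e)"]) auto

lemma sec_at_cong:
  assumes "sec_at E x s" "\<forall>\<^sub>F y in nhds x. s y = t y"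
  shows "sec_at E x t"
proof -
  obtain U e where U: "(U, e) \<in> frames E" "x \<in> U" using frame_exists by blast
  obtain c where c: "\<And>i. i<bdl_rank E \<Longrightarrow> smooth_at (base E) x (c i)"
    "\<forall>\<^sub>F y in nhds x. s y = (\<Sum>i<bdl_rank E. c i y *\<^sub>R e i y)"
    using sec_at_in_frame[OF assms(1) U] by blast
  have "\<forall>\<^sub>F y in nhds x. t y = (\<Sum>i<bdl_rank E. c i y *\<^sub>R e i y)"
    using c(2) assms(2) by eventually_elim simp
  with U c(1) show ?thesis by (rule sec_atI)
qed

lemma sec_at_add:
  assumes "sec_at E x s" "sec_at E x t"
  shows "sec_at E x (\<lambda>y. s y + t y)"
proof -
  obtain U e where U: "(U, e) \<in> frames E" "x \<in> U" using frame_exists by blast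
  obtain c where c: "\<forall>i<bdl_rank E. smooth_at (base E) x (c i)"
    "\<forall>\<^sub>F y in nhds x. s y = (\<Sum>i<bdl_rank E. c i y *\<^sub>R e i y)"
    using sec_at_in_frame[OF assms(1) U] by blast
  obtain d where d: "\<forall>i<bdl_rank E. smooth_at (base E) x (d i)"
    "\<forall>\<^sub>F y in nhds x. t y = (\<Sum>i<bdl_rank E. d i y *\<^sub>R e i y)"
    using sec_at_in_frame[OF assms(2) U] by blast
  show ?thesis
  proof (rule sec_atI[OF U])
    show "smooth_at (base E) x (\<lambda>y. c i y + d i y)" if "i < bdl_rank E" for i
      using c d that by (auto intro: smooth_at_add[OF bundle_base])
    show "\<forall>\<^sub>F y in nhds x. s y + t y = (\<Sum>i<bdl_rank E. (c i y + d i y) *\<^sub>R e i y)"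
      using c(2) d(2) by eventually_elim (simp add: scaleR_add_left sum.distrib)
  qed
qed

lemma sec_at_scale:
  assumes "sec_at E x s" "smooth_at (base E) x f"
  shows "sec_at E x (\<lambda>y. f y *\<^sub>R s y)"
proof -
  obtain U e where U: "(U, e) \<in> frames E" "x \<in> U" using frame_exists by blast
  obtain c where c: "\<forall>i<bdl_rank E. smooth_at (base E) x (c i)"
    "\<forall>\<^sub>F y in nhds x. s y = (\<Sum>i<bdl_rank E. c i y *\<^sub>R e i y)"
    using sec_at_in_frame[OF assms(1) U] by blast
  show ?thesis
  proof (rule sec_atI[OF U])
    show "smooth_at (base E) x (\<lambda>y. f y * c i y)" if "i < bdl_rank E" for i
      using c assms that by (auto intro: smooth_at_mult[OF bundle_base])
    show "\<forall>\<^sub>F y in nhds x. f y *\<^sub>R s y = (\<Sum>i<bdl_rank E. (f y * c i y) *\<^sub>R e i y)"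
      using c(2) by eventually_elim (simp add: scaleR_sum_right)
  qed
qed

lemma sec_at_zero: "sec_at E x (\<lambda>y. 0)"
proof -
  obtain U e where U: "(U, e) \<in> frames E" "x \<in> U" using frame_exists by blast
  show ?thesis
    by (rule sec_atI[OF U, of "\<lambda>i y. 0"]) (auto simp: smooth_at_const[OF bundle_base])
qed

lemma sec_at_sum: "(\<And>i. i \<in> I \<Longrightarrow> sec_at E x (s i)) \<Longrightarrow> sec_at E x (\<lambda>y. \<Sum>i\<in>I. s i y)"
  by (induction I rule: infinite_finite_induct) (auto intro: sec_at_add simp: sec_at_zero)

lemma sec_at_frame:
  assumes "(U, e) \<in> frames E" "x \<in> U" "i < bdl_rank E"
  shows "sec_at E x (e i)"
proof (rule sec_atI[OF assms(1,2), of "\<lambda>j y. if j = i then 1 else 0"])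
  show "\<forall>\<^sub>F y in nhds x. e i y = (\<Sum>j<bdl_rank E. (if j = i then 1 else 0) *\<^sub>R e j y)"
    using assms(3) by (simp add: if_distrib[of "\<lambda>c. c *\<^sub>R _"] cong: if_cong)
qed (auto simp: smooth_at_const[OF bundle_base])

lemma sec_at_eventually:
  assumes "sec_at E x s"
  shows "\<forall>\<^sub>F y in nhds x. sec_at E y s"
proof -
  obtain U e where U: "(U, e) \<in> frames E" "x \<in> U" using frame_exists by blast
  obtain c where c: "\<And>i. i<bdl_rank E \<Longrightarrow> smooth_at (base E) x (c i)"
    "\<forall>\<^sub>F y in nhds x. s y = (\<Sum>i<bdl_rank E. c i y *\<^sub>R e i y)"
    using sec_at_in_frame[OF assms U] by blast
  have "\<forall>\<^sub>F y in nhds x. \<forall>i\<in>{..<bdl_rank E}. smooth_at (base E) y (c i)"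
    using c(1) by (intro eventually_ball_finite) (auto intro: smooth_at_eventually[OF bundle_base])
  moreover have "\<forall>\<^sub>F y in nhds x. \<forall>\<^sub>F z in nhds y. s z = (\<Sum>i<bdl_rank E. c i z *\<^sub>R e i z)"
    using c(2) by (simp add: eventually_eventually)
  ultimately show ?thesis
    using eventually_nhds_in_open[OF frameD(1)[OF U(1)] U(2)]
    by eventually_elim (rule sec_atI[OF U(1)], auto)
qed

lemma sec_at_fibre:
  assumes "sec_at E x s"
  shows "s x \<in> fibre E x"
proof -
  obtain U e where U: "(U, e) \<in> frames E" "x \<in> U" using frame_exists by blast
  obtain c where "\<forall>\<^sub>F y in nhds x. s y = (\<Sum>i<bdl_rank E. c i y *\<^sub>R e i y)"
    using sec_at_in_frame[OF assms U] by blast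
  then have "s x = (\<Sum>i<bdl_rank E. c i x *\<^sub>R e i x)"
    by (rule eventually_nhds_x_imp_x)
  then show ?thesis
    using basis_of_mem[OF frameD(2)[OF U]] by (auto intro!: subspace_sum subspace_scale fibre_subspace)
qed

text \<open>In the converse direction the coefficients are first chosen separately at each point.
  Linear independence of the frame forces them to agree near \<open>x\<close> with the smooth
  coefficients of the germ there, so the choice is smooth.\<close>

lemma smooth_comb_iff:
  assumes U: "(U, e) \<in> frames E" and W: "open W" "W \<subseteq> U"
  shows "smooth_comb (base E) W (bdl_rank E) e s \<longleftrightarrow> (\<forall>x\<in>W. sec_at E x s)"
proof
  assume "smooth_comb (base E) W (bdl_rank E) e s"
  then obtain c where c: "\<And>i. i < bdl_rank E \<Longrightarrow> smooth_fun_on (base E) W (c i)"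
    "\<And>x. x \<in> W \<Longrightarrow> s x = (\<Sum>i<bdl_rank E. c i x *\<^sub>R e i x)"
    by (auto simp: smooth_comb_def)
  show "\<forall>x\<in>W. sec_at E x s"
  proof
    fix x assume x: "x \<in> W"
    show "sec_at E x s"
      by (rule sec_atI[OF U, of _ c])
        (use x W c in \<open>auto simp: smooth_at_def eventually_nhds\<close>)
  qed
next
  assume s: "\<forall>x\<in>W. sec_at E x s"
  have "\<exists>c. \<forall>i. s x = (\<Sum>i<bdl_rank E. c i *\<^sub>R e i x)" if "x \<in> W" for x
    using basis_of_coords[OF frameD(2)[OF U]] sec_at_fibre s that W(2) by (metis subsetD)
  then obtain c where c: "\<And>x. x \<in> W \<Longrightarrow> s x = (\<Sum>i<bdl_rank E. c x i *\<^sub>R e i x)"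
    by metis
  have "smooth_fun_on (base E) W (\<lambda>x. c x i)" if i: "i < bdl_rank E" for i
  proof (rule smooth_fun_on_local[OF bundle_base])
    fix x assume x: "x \<in> W"
    then obtain d where d: "smooth_at (base E) x (d i)"
      "\<forall>\<^sub>F y in nhds x. s y = (\<Sum>i<bdl_rank E. d i y *\<^sub>R e i y)"
      using sec_at_in_frame[of x s U e] s U W(2) i by blast
    have "\<forall>\<^sub>F y in nhds x. d i y = c y i"
      using d(2) eventually_nhds_in_open[OF W(1) x]
    proof eventually_elim
      case (elim y)
      then show ?case
        using basis_of_unique[OF frameD(2)[OF U] _ i, of y "\<lambda>i. d i y" "c y"] c W(2) by force
    qed
    with d(1) show "smooth_at (base E) x (\<lambda>x. c x i)"
      by (rule smooth_at_cong[OF bundle_base])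
  qed
  with c show "smooth_comb (base E) W (bdl_rank E) e s"
    unfolding smooth_comb_def by (intro exI[of _ "\<lambda>i x. c x i"]) auto
qed

section \<open>Global sections and their extension from germs\<close>

lemma sections_iff: "s \<in> sections E \<longleftrightarrow> (\<forall>x. sec_at E x s)"
proof
  assume s: "s \<in> sections E"
  show "\<forall>x. sec_at E x s"
  proof
    fix x
    obtain U e where U: "(U, e) \<in> frames E" "x \<in> U" using frame_exists by blast
    then have "smooth_comb (base E) U (bdl_rank E) e s"
      using s by (auto simp: sections_def)
    then show "sec_at E x s"
      using smooth_comb_iff[OF U(1) frameD(1)[OF U(1)]] U(2) by blast
  qed
next
  assume "\<forall>x. sec_at E x s"
  then show "s \<in> sections E"
    using smooth_comb_iff frameD(1) by (auto simp: sections_def sec_at_fibre)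
qed

lemma section_fibre: "s \<in> sections E \<Longrightarrow> s x \<in> fibre E x"
  by (simp add: sections_def)

lemma sections_add: "s \<in> sections E \<Longrightarrow> t \<in> sections E \<Longrightarrow> (\<lambda>y. s y + t y) \<in> sections E"
  by (simp add: sections_iff sec_at_add)

lemma sections_scale: "s \<in> sections E \<Longrightarrow> f \<in> smooth_functions (base E) \<Longrightarrow> (\<lambda>y. f y *\<^sub>R s y) \<in> sections E"
  by (simp add: sections_iff sec_at_scale smooth_functions_iff[OF bundle_base])

lemma sections_cscale: "s \<in> sections E \<Longrightarrow> (\<lambda>y. c *\<^sub>R s y) \<in> sections E"
  using sections_scale smooth_functions_const[OF bundle_base] by blast

lemma sections_diff: "s \<in> sections E \<Longrightarrow> t \<in> sections E \<Longrightarrow> (\<lambda>y. s y - t y) \<in> sections E"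
  using sections_add[of s "\<lambda>y. (-1) *\<^sub>R t y"] sections_cscale[of t "-1"] by simp

lemma sections_zero: "(\<lambda>y. 0) \<in> sections E"
  by (simp add: sections_iff sec_at_zero)

lemma sections_sum: "(\<And>i. i \<in> I \<Longrightarrow> s i \<in> sections E) \<Longrightarrow> (\<lambda>y. \<Sum>i\<in>I. s i y) \<in> sections E"
  by (auto simp: sections_iff intro: sec_at_sum)

lemma section_extension:
  assumes "sec_at E x s"
  obtains t where "t \<in> sections E" "\<forall>\<^sub>F y in nhds x. t y = s y"
proof -
  obtain W where W: "open W" "x \<in> W" "\<And>y. y \<in> W \<Longrightarrow> sec_at E y s"
    using sec_at_eventually[OF assms] by (auto simp: eventually_nhds)
  obtain g where g: "g \<in> smooth_functions (base E)" "\<forall>\<^sub>F y in nhds x. g y = 1"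
    "\<And>y. y \<notin> W \<Longrightarrow> \<forall>\<^sub>F z in nhds y. g z = 0"
    using smooth_bump_exists[OF bundle_base W(1,2)] by blast
  have "sec_at E y (\<lambda>y. g y *\<^sub>R s y)" for y
  proof (cases "y \<in> W")
    case True
    then show ?thesis using g(1) W(3) by (simp add: smooth_functions_iff[OF bundle_base] sec_at_scale)
  next
    case False
    have "\<forall>\<^sub>F z in nhds y. 0 = g z *\<^sub>R s z"
      using g(3)[OF False] by (rule eventually_mono) auto
    with sec_at_zero show ?thesis by (rule sec_at_cong)
  qed
  moreover have "\<forall>\<^sub>F y in nhds x. g y *\<^sub>R s y = s y"
    using g(2) by (rule eventually_mono) auto
  ultimately show ?thesis
    using that[of "\<lambda>y. g y *\<^sub>R s y"] by (auto simp: sections_iff)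
qed

lemma section_through:
  assumes "v \<in> fibre E x"
  obtains s where "s \<in> sections E" "s x = v"
proof -
  obtain U e where U: "(U, e) \<in> frames E" "x \<in> U" using frame_exists by blast
  obtain c where c: "v = (\<Sum>i<bdl_rank E. c i *\<^sub>R e i x)"
    using basis_of_coords[OF frameD(2)[OF U]] assms by metis
  have "sec_at E x (\<lambda>y. \<Sum>i<bdl_rank E. c i *\<^sub>R e i y)"
    using U by (intro sec_at_sum sec_at_scale sec_at_frame) (auto simp: smooth_at_const[OF bundle_base])
  then obtain t where t: "t \<in> sections E" "\<forall>\<^sub>F y in nhds x. t y = (\<Sum>i<bdl_rank E. c i *\<^sub>R e i y)"
    by (rule section_extension)
  have "t x = v"
    using eventually_nhds_x_imp_x[OF t(2)] c by simp
  with t(1) show ?thesis by (rule that)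
qed

section \<open>Forms of degree 0 and 1, and global objects that are dual frames near a point\<close>

lemma kforms_1_fibre: "\<alpha> \<in> kforms 1 E \<Longrightarrow> \<alpha> x \<in> alt_forms 1 (fibre E x)"
  by (simp add: kforms_def)

text \<open>Frame elements coincide near any given point with global sections, and sections are
  locally combinations of frame elements; hence coefficients in frames and pairings with global
  sections test the same smoothness.\<close>

lemma kforms_1_iff:
  "\<alpha> \<in> kforms 1 E \<longleftrightarrow> (\<forall>x. \<alpha> x \<in> alt_forms 1 (fibre E x)) \<and>
    (\<forall>s\<in>sections E. (\<lambda>y. \<alpha> y [s y]) \<in> smooth_functions (base E))"
proof (intro iffI conjI ballI)
  assume \<alpha>: "\<alpha> \<in> kforms 1 E"
  then show fib: "\<forall>x. \<alpha> x \<in> alt_forms 1 (fibre E x)" by (simp add: kforms_def)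
  fix s assume s: "s \<in> sections E"
  have "smooth_at (base E) x (\<lambda>y. \<alpha> y [s y])" for x
  proof -
    obtain U e where U: "(U, e) \<in> frames E" "x \<in> U" using frame_exists by blast
    obtain c where c: "\<And>i. i<bdl_rank E \<Longrightarrow> smooth_at (base E) x (c i)"
      "\<forall>\<^sub>F y in nhds x. s y = (\<Sum>i<bdl_rank E. c i y *\<^sub>R e i y)"
      using sec_at_in_frame[of x s U e] U s by (auto simp: sections_iff)
    have "smooth_fun_on (base E) U (\<lambda>y. \<alpha> y [e i y])" if "i < bdl_rank E" for i
    proof -
      have "length [i] = 1 \<and> set [i] \<subseteq> {..<bdl_rank E}" using that by simp
      then have "smooth_fun_on (base E) U (\<lambda>y. \<alpha> y (map (\<lambda>j. e j y) [i]))"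
        using \<alpha> U(1) unfolding kforms_def by blast
      then show ?thesis by simp
    qed
    then have "smooth_at (base E) x (\<lambda>y. \<Sum>i<bdl_rank E. c i y * \<alpha> y [e i y])"
      using c(1) U(2) frameD(1)[OF U(1)] by (intro smooth_at_sum[OF bundle_base] smooth_at_mult[OF bundle_base]) (auto simp: smooth_at_def)
    moreover have "\<forall>\<^sub>F y in nhds x. (\<Sum>i<bdl_rank E. c i y * \<alpha> y [e i y]) = \<alpha> y [s y]"
      using c(2) eventually_nhds_in_open[OF frameD(1)[OF U(1)] U(2)]
    proof eventually_elim
      case (elim y)
      then show ?case
        using alt_forms_1_sum[OF fibre_subspace fib[rule_format, of y], of "{..<bdl_rank E}" "\<lambda>i. e i y"]
          basis_of_mem[OF frameD(2)[OF U(1)]] by auto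
    qed
    ultimately show ?thesis by (rule smooth_at_cong[OF bundle_base])
  qed
  then show "(\<lambda>y. \<alpha> y [s y]) \<in> smooth_functions (base E)"
    by (simp add: smooth_functions_iff[OF bundle_base])
next
  assume \<alpha>: "(\<forall>x. \<alpha> x \<in> alt_forms 1 (fibre E x)) \<and>
    (\<forall>s\<in>sections E. (\<lambda>y. \<alpha> y [s y]) \<in> smooth_functions (base E))"
  have "smooth_fun_on (base E) U (\<lambda>x. \<alpha> x (map (\<lambda>j. e j x) js))"
    if U: "(U, e) \<in> frames E" and js: "length js = 1" "set js \<subseteq> {..<bdl_rank E}" for U e js
  proof (rule smooth_fun_on_local[OF bundle_base])
    fix x assume x: "x \<in> U"
    obtain j where j: "js = [j]" "j < bdl_rank E"
      using js by (auto simp: length_Suc_conv One_nat_def)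
    obtain t where t: "t \<in> sections E" "\<forall>\<^sub>F y in nhds x. t y = e j y"
      using section_extension[OF sec_at_frame[OF U x j(2)]] by blast
    have "smooth_at (base E) x (\<lambda>y. \<alpha> y [t y])"
      using \<alpha> t(1) by (simp add: smooth_functions_iff[OF bundle_base])
    moreover have "\<forall>\<^sub>F y in nhds x. \<alpha> y [t y] = \<alpha> y (map (\<lambda>j. e j y) js)"
      using t(2) by (rule eventually_mono) (simp add: j(1))
    ultimately show "smooth_at (base E) x (\<lambda>x. \<alpha> x (map (\<lambda>j. e j x) js))"
      by (rule smooth_at_cong[OF bundle_base])
  qed
  with \<alpha> show "\<alpha> \<in> kforms 1 E" by (auto simp: kforms_def)
qed

lemma kforms_1_eval: "\<alpha> \<in> kforms 1 E \<Longrightarrow> s \<in> sections E \<Longrightarrow> (\<lambda>y. \<alpha> y [s y]) \<in> smooth_functions (base E)"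
  using kforms_1_iff by blast

lemma kforms_0_iff:
  "\<omega> \<in> kforms 0 E \<longleftrightarrow> (\<forall>x. \<omega> x \<in> alt_forms 0 (fibre E x)) \<and> (\<lambda>x. \<omega> x []) \<in> smooth_functions (base E)"
proof -
  have "(\<forall>(U, e)\<in>frames E. smooth_fun_on (base E) U (\<lambda>x. \<omega> x [])) \<longleftrightarrow> (\<lambda>x. \<omega> x []) \<in> smooth_functions (base E)"
    (is "?L \<longleftrightarrow> ?R")
  proof
    assume ?R
    then show ?L
      by (auto simp: smooth_functions_iff[OF bundle_base] intro!: smooth_fun_on_local[OF bundle_base])
  next
    assume L: ?L
    show ?R
      unfolding smooth_functions_iff[OF bundle_base]
    proof
      fix x
      obtain U e where U: "(U, e) \<in> frames E" "x \<in> U" using frame_exists by blast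
      then have "smooth_fun_on (base E) U (\<lambda>x. \<omega> x [])" using L by auto
      then show "smooth_at (base E) x (\<lambda>x. \<omega> x [])"
        using U frameD(1)[OF U(1)] by (auto simp: smooth_at_def)
    qed
  qed
  then show ?thesis by (simp add: kforms_def case_prod_unfold)
qed

lemma frame_dual:
  assumes "(U, e) \<in> frames E"
  obtains \<epsilon> where "\<And>x. x \<in> U \<Longrightarrow> dual_bases (fibre E x) (bdl_rank E) (\<lambda>i. e i x) (\<lambda>i. \<epsilon> i x)"
proof -
  have "\<forall>x. \<exists>\<epsilon>. x \<in> U \<longrightarrow> dual_bases (fibre E x) (bdl_rank E) (\<lambda>i. e i x) \<epsilon>"
    using dual_basis_exists[OF frameD(2)[OF assms]] by blast
  from choice[OF this] obtain \<epsilon> where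
    "\<And>x. x \<in> U \<Longrightarrow> dual_bases (fibre E x) (bdl_rank E) (\<lambda>i. e i x) (\<epsilon> x)" by blast
  then show ?thesis using that[of "\<lambda>i x. \<epsilon> x i"] by blast
qed

text \<open>The dual frame is given fibre by fibre only. Its smoothness comes from the fact that
  pairing \<open>\<epsilon> i\<close> with a section returns the \<open>i\<close>-th coefficient of
  that section.\<close>

lemma dual_frame_extension:
  assumes U: "(U, e) \<in> frames E" "x \<in> U" and i: "i < bdl_rank E"
    and \<epsilon>: "\<And>y. y \<in> U \<Longrightarrow> dual_bases (fibre E y) (bdl_rank E) (\<lambda>i. e i y) (\<lambda>i. \<epsilon> i y)"
  shows "\<exists>\<alpha>\<in>kforms 1 E. \<forall>\<^sub>F y in nhds x. \<alpha> y = \<epsilon> i y"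
proof -
  obtain g where g: "g \<in> smooth_functions (base E)" "\<forall>\<^sub>F y in nhds x. g y = 1"
    "\<And>y. y \<notin> U \<Longrightarrow> \<forall>\<^sub>F z in nhds y. g z = 0"
    using smooth_bump_exists[OF bundle_base frameD(1)[OF U(1)] U(2)] by blast
  define \<alpha> where "\<alpha> = (\<lambda>y. if y \<in> U then g y *\<^sub>R \<epsilon> i y else 0)"
  have "\<alpha> \<in> kforms 1 E"
    unfolding kforms_1_iff
  proof (intro conjI allI ballI)
    show "\<alpha> y \<in> alt_forms 1 (fibre E y)" for y
      using dual_bases_mem(2)[OF \<epsilon> i] alt_forms_1_subspace[OF fibre_subspace, of y]
      by (auto simp: \<alpha>_def subspace_scale subspace_0)
    fix s assume s: "s \<in> sections E"
    have "smooth_at (base E) y (\<lambda>z. \<alpha> z [s z])" for y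
    proof (cases "y \<in> U")
      case True
      obtain c where c: "\<And>i. i<bdl_rank E \<Longrightarrow> smooth_at (base E) y (c i)"
        "\<forall>\<^sub>F y in nhds y. s y = (\<Sum>i<bdl_rank E. c i y *\<^sub>R e i y)"
        using sec_at_in_frame[of y s U e] U True s by (auto simp: sections_iff)
      have "smooth_at (base E) y (\<lambda>z. g z * c i z)"
        using c(1)[OF i] g(1) by (auto simp: smooth_functions_iff[OF bundle_base] intro: smooth_at_mult[OF bundle_base])
      moreover have "\<forall>\<^sub>F z in nhds y. g z * c i z = \<alpha> z [s z]"
        using c(2) eventually_nhds_in_open[OF frameD(1)[OF U(1)] True]
        by eventually_elim (simp add: \<alpha>_def scaleR_fun_def dual_bases_coord[OF \<epsilon> i])
      ultimately show ?thesis by (rule smooth_at_cong[OF bundle_base])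
    next
      case False
      have "\<forall>\<^sub>F z in nhds y. 0 = \<alpha> z [s z]"
        using g(3)[OF False] by (rule eventually_mono) (simp add: \<alpha>_def scaleR_fun_def)
      with smooth_at_const[OF bundle_base] show ?thesis by (rule smooth_at_cong[OF bundle_base])
    qed
    then show "(\<lambda>y. \<alpha> y [s y]) \<in> smooth_functions (base E)"
      by (simp add: smooth_functions_iff[OF bundle_base])
  qed
  moreover have "\<forall>\<^sub>F y in nhds x. \<alpha> y = \<epsilon> i y"
    using g(2) eventually_nhds_in_open[OF frameD(1)[OF U(1)] U(2)]
    by eventually_elim (simp add: \<alpha>_def)
  ultimately show ?thesis by blast
qed

text \<open>Leibniz rules and the Koszul formula apply to global sections and forms; here these
  serve as a pair of dual frames near \<open>x\<close>, which is what expansions under derivatives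
  and brackets require.\<close>

lemma global_frame:
  obtains e \<epsilon> where "\<And>i. i < bdl_rank E \<Longrightarrow> e i \<in> sections E" "\<And>i. i < bdl_rank E \<Longrightarrow> \<epsilon> i \<in> kforms 1 E"
    "\<forall>\<^sub>F y in nhds x. dual_bases (fibre E y) (bdl_rank E) (\<lambda>i. e i y) (\<lambda>i. \<epsilon> i y)"
proof -
  let ?n = "bdl_rank E"
  obtain U b where U: "(U, b) \<in> frames E" "x \<in> U" using frame_exists by blast
  obtain \<beta> where \<beta>: "\<And>x. x \<in> U \<Longrightarrow> dual_bases (fibre E x) ?n (\<lambda>i. b i x) (\<lambda>i. \<beta> i x)"
    using frame_dual[OF U(1)] by blast
  have "\<forall>i. \<exists>t. i < ?n \<longrightarrow> t \<in> sections E \<and> (\<forall>\<^sub>F y in nhds x. t y = b i y)"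
    using section_extension[OF sec_at_frame[OF U]] by blast
  from choice[OF this] obtain e where
    e: "\<And>i. i < ?n \<Longrightarrow> e i \<in> sections E" "\<And>i. i < ?n \<Longrightarrow> \<forall>\<^sub>F y in nhds x. e i y = b i y"
    by blast
  have "\<forall>i. \<exists>\<alpha>. i < ?n \<longrightarrow> \<alpha> \<in> kforms 1 E \<and> (\<forall>\<^sub>F y in nhds x. \<alpha> y = \<beta> i y)"
    using dual_frame_extension[where \<epsilon> = \<beta>, OF U _ \<beta>] unfolding Bex_def by blast
  from choice[OF this] obtain \<epsilon> where
    \<epsilon>: "\<And>i. i < ?n \<Longrightarrow> \<epsilon> i \<in> kforms 1 E" "\<And>i. i < ?n \<Longrightarrow> \<forall>\<^sub>F y in nhds x. \<epsilon> i y = \<beta> i y"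
    by blast
  have "\<forall>\<^sub>F y in nhds x. \<forall>i\<in>{..<?n}. e i y = b i y" "\<forall>\<^sub>F y in nhds x. \<forall>i\<in>{..<?n}. \<epsilon> i y = \<beta> i y"
    using e(2) \<epsilon>(2) by (auto intro: eventually_ball_finite)
  then have "\<forall>\<^sub>F y in nhds x. dual_bases (fibre E y) ?n (\<lambda>i. e i y) (\<lambda>i. \<epsilon> i y)"
    using eventually_nhds_in_open[OF frameD(1)[OF U(1)] U(2)]
  proof eventually_elim
    case (elim y)
    have "(\<lambda>i. e i y) ` {..<?n} = (\<lambda>i. b i y) ` {..<?n}" "inj_on (\<lambda>i. e i y) {..<?n} = inj_on (\<lambda>i. b i y) {..<?n}"
      using elim(1) by (auto simp: inj_on_def)
    then show ?case
      using \<beta>[OF elim(3)] elim(1,2) by (simp add: dual_bases_def basis_of_def)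
  qed
  then show ?thesis using that e(1) \<epsilon>(1) by blast
qed

lemma kforms_1_add: "\<alpha> \<in> kforms 1 E \<Longrightarrow> \<beta> \<in> kforms 1 E \<Longrightarrow> \<alpha> + \<beta> \<in> kforms 1 E"
  using alt_forms_1_subspace[OF fibre_subspace]
  by (auto simp: kforms_1_iff subspace_add smooth_functions_add[OF bundle_base])

lemma kforms_1_scale: "\<alpha> \<in> kforms 1 E \<Longrightarrow> f \<in> smooth_functions (base E) \<Longrightarrow> (\<lambda>y. f y *\<^sub>R \<alpha> y) \<in> kforms 1 E"
proof -
  assume \<alpha>: "\<alpha> \<in> kforms 1 E" and f: "f \<in> smooth_functions (base E)"
  have "f y *\<^sub>R \<alpha> y \<in> alt_forms 1 (fibre E y)" for y
    using \<alpha> by (intro subspace_scale alt_forms_1_subspace fibre_subspace) (simp add: kforms_1_iff)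
  moreover have "(\<lambda>y. (f y *\<^sub>R \<alpha> y) [s y]) \<in> smooth_functions (base E)" if "s \<in> sections E" for s
    using that \<alpha> f by (simp add: kforms_1_iff scaleR_fun_def smooth_functions_mult[OF bundle_base])
  ultimately show ?thesis by (simp add: kforms_1_iff)
qed

lemma kforms_1_zero: "(\<lambda>y. 0) \<in> kforms 1 E"
  using alt_forms_1_subspace[OF fibre_subspace]
  by (auto simp: kforms_1_iff subspace_0 smooth_functions_const[OF bundle_base])

lemma kforms_1_sum: "(\<And>i. i \<in> I \<Longrightarrow> \<alpha> i \<in> kforms 1 E) \<Longrightarrow> (\<lambda>y. \<Sum>i\<in>I. \<alpha> i y) \<in> kforms 1 E"
proof (induction I rule: infinite_finite_induct)
  case (insert a I)
  have "(\<lambda>y. \<Sum>i\<in>insert a I. \<alpha> i y) = \<alpha> a + (\<lambda>y. \<Sum>i\<in>I. \<alpha> i y)"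
    using insert(1,2) by (auto simp: plus_fun_def)
  moreover have "\<alpha> a + (\<lambda>y. \<Sum>i\<in>I. \<alpha> i y) \<in> kforms 1 E"
    using insert by (intro kforms_1_add) auto
  ultimately show ?case by simp
qed (auto simp: kforms_1_zero)

lemma form_through:
  assumes "a \<in> alt_forms 1 (fibre E x)"
  obtains \<alpha> where "\<alpha> \<in> kforms 1 E" "\<alpha> x = a"
proof -
  let ?n = "bdl_rank E"
  obtain e \<epsilon> where e: "\<And>i. i < ?n \<Longrightarrow> e i \<in> sections E" and \<epsilon>: "\<And>i. i < ?n \<Longrightarrow> \<epsilon> i \<in> kforms 1 E"
    and ev: "\<forall>\<^sub>F y in nhds x. dual_bases (fibre E y) ?n (\<lambda>i. e i y) (\<lambda>i. \<epsilon> i y)"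
    using global_frame by blast
  have "(\<Sum>i<?n. a [e i x] *\<^sub>R \<epsilon> i x) = a"
    by (rule dual_bases_form[OF eventually_nhds_x_imp_x[OF ev] assms])
  moreover have "(\<lambda>y. \<Sum>i<?n. a [e i x] *\<^sub>R \<epsilon> i y) \<in> kforms 1 E"
    using \<epsilon> by (intro kforms_1_sum kforms_1_scale) (auto simp: smooth_functions_const[OF bundle_base])
  ultimately show ?thesis using that[of "\<lambda>y. \<Sum>i<?n. a [e i x] *\<^sub>R \<epsilon> i y"] by simp
qed

lemma fibre_eqI:
  assumes "v \<in> fibre E x" "w \<in> fibre E x" "\<And>\<beta>. \<beta> \<in> kforms 1 E \<Longrightarrow> \<beta> x [v] = \<beta> x [w]"
  shows "v = w"
proof -
  let ?n = "bdl_rank E"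
  obtain e \<epsilon> where e: "\<And>i. i < ?n \<Longrightarrow> e i \<in> sections E" and \<epsilon>: "\<And>i. i < ?n \<Longrightarrow> \<epsilon> i \<in> kforms 1 E"
    and ev: "\<forall>\<^sub>F y in nhds x. dual_bases (fibre E y) ?n (\<lambda>i. e i y) (\<lambda>i. \<epsilon> i y)"
    using global_frame by blast
  note expand = dual_bases_vector[OF eventually_nhds_x_imp_x[OF ev]]
  have "v = (\<Sum>i<?n. \<epsilon> i x [v] *\<^sub>R e i x)"
    by (rule expand[OF assms(1), symmetric])
  also have "\<dots> = (\<Sum>i<?n. \<epsilon> i x [w] *\<^sub>R e i x)"
    using assms(3)[OF \<epsilon>] by (intro sum.cong refl) simp
  also have "\<dots> = w"
    by (rule expand[OF assms(2)])
  finally show ?thesis .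
qed

text \<open>Near \<open>x\<close> the map is a combination of frame sections whose coefficients are
  its pairings with the dual forms.\<close>

lemma sections_from_pairing:
  assumes "\<And>x. s x \<in> fibre E x" "\<And>\<beta>. \<beta> \<in> kforms 1 E \<Longrightarrow> (\<lambda>y. \<beta> y [s y]) \<in> smooth_functions (base E)"
  shows "s \<in> sections E"
  unfolding sections_iff
proof
  fix x
  let ?n = "bdl_rank E"
  obtain e \<epsilon> where e: "\<And>i. i < ?n \<Longrightarrow> e i \<in> sections E" and \<epsilon>: "\<And>i. i < ?n \<Longrightarrow> \<epsilon> i \<in> kforms 1 E"
    and ev: "\<forall>\<^sub>F y in nhds x. dual_bases (fibre E y) ?n (\<lambda>i. e i y) (\<lambda>i. \<epsilon> i y)"
    using global_frame by blast
  have "sec_at E x (\<lambda>y. \<Sum>i<?n. \<epsilon> i y [s y] *\<^sub>R e i y)"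
    using e assms(2)[OF \<epsilon>]
    by (intro sec_at_sum sec_at_scale) (auto simp: sections_iff smooth_functions_iff[OF bundle_base])
  moreover have "\<forall>\<^sub>F y in nhds x. (\<Sum>i<?n. \<epsilon> i y [s y] *\<^sub>R e i y) = s y"
    using ev by eventually_elim (rule dual_bases_vector[OF _ assms(1)])
  ultimately show "sec_at E x s" by (rule sec_at_cong)
qed

section \<open>Bivectors and the map \<open>sharp\<close>\<close>

lemma multisections_2_iff:
  "P \<in> multisections 2 E \<longleftrightarrow> (\<forall>x. P x \<in> alt_forms 2 (alt_forms 1 (fibre E x))) \<and>
    (\<forall>\<alpha>\<in>kforms 1 E. \<forall>\<beta>\<in>kforms 1 E. (\<lambda>y. P y [\<alpha> y, \<beta> y]) \<in> smooth_functions (base E))"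
proof (intro iffI conjI ballI)
  let ?n = "bdl_rank E"
  assume P: "P \<in> multisections 2 E"
  then show fib: "\<forall>x. P x \<in> alt_forms 2 (alt_forms 1 (fibre E x))"
    by (simp add: multisections_def kforms_def dual_bundle_def)
  fix \<alpha> \<beta> assume \<alpha>: "\<alpha> \<in> kforms 1 E" and \<beta>: "\<beta> \<in> kforms 1 E"
  have "smooth_at (base E) x (\<lambda>y. P y [\<alpha> y, \<beta> y])" for x
  proof -
    obtain U e where U: "(U, e) \<in> frames E" "x \<in> U" using frame_exists by blast
    obtain \<epsilon> where \<epsilon>: "\<And>x. x \<in> U \<Longrightarrow> dual_bases (fibre E x) ?n (\<lambda>i. e i x) (\<lambda>i. \<epsilon> i x)"
      using frame_dual[OF U(1)] by blast
    then have fr: "(U, \<epsilon>) \<in> frames (dual_bundle E)"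
      using U(1) by (auto simp: dual_bundle_def dual_bases_def)
    have sm: "smooth_fun_on (base E) U (\<lambda>y. P y [\<epsilon> i y, \<epsilon> j y])" if "i < ?n" "j < ?n" for i j
    proof -
      have "length [i, j] = 2 \<and> set [i, j] \<subseteq> {..<bdl_rank (dual_bundle E)}"
        using that by (simp add: dual_bundle_def)
      then have "smooth_fun_on (base (dual_bundle E)) U (\<lambda>y. P y (map (\<lambda>j. \<epsilon> j y) [i, j]))"
        using P fr unfolding multisections_def kforms_def by blast
      then show ?thesis by (simp add: dual_bundle_def)
    qed
    have frs: "smooth_at (base E) x (\<lambda>y. \<gamma> y [e i y])" if \<gamma>: "\<gamma> \<in> kforms 1 E" and i: "i < ?n" for \<gamma> i
    proof -
      obtain t where t: "t \<in> sections E" "\<forall>\<^sub>F y in nhds x. t y = e i y"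
        using section_extension[OF sec_at_frame[OF U i]] by blast
      have "smooth_at (base E) x (\<lambda>y. \<gamma> y [t y])"
        using kforms_1_eval[OF \<gamma> t(1)] by (simp add: smooth_functions_iff[OF bundle_base])
      then show ?thesis
        by (rule smooth_at_cong[OF bundle_base]) (use t(2) in \<open>auto elim: eventually_mono\<close>)
    qed
    have "smooth_at (base E) x (\<lambda>y. \<Sum>i<?n. \<Sum>j<?n. \<alpha> y [e i y] * (\<beta> y [e j y] * P y [\<epsilon> i y, \<epsilon> j y]))"
      using sm U(2) frameD(1)[OF U(1)]
      by (intro smooth_at_sum[OF bundle_base] smooth_at_mult[OF bundle_base] frs[OF \<alpha>] frs[OF \<beta>]) (auto simp: smooth_at_def)
    moreover have "\<forall>\<^sub>F y in nhds x. (\<Sum>i<?n. \<Sum>j<?n. \<alpha> y [e i y] * (\<beta> y [e j y] * P y [\<epsilon> i y, \<epsilon> j y])) = P y [\<alpha> y, \<beta> y]"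
      using eventually_nhds_in_open[OF frameD(1)[OF U(1)] U(2)]
      by eventually_elim
        (rule dual_bases_bilinear[OF \<epsilon> fib[rule_format] kforms_1_fibre[OF \<alpha>] kforms_1_fibre[OF \<beta>], symmetric])
    ultimately show ?thesis by (rule smooth_at_cong[OF bundle_base])
  qed
  then show "(\<lambda>y. P y [\<alpha> y, \<beta> y]) \<in> smooth_functions (base E)"
    by (simp add: smooth_functions_iff[OF bundle_base])
next
  let ?n = "bdl_rank E"
  assume P: "(\<forall>x. P x \<in> alt_forms 2 (alt_forms 1 (fibre E x))) \<and>
    (\<forall>\<alpha>\<in>kforms 1 E. \<forall>\<beta>\<in>kforms 1 E. (\<lambda>y. P y [\<alpha> y, \<beta> y]) \<in> smooth_functions (base E))"
  have "smooth_fun_on (base E) U (\<lambda>x. P x (map (\<lambda>j. \<epsilon> j x) js))"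
    if U: "(U, \<epsilon>) \<in> frames (dual_bundle E)" and js: "length js = 2" "set js \<subseteq> {..<?n}" for U \<epsilon> js
  proof (rule smooth_fun_on_local[OF bundle_base])
    fix x assume x: "x \<in> U"
    obtain i j where j: "js = [i, j]" "i < ?n" "j < ?n"
      using js by (auto simp: length_Suc_conv numeral_2_eq_2)
    obtain e where e: "(U, e) \<in> frames E"
      and "\<And>y i. y \<in> U \<Longrightarrow> i < ?n \<Longrightarrow> \<epsilon> i y \<in> alt_forms 1 (fibre E y) \<and>
        (\<forall>j<?n. \<epsilon> i y [e j y] = (if i = j then 1 else 0))"
      using U by (auto simp: dual_bundle_def)
    then have d: "\<And>y. y \<in> U \<Longrightarrow> dual_bases (fibre E y) ?n (\<lambda>i. e i y) (\<lambda>i. \<epsilon> i y)"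
      using frameD(2)[OF e] by (simp add: dual_bases_def)
    obtain \<alpha> where \<alpha>: "\<alpha> \<in> kforms 1 E" "\<forall>\<^sub>F y in nhds x. \<alpha> y = \<epsilon> i y"
      using dual_frame_extension[OF e x j(2) d] by blast
    obtain \<beta> where \<beta>: "\<beta> \<in> kforms 1 E" "\<forall>\<^sub>F y in nhds x. \<beta> y = \<epsilon> j y"
      using dual_frame_extension[OF e x j(3) d] by blast
    have "smooth_at (base E) x (\<lambda>y. P y [\<alpha> y, \<beta> y])"
      using P \<alpha> \<beta> by (simp add: smooth_functions_iff[OF bundle_base])
    moreover have "\<forall>\<^sub>F y in nhds x. P y [\<alpha> y, \<beta> y] = P y (map (\<lambda>j. \<epsilon> j y) js)"
      using \<alpha>(2) \<beta>(2) by eventually_elim (simp add: j(1))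
    ultimately show "smooth_at (base E) x (\<lambda>x. P x (map (\<lambda>j. \<epsilon> j x) js))"
      by (rule smooth_at_cong[OF bundle_base])
  qed
  moreover have "base (dual_bundle E) = base E" "bdl_rank (dual_bundle E) = ?n"
    "fibre (dual_bundle E) = (\<lambda>x. alt_forms 1 (fibre E x))"
    by (auto simp: dual_bundle_def)
  ultimately show "P \<in> multisections 2 E"
    using P by (auto simp: multisections_def kforms_def)
qed

lemma multisections_2_fibre: "P \<in> multisections 2 E \<Longrightarrow> P x \<in> alt_forms 2 (alt_forms 1 (fibre E x))"
  by (simp add: multisections_2_iff)

text \<open>Finite-dimensional reflexivity: a functional \<open>l\<close> on the dual space is
  evaluation at the vector with coordinates \<open>l (\<epsilon> i)\<close>, and covectors separate
  vectors. The description in \<open>sharp\<close> thereby has a unique solution.\<close>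

lemma contraction_exists:
  assumes l: "\<And>\<beta> \<gamma> s t. \<beta> \<in> alt_forms 1 (fibre E x) \<Longrightarrow> \<gamma> \<in> alt_forms 1 (fibre E x) \<Longrightarrow>
      l (s *\<^sub>R \<beta> + t *\<^sub>R \<gamma>) = s * l \<beta> + t * l \<gamma>"
  shows "\<exists>!v. v \<in> fibre E x \<and> (\<forall>\<beta>\<in>alt_forms 1 (fibre E x). \<beta> [v] = l \<beta>)"
proof -
  let ?n = "bdl_rank E" and ?D = "alt_forms 1 (fibre E x)"
  obtain U e where U: "(U, e) \<in> frames E" "x \<in> U" using frame_exists by blast
  obtain \<epsilon> where d: "dual_bases (fibre E x) ?n (\<lambda>i. e i x) \<epsilon>"
    using dual_basis_exists[OF frameD(2)[OF U]] by blast
  note \<epsilon> = dual_bases_mem(2)[OF d] and b = dual_bases_mem(1)[OF d]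
  have D: "subspace ?D" by (rule alt_forms_1_subspace[OF fibre_subspace])
  have lsum: "l (\<Sum>i\<in>I. c i *\<^sub>R \<epsilon> i) = (\<Sum>i\<in>I. c i * l (\<epsilon> i))" if "finite I" "I \<subseteq> {..<?n}" for c I
    using that
  proof induction
    case empty
    have "l 0 = 0" using l[of 0 0 0 0] subspace_0[OF D] by simp
    then show ?case by (simp add: zero_fun_def)
  next
    case (insert a I)
    have "(\<Sum>i\<in>I. c i *\<^sub>R \<epsilon> i) \<in> ?D" using insert.prems by (intro subspace_sum D subspace_scale \<epsilon>) auto
    then show ?case
      using insert(3,4) l[OF \<epsilon>(1)[of a], of "\<Sum>i\<in>I. c i *\<^sub>R \<epsilon> i" "c a" 1]
      unfolding sum.insert[OF insert(1,2)] scaleR_one by (simp add: plus_fun_def)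
  qed
  let ?v = "\<Sum>i<?n. l (\<epsilon> i) *\<^sub>R e i x"
  have "\<beta> [?v] = l \<beta>" if "\<beta> \<in> ?D" for \<beta>
  proof -
    have "\<beta> [?v] = (\<Sum>i<?n. l (\<epsilon> i) * \<beta> [e i x])"
      using b by (intro alt_forms_1_sum[OF fibre_subspace that]) auto
    also have "\<dots> = l (\<Sum>i<?n. \<beta> [e i x] *\<^sub>R \<epsilon> i)"
      by (simp add: lsum mult.commute)
    also have "(\<Sum>i<?n. \<beta> [e i x] *\<^sub>R \<epsilon> i) = \<beta>"
      by (rule dual_bases_form[OF d that])
    finally show ?thesis .
  qed
  moreover have "?v \<in> fibre E x"
    using b by (intro subspace_sum subspace_scale fibre_subspace) auto
  moreover have "w = ?v" if w: "w \<in> fibre E x" "\<forall>\<beta>\<in>?D. \<beta> [w] = l \<beta>" for w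
    using fibre_eqI[OF w(1) \<open>?v \<in> fibre E x\<close>] w(2) calculation(1) kforms_1_fibre by auto
  ultimately show ?thesis by blast
qed

text \<open>\<open>P\<close> is an arbitrary function here, so that the rule can also be applied to
  \<open>comp_bivector\<close>.\<close>

lemma sharp_eqI:
  assumes "v \<in> fibre E x" "\<And>\<beta>. \<beta> \<in> alt_forms 1 (fibre E x) \<Longrightarrow> \<beta> [v] = P x [\<alpha> x, \<beta>]"
  shows "sharp E P \<alpha> x = v"
  unfolding sharp_def
proof (rule the_equality)
  show "v \<in> fibre E x \<and> (\<forall>\<beta>\<in>alt_forms 1 (fibre E x). \<beta> [v] = P x [\<alpha> x, \<beta>])"
    using assms by blast
  show "w = v" if "w \<in> fibre E x \<and> (\<forall>\<beta>\<in>alt_forms 1 (fibre E x). \<beta> [w] = P x [\<alpha> x, \<beta>])" for w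
    using that assms by (intro fibre_eqI) (auto dest: kforms_1_fibre)
qed

lemma sharpD:
  assumes "P \<in> multisections 2 E" "\<alpha> x \<in> alt_forms 1 (fibre E x)"
  shows "sharp E P \<alpha> x \<in> fibre E x"
    "\<beta> \<in> alt_forms 1 (fibre E x) \<Longrightarrow> \<beta> [sharp E P \<alpha> x] = P x [\<alpha> x, \<beta>]"
proof -
  have "\<exists>!v. v \<in> fibre E x \<and> (\<forall>\<beta>\<in>alt_forms 1 (fibre E x). \<beta> [v] = P x [\<alpha> x, \<beta>])"
    using alt_forms_2_linear_2[OF alt_forms_1_subspace[OF fibre_subspace] multisections_2_fibre[OF assms(1)]] assms(2)
    by (intro contraction_exists) blast
  then obtain v where v: "v \<in> fibre E x" "\<forall>\<beta>\<in>alt_forms 1 (fibre E x). \<beta> [v] = P x [\<alpha> x, \<beta>]"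
    by blast
  then have "sharp E P \<alpha> x = v" by (intro sharp_eqI) auto
  then show "sharp E P \<alpha> x \<in> fibre E x"
    "\<beta> \<in> alt_forms 1 (fibre E x) \<Longrightarrow> \<beta> [sharp E P \<alpha> x] = P x [\<alpha> x, \<beta>]"
    using v by auto
qed

lemma sharp_sections:
  assumes "P \<in> multisections 2 E" "\<alpha> \<in> kforms 1 E"
  shows "sharp E P \<alpha> \<in> sections E"
proof (rule sections_from_pairing)
  show "sharp E P \<alpha> x \<in> fibre E x" for x
    using sharpD(1)[OF assms(1), of \<alpha> x] kforms_1_fibre[OF assms(2)] by blast
  show "(\<lambda>y. \<beta> y [sharp E P \<alpha> y]) \<in> smooth_functions (base E)" if "\<beta> \<in> kforms 1 E" for \<beta>
    using assms that by (simp add: sharpD(2) kforms_1_fibre multisections_2_iff)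
qed

end

subsection \<open>Lie algebroids\<close>

lemma sum_list_fun_apply: "(\<Sum>x\<leftarrow>xs. f x) y = (\<Sum>x\<leftarrow>xs. f x y)"
  by (induction xs) auto

lemma sum_list_zero: "(\<And>x. x \<in> set xs \<Longrightarrow> f x = 0) \<Longrightarrow> (\<Sum>x\<leftarrow>xs. f x) = 0"
  by (induction xs) auto

lemma sum_list_concat_map: "(\<Sum>x\<leftarrow>concat (map f xs). g x) = (\<Sum>x\<leftarrow>xs. \<Sum>y\<leftarrow>f x. g y)"
  by (induction xs) auto

lemma wedge_2:
  assumes "a \<in> alt_forms 1 V" "b \<in> alt_forms 1 V"
  shows "wedge V [v, w] [a, b] = a [v] * b [w] - a [w] * b [v]"
proof -
  have 2: "{..<2::nat} = {0, 1}" by auto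
  have f: "finite {1::nat}" "0 \<notin> {1::nat}" by auto
  show ?thesis
    using assms
    by (simp add: wedge_def 2 sum_over_permutations_insert[OF f] permutes_sing sign_swap_id sign_id
        numeral_2_eq_2[symmetric] lessThan_Suc)
qed

lemma wedge_3:
  assumes "a \<in> alt_forms 1 V" "b \<in> alt_forms 1 V" "c \<in> alt_forms 1 V"
  shows "wedge V [u, v, w] [a, b, c] =
    a [u] * b [v] * c [w] + a [v] * b [w] * c [u] + a [w] * b [u] * c [v] -
    a [u] * b [w] * c [v] - a [v] * b [u] * c [w] - a [w] * b [v] * c [u]"
proof -
  have 3: "{..<length [u, v, w]} = {0, 1, 2}" by auto
  have f: "finite {1::nat, 2}" "0 \<notin> {1::nat, 2}" "finite {2::nat}" "1 \<notin> {2::nat}" by auto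
  show ?thesis
    unfolding wedge_def 3 sum_over_permutations_insert[OF f(1,2)] sum_over_permutations_insert[OF f(3,4)]
      permutes_sing
    using assms
    by (simp add: sign_swap_id sign_id sign_compose permutation_swap_id transpose_def algebra_simps)
qed

lemma wedge_support: "\<not> (length \<alpha>s = length vs \<and> set \<alpha>s \<subseteq> alt_forms 1 V) \<Longrightarrow> wedge V vs \<alpha>s = 0"
  by (auto simp: wedge_def)

context
  fixes A :: "('m::{t2_space,second_countable_topology}, 'e::real_normed_vector, 'v::real_vector) algebroid"
  assumes A: "lie_algebroid A"
begin

lemma algebroid_bundle: "vector_bundle A"
  using A by (simp add: lie_algebroid_def)

lemmas A_base = bundle_base[OF algebroid_bundle]
lemmas A_subspace = fibre_subspace[OF algebroid_bundle]
lemmas A_fibre = section_fibre[OF algebroid_bundle]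
lemmas A_form = kforms_1_fibre[OF algebroid_bundle]
lemmas A_eval = kforms_1_eval[OF algebroid_bundle]

lemma anchor_morphism: "bundle_morphism A (tangent_bundle (base A)) (anchor A) id"
  using A by (simp only: lie_algebroid_def)

lemma anchor_tangent: "v \<in> fibre A x \<Longrightarrow> anchor A x v \<in> tangent_space (base A) x"
  using anchor_morphism by (simp add: bundle_morphism_def tangent_bundle_def)

lemma anchor_linear:
  assumes "v \<in> fibre A x" "w \<in> fibre A x"
  shows "anchor A x (a *\<^sub>R v + b *\<^sub>R w) f = a * anchor A x v f + b * anchor A x w f"
proof -
  have "anchor A x (a *\<^sub>R v + b *\<^sub>R w) = a *\<^sub>R anchor A x v + b *\<^sub>R anchor A x w"
    using anchor_morphism assms by (simp add: bundle_morphism_def)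
  then show ?thesis by (simp add: scaleR_fun_def)
qed

lemma anchor_zero: "anchor A x 0 f = 0"
  using anchor_linear[of 0 x 0 0 0 f] subspace_0[OF A_subspace] by simp

lemma anchor_scale: "v \<in> fibre A x \<Longrightarrow> anchor A x (a *\<^sub>R v) f = a * anchor A x v f"
  using anchor_linear[of v x v a 0 f] by simp

lemma anchor_add: "v \<in> fibre A x \<Longrightarrow> w \<in> fibre A x \<Longrightarrow> anchor A x (v + w) f = anchor A x v f + anchor A x w f"
  using anchor_linear[of v x w 1 1 f] by simp

lemma anchor_diff: "v \<in> fibre A x \<Longrightarrow> w \<in> fibre A x \<Longrightarrow> anchor A x (v - w) f = anchor A x v f - anchor A x w f"
  using anchor_linear[of v x w 1 "-1" f] by simp

lemma bracket_section: "X \<in> sections A \<Longrightarrow> Y \<in> sections A \<Longrightarrow> bracket A X Y \<in> sections A"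
  using A unfolding lie_algebroid_def by blast

lemma bracket_skew:
  assumes "X \<in> sections A" "Y \<in> sections A"
  shows "bracket A X Y x = - bracket A Y X x"
proof -
  have "bracket A X Y = - bracket A Y X"
    using A assms unfolding lie_algebroid_def by blast
  then show ?thesis by (simp add: fun_eq_iff)
qed

lemma bracket_linear_left:
  assumes "X \<in> sections A" "Y \<in> sections A" "Z \<in> sections A"
  shows "bracket A (\<lambda>y. a *\<^sub>R X y + b *\<^sub>R Y y) Z x = a *\<^sub>R bracket A X Z x + b *\<^sub>R bracket A Y Z x"
proof -
  have "bracket A (a *\<^sub>R X + b *\<^sub>R Y) Z = a *\<^sub>R bracket A X Z + b *\<^sub>R bracket A Y Z"
    using A assms unfolding lie_algebroid_def by blast
  moreover have "a *\<^sub>R X + b *\<^sub>R Y = (\<lambda>y. a *\<^sub>R X y + b *\<^sub>R Y y)"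
    by (auto simp: scaleR_fun_def)
  ultimately show ?thesis by (simp add: scaleR_fun_def)
qed

lemma bracket_linear_right:
  assumes "X \<in> sections A" "Y \<in> sections A" "Z \<in> sections A"
  shows "bracket A Z (\<lambda>y. a *\<^sub>R X y + b *\<^sub>R Y y) x = a *\<^sub>R bracket A Z X x + b *\<^sub>R bracket A Z Y x"
proof -
  have "(\<lambda>y. a *\<^sub>R X y + b *\<^sub>R Y y) \<in> sections A"
    using assms by (intro sections_add sections_cscale algebroid_bundle)
  then show ?thesis
    using bracket_skew[of Z _ x] bracket_linear_left[OF assms, of a b x] assms
    by (simp add: algebra_simps)
qed

lemma bracket_leibniz_right:
  assumes "X \<in> sections A" "Y \<in> sections A" "f \<in> smooth_functions (base A)"
  shows "bracket A X (\<lambda>y. f y *\<^sub>R Y y) x = f x *\<^sub>R bracket A X Y x + anchor A x (X x) f *\<^sub>R Y x"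
proof -
  have "bracket A X (\<lambda>x. f x *\<^sub>R Y x) = (\<lambda>x. f x *\<^sub>R bracket A X Y x + anchor A x (X x) f *\<^sub>R Y x)"
    using A assms unfolding lie_algebroid_def by blast
  then show ?thesis by simp
qed

lemma bracket_leibniz_left:
  assumes "X \<in> sections A" "Y \<in> sections A" "f \<in> smooth_functions (base A)"
  shows "bracket A (\<lambda>y. f y *\<^sub>R Y y) X x = f x *\<^sub>R bracket A Y X x - anchor A x (X x) f *\<^sub>R Y x"
proof -
  have "(\<lambda>y. f y *\<^sub>R Y y) \<in> sections A"
    using assms by (intro sections_scale algebroid_bundle)
  then show ?thesis
    using bracket_skew[of _ X x] bracket_leibniz_right[OF assms, of x] assms
    by (simp add: algebra_simps)
qed

lemma bracket_zero: "X \<in> sections A \<Longrightarrow> bracket A X (\<lambda>y. 0) x = 0"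
  using bracket_linear_right[of X X X 0 0 x] by simp

text \<open>As for derivations: a bump function \<open>h\<close> makes \<open>h * (Y - Z)\<close>
  the zero section, and the Leibniz rule at \<open>x\<close>, where \<open>h\<close> is 1 and the
  difference vanishes, leaves the bracket with the difference.\<close>

lemma bracket_local:
  assumes "X \<in> sections A" "Y \<in> sections A" "Z \<in> sections A" "\<forall>\<^sub>F y in nhds x. Y y = Z y"
  shows "bracket A X Y x = bracket A X Z x" "bracket A Y X x = bracket A Z X x"
proof -
  obtain W where W: "open W" "x \<in> W" "\<And>y. y \<in> W \<Longrightarrow> Y y = Z y"
    using assms(4) by (auto simp: eventually_nhds)
  obtain h where h: "h \<in> smooth_functions (base A)" "\<forall>\<^sub>F y in nhds x. h y = 1"
    "\<And>y. y \<notin> W \<Longrightarrow> \<forall>\<^sub>F z in nhds y. h z = 0"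
    using smooth_bump_exists[OF A_base W(1,2)] by blast
  let ?D = "\<lambda>y. 1 *\<^sub>R Y y + (- 1) *\<^sub>R Z y"
  have D: "?D \<in> sections A"
    using assms by (intro sections_add sections_cscale algebroid_bundle)
  have "h y *\<^sub>R ?D y = 0" for y
    using W(3)[of y] h(3)[of y, THEN eventually_nhds_x_imp_x] by (cases "y \<in> W") auto
  then have "(\<lambda>y. h y *\<^sub>R ?D y) = (\<lambda>y. 0)" by blast
  then have "0 = h x *\<^sub>R bracket A X ?D x + anchor A x (X x) h *\<^sub>R ?D x"
    using bracket_leibniz_right[OF assms(1) D h(1), of x] bracket_zero[OF assms(1), of x] by metis
  moreover have "h x = 1" using h(2) by (rule eventually_nhds_x_imp_x)
  moreover have "?D x = 0" using W(2,3) by simp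
  ultimately have "bracket A X ?D x = 0" by simp
  then show "bracket A X Y x = bracket A X Z x"
    using bracket_linear_right[OF assms(2,3,1), of 1 "-1" x] by simp
  then show "bracket A Y X x = bracket A Z X x"
    using bracket_skew[OF assms(1,2), of x] bracket_skew[OF assms(1,3), of x] by simp
qed

lemma bracket_sum_right:
  assumes "X \<in> sections A"
  shows "(\<And>i. i \<in> I \<Longrightarrow> Y i \<in> sections A) \<Longrightarrow> bracket A X (\<lambda>y. \<Sum>i\<in>I. Y i y) x = (\<Sum>i\<in>I. bracket A X (Y i) x)"
proof (induction I rule: infinite_finite_induct)
  case (insert a I)
  then show ?case
    using bracket_linear_right[of "Y a" "\<lambda>y. \<Sum>i\<in>I. Y i y" X 1 1 x] assms
    by (simp add: sections_sum[OF algebroid_bundle])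
qed (simp_all add: bracket_zero[OF assms])

section \<open>The differential in degrees 0 and 1\<close>

lemma differential_0_form:
  assumes "v \<in> fibre A x"
  shows "differential A \<omega> x [v] = anchor A x v (\<lambda>y. \<omega> y [])"
proof -
  have K: "koszul A \<omega> Xs x = anchor A x v (\<lambda>y. \<omega> y [])" if Xs: "map (\<lambda>X. X x) Xs = [v]" for Xs
  proof -
    obtain X where "Xs = [X]" "X x = v" using Xs by (auto simp: map_eq_Cons_conv)
    then show ?thesis by (simp add: koszul_def del_def)
  qed
  obtain X where "X \<in> sections A" "X x = v"
    using section_through[OF algebroid_bundle assms] by blast
  then have "set [X] \<subseteq> sections A \<and> map (\<lambda>X. X x) [X] = [v]" by simp
  then have "(THE c. \<forall>Xs. set Xs \<subseteq> sections A \<and> map (\<lambda>X. X x) Xs = [v] \<longrightarrow> c = koszul A \<omega> Xs x) =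
      anchor A x v (\<lambda>y. \<omega> y [])"
    using K by (intro the_equality) metis+
  then show ?thesis using assms by (simp add: differential_def)
qed

definition koszul_1 where
  "koszul_1 \<omega> X Y x = anchor A x (X x) (\<lambda>y. \<omega> y [Y y]) - anchor A x (Y x) (\<lambda>y. \<omega> y [X y]) - \<omega> x [bracket A X Y x]"

text \<open>Tensoriality of the Koszul formula, without which the description of the differential
  has no solution. Near \<open>x\<close> the section \<open>Y\<close> is a combination of
  \<open>e i\<close> with coefficients \<open>f i\<close> vanishing at \<open>x\<close>; the bracket
  term and the first anchor term then both reduce to the sum of
  \<open>anchor A x (X x) (f i) * \<omega> x [e i x]\<close> and cancel.\<close>

lemma koszul_1_vanish:
  assumes \<omega>: "\<omega> \<in> kforms 1 A" and X: "X \<in> sections A" and Y: "Y \<in> sections A" and 0: "Y x = 0"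
  shows "koszul_1 \<omega> X Y x = 0"
proof -
  let ?n = "bdl_rank A"
  obtain e \<epsilon> where e: "\<And>i. i < ?n \<Longrightarrow> e i \<in> sections A" and \<epsilon>: "\<And>i. i < ?n \<Longrightarrow> \<epsilon> i \<in> kforms 1 A"
    and ev: "\<forall>\<^sub>F y in nhds x. dual_bases (fibre A y) ?n (\<lambda>i. e i y) (\<lambda>i. \<epsilon> i y)"
    using global_frame[OF algebroid_bundle] by blast
  define f where "f = (\<lambda>i y. \<epsilon> i y [Y y])"
  have f: "f i \<in> smooth_functions (base A)" if "i < ?n" for i
    unfolding f_def using \<epsilon>[OF that] Y by (rule A_eval)
  have f0: "f i x = 0" if "i < ?n" for i
    using alt_forms_1_zero[OF A_subspace A_form[OF \<epsilon>[OF that]]] 0 by (simp add: f_def)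
  let ?Y = "\<lambda>y. \<Sum>i<?n. f i y *\<^sub>R e i y"
  have fe: "(\<lambda>y. f i y *\<^sub>R e i y) \<in> sections A" if "i < ?n" for i
    using sections_scale[OF algebroid_bundle e f] that by blast
  have Y': "?Y \<in> sections A"
    using fe by (intro sections_sum[OF algebroid_bundle]) auto
  have eq: "\<forall>\<^sub>F y in nhds x. Y y = ?Y y"
    unfolding f_def using ev by eventually_elim (rule dual_bases_vector[OF _ A_fibre[OF Y], symmetric])
  have v: "X x \<in> fibre A x" using X by (rule A_fibre)
  note T = anchor_tangent[OF v]
  have "bracket A X Y x = bracket A X ?Y x"
    using bracket_local(1)[OF X Y Y' eq] .
  also have "\<dots> = (\<Sum>i<?n. bracket A X (\<lambda>y. f i y *\<^sub>R e i y) x)"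
    using fe by (intro bracket_sum_right X) auto
  also have "\<dots> = (\<Sum>i<?n. anchor A x (X x) (f i) *\<^sub>R e i x)"
    by (intro sum.cong refl) (simp add: bracket_leibniz_right[OF X e f] f0)
  finally have 1: "\<omega> x [bracket A X Y x] = (\<Sum>i<?n. anchor A x (X x) (f i) * \<omega> x [e i x])"
    using alt_forms_1_sum[OF A_subspace A_form[OF \<omega>], of "{..<?n}" "\<lambda>i. e i x"] A_fibre[OF e] by simp
  have \<omega>e: "(\<lambda>y. \<omega> y [e i y]) \<in> smooth_functions (base A)" if "i < ?n" for i
    using A_eval[OF \<omega> e[OF that]] .
  have "anchor A x (X x) (\<lambda>y. \<omega> y [Y y]) = anchor A x (X x) (\<lambda>y. \<Sum>i<?n. f i y * \<omega> y [e i y])"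
  proof (rule tangent_local[OF A_base T])
    show "(\<lambda>y. \<Sum>i<?n. f i y * \<omega> y [e i y]) \<in> smooth_functions (base A)"
      using f \<omega>e by (intro smooth_functions_sum smooth_functions_mult A_base) auto
    show "\<forall>\<^sub>F y in nhds x. \<omega> y [Y y] = (\<Sum>i<?n. f i y * \<omega> y [e i y])"
      using eq
    proof eventually_elim
      case (elim y)
      show ?case
        unfolding elim
        using alt_forms_1_sum[OF A_subspace A_form[OF \<omega>], of "{..<?n}" "\<lambda>i. e i y"] A_fibre[OF e] by simp
    qed
  qed (rule A_eval[OF \<omega> Y])
  also have "\<dots> = (\<Sum>i<?n. anchor A x (X x) (\<lambda>y. f i y * \<omega> y [e i y]))"
    using f \<omega>e by (intro tangent_sum[OF A_base T] smooth_functions_mult A_base) auto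
  also have "\<dots> = (\<Sum>i<?n. anchor A x (X x) (f i) * \<omega> x [e i x])"
    by (intro sum.cong refl) (simp add: tangent_mult[OF A_base T f \<omega>e] f0)
  finally show ?thesis
    using 1 0 by (simp add: koszul_1_def anchor_zero)
qed

lemma koszul_1_skew:
  assumes "\<omega> \<in> kforms 1 A" "X \<in> sections A" "Y \<in> sections A"
  shows "koszul_1 \<omega> X Y x = - koszul_1 \<omega> Y X x"
  using bracket_skew[OF assms(2,3), of x] alt_forms_1_minus[OF A_subspace A_form[OF assms(1)]]
    A_fibre[OF bracket_section[OF assms(3,2)]]
  by (simp add: koszul_1_def)

lemma koszul_1_diff:
  assumes \<omega>: "\<omega> \<in> kforms 1 A" and "X \<in> sections A" "Y \<in> sections A" "Z \<in> sections A"
  shows "koszul_1 \<omega> X (\<lambda>y. Y y - Z y) x = koszul_1 \<omega> X Y x - koszul_1 \<omega> X Z x"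
proof -
  have T: "anchor A x (X x) \<in> tangent_space (base A) x"
    using assms(2) by (intro anchor_tangent A_fibre)
  have 1: "(\<lambda>y. \<omega> y [Y y - Z y]) = (\<lambda>y. \<omega> y [Y y] - \<omega> y [Z y])"
    using alt_forms_1_diff[OF A_subspace A_form[OF \<omega>]] A_fibre assms by blast
  have 2: "bracket A X (\<lambda>y. Y y - Z y) x = bracket A X Y x - bracket A X Z x"
    using bracket_linear_right[OF assms(3,4,2), of 1 "-1" x] by simp
  show ?thesis
    unfolding koszul_1_def 1 2
    using tangent_diff[OF A_base T A_eval[OF \<omega> assms(3)] A_eval[OF \<omega> assms(4)]]
      anchor_diff[OF A_fibre[OF assms(3)] A_fibre[OF assms(4)]]
      alt_forms_1_diff[OF A_subspace A_form[OF \<omega>] A_fibre[OF bracket_section[OF assms(2,3)]]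
        A_fibre[OF bracket_section[OF assms(2,4)]]]
    by simp
qed

text \<open>The second argument is exchanged by applying the vanishing lemma to a difference, the
  first one likewise after swapping by skew-symmetry.\<close>

lemma koszul_1_cong:
  assumes \<omega>: "\<omega> \<in> kforms 1 A" and X: "X \<in> sections A" "X' \<in> sections A" and Y: "Y \<in> sections A" "Y' \<in> sections A"
    and eq: "X x = X' x" "Y x = Y' x"
  shows "koszul_1 \<omega> X Y x = koszul_1 \<omega> X' Y' x"
proof -
  have "koszul_1 \<omega> X (\<lambda>y. Y y - Y' y) x = 0"
    using \<omega> X Y eq by (intro koszul_1_vanish sections_diff[OF algebroid_bundle]) auto
  then have 1: "koszul_1 \<omega> X Y x = koszul_1 \<omega> X Y' x"
    using koszul_1_diff[OF \<omega> X(1) Y] by simp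
  have "koszul_1 \<omega> Y' (\<lambda>y. X y - X' y) x = 0"
    using \<omega> X Y eq by (intro koszul_1_vanish sections_diff[OF algebroid_bundle]) auto
  then have "koszul_1 \<omega> Y' X x = koszul_1 \<omega> Y' X' x"
    using koszul_1_diff[OF \<omega> Y(2) X] by simp
  then show ?thesis
    using 1 koszul_1_skew[OF \<omega>] X Y by metis
qed

lemma differential_1_form:
  assumes \<omega>: "\<omega> \<in> kforms 1 A" and X: "X \<in> sections A" and Y: "Y \<in> sections A"
  shows "differential A \<omega> x [X x, Y x] = koszul_1 \<omega> X Y x"
proof -
  have K: "koszul A \<omega> [U, V] x = koszul_1 \<omega> U V x" for U V
    by (simp add: koszul_def koszul_1_def del_def numeral_2_eq_2 One_nat_def)
  have "(THE c. \<forall>Xs. set Xs \<subseteq> sections A \<and> map (\<lambda>X. X x) Xs = [X x, Y x] \<longrightarrow> c = koszul A \<omega> Xs x) =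
      koszul_1 \<omega> X Y x"
  proof (rule the_equality)
    show "\<forall>Xs. set Xs \<subseteq> sections A \<and> map (\<lambda>X. X x) Xs = [X x, Y x] \<longrightarrow> koszul_1 \<omega> X Y x = koszul A \<omega> Xs x"
    proof (intro allI impI)
      fix Xs assume as: "set Xs \<subseteq> sections A \<and> map (\<lambda>X. X x) Xs = [X x, Y x]"
      then obtain U V where UV: "Xs = [U, V]" "U x = X x" "V x = Y x"
        by (auto simp: map_eq_Cons_conv)
      then show "koszul_1 \<omega> X Y x = koszul A \<omega> Xs x"
        using as K koszul_1_cong[OF \<omega> X _ Y, of U V x] by simp
    qed
    fix c
    assume "\<forall>Xs. set Xs \<subseteq> sections A \<and> map (\<lambda>X. X x) Xs = [X x, Y x] \<longrightarrow> c = koszul A \<omega> Xs x"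
    from this[rule_format, of "[X, Y]"] show "c = koszul_1 \<omega> X Y x"
      using X Y K by simp
  qed
  then show ?thesis using A_fibre X Y by (simp add: differential_def)
qed

subsection \<open>The Schouten bracket of a bivector with itself\<close>

text \<open>Both \<open>\<gamma>([P\<^sup>\<sharp>\<alpha>, P\<^sup>\<sharp>\<beta>])\<close> and \<open>\<rho>(P\<^sup>\<sharp>\<alpha>)(P(\<beta>, \<gamma>))\<close> fail to be function-linear in the forms, but their
  cyclic sums fail in the same way. The cyclic sum of the differences is \<open>[P, P](\<alpha>, \<beta>, \<gamma>) / 2\<close>, and it is
  polarised to compare it with the bracket of decomposable bivectors.\<close>

definition pair_defect where
  "pair_defect x U V \<gamma> = \<gamma> x [bracket A U V x] - anchor A x (U x) (\<lambda>y. \<gamma> y [V y])"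

text \<open>In the second argument the derivative of \<open>g\<close> from the bracket cancels that
  from the anchor term, so the defect is function-linear there. Scaling the first argument leaves
  the one residue \<open>g x * anchor A x (V x) f * \<gamma> x [U x]\<close>.\<close>

lemma pair_defect_scale:
  assumes \<gamma>: "\<gamma> \<in> kforms 1 A" and U: "U \<in> sections A" and V: "V \<in> sections A"
    and f: "f \<in> smooth_functions (base A)" and g: "g \<in> smooth_functions (base A)"
  shows "pair_defect x (\<lambda>y. f y *\<^sub>R U y) (\<lambda>y. g y *\<^sub>R V y) \<gamma> =
    f x * g x * pair_defect x U V \<gamma> - g x * anchor A x (V x) f * \<gamma> x [U x]"
proof -
  note fib = A_fibre[OF U] A_fibre[OF V] A_fibre[OF bracket_section[OF U V]]
  have fU: "(\<lambda>y. f y *\<^sub>R U y) \<in> sections A"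
    using U f by (intro sections_scale algebroid_bundle)
  have "bracket A (\<lambda>y. f y *\<^sub>R U y) (\<lambda>y. g y *\<^sub>R V y) x =
      g x *\<^sub>R (f x *\<^sub>R bracket A U V x - anchor A x (V x) f *\<^sub>R U x) +
      (f x * anchor A x (U x) g) *\<^sub>R V x"
    using bracket_leibniz_right[OF fU V g] bracket_leibniz_left[OF V U f] anchor_scale[OF fib(1)] by simp
  \<comment> \<open>Regrouped into nested two-term combinations, the shape in which linearity of
    \<gamma> is available; the coefficient 1 is padding.\<close>
  also have "\<dots> = (g x * f x) *\<^sub>R bracket A U V x +
      1 *\<^sub>R ((f x * anchor A x (U x) g) *\<^sub>R V x + (- (g x * anchor A x (V x) f)) *\<^sub>R U x)"
    by (simp add: algebra_simps)
  finally have b: "\<gamma> x [bracket A (\<lambda>y. f y *\<^sub>R U y) (\<lambda>y. g y *\<^sub>R V y) x] =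
      g x * f x * \<gamma> x [bracket A U V x] +
      1 * (f x * anchor A x (U x) g * \<gamma> x [V x] + (- (g x * anchor A x (V x) f)) * \<gamma> x [U x])"
    using fib by (simp only: alt_forms_1_linear[OF A_form[OF \<gamma>]] subspace_add[OF A_subspace]
        subspace_scale[OF A_subspace])
  have "(\<lambda>y. \<gamma> y [g y *\<^sub>R V y]) = (\<lambda>y. g y * \<gamma> y [V y])"
    using alt_forms_1_scale[OF A_subspace A_form[OF \<gamma>] A_fibre[OF V]] by blast
  then have "anchor A x (f x *\<^sub>R U x) (\<lambda>y. \<gamma> y [g y *\<^sub>R V y]) =
      f x * (anchor A x (U x) g * \<gamma> x [V x] + g x * anchor A x (U x) (\<lambda>y. \<gamma> y [V y]))"
    using anchor_scale[OF fib(1)] tangent_mult[OF A_base anchor_tangent[OF fib(1)] g A_eval[OF \<gamma> V]] by simp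
  then show ?thesis
    unfolding pair_defect_def b by (simp add: algebra_simps)
qed

lemma pair_defect_add_left:
  assumes \<gamma>: "\<gamma> \<in> kforms 1 A" and "U \<in> sections A" "U' \<in> sections A" "V \<in> sections A"
  shows "pair_defect x (\<lambda>y. U y + U' y) V \<gamma> = pair_defect x U V \<gamma> + pair_defect x U' V \<gamma>"
  using bracket_linear_left[OF assms(2-4), of 1 1 x]
    alt_forms_1_add[OF A_subspace A_form[OF \<gamma>]] A_fibre bracket_section assms(2-4)
    anchor_add[OF A_fibre[OF assms(2)] A_fibre[OF assms(3)]]
  by (simp add: pair_defect_def)

lemma pair_defect_add_right:
  assumes \<gamma>: "\<gamma> \<in> kforms 1 A" and "V \<in> sections A" "V' \<in> sections A" "U \<in> sections A"
  shows "pair_defect x U (\<lambda>y. V y + V' y) \<gamma> = pair_defect x U V \<gamma> + pair_defect x U V' \<gamma>"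
proof -
  have "(\<lambda>y. \<gamma> y [V y + V' y]) = (\<lambda>y. \<gamma> y [V y] + \<gamma> y [V' y])"
    using alt_forms_1_add[OF A_subspace A_form[OF \<gamma>]] A_fibre assms by blast
  then show ?thesis
    using bracket_linear_right[OF assms(2-4), of 1 1 x]
      alt_forms_1_add[OF A_subspace A_form[OF \<gamma>]] A_fibre bracket_section assms(2-4)
      tangent_add[OF A_base anchor_tangent[OF A_fibre[OF assms(4)]] A_eval[OF \<gamma> assms(2)] A_eval[OF \<gamma> assms(3)]]
    by (simp add: pair_defect_def)
qed

lemma pair_defect_zero:
  assumes "\<gamma> \<in> kforms 1 A" "U \<in> sections A"
  shows "pair_defect x (\<lambda>y. 0) U \<gamma> = 0" "pair_defect x U (\<lambda>y. 0) \<gamma> = 0"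
  using pair_defect_add_left[OF assms(1) sections_zero[OF algebroid_bundle] sections_zero[OF algebroid_bundle] assms(2)]
    pair_defect_add_right[OF assms(1) sections_zero[OF algebroid_bundle] sections_zero[OF algebroid_bundle] assms(2)]
  by simp_all

lemma sections_sum_list:
  "(\<And>l. l \<in> set L \<Longrightarrow> U l \<in> sections A) \<Longrightarrow> (\<lambda>y. \<Sum>l\<leftarrow>L. U l y) \<in> sections A"
  by (induction L) (auto intro: sections_zero[OF algebroid_bundle] sections_add[OF algebroid_bundle])

lemma pair_defect_sum_left:
  assumes "\<gamma> \<in> kforms 1 A" "V \<in> sections A" "\<And>l. l \<in> set L \<Longrightarrow> U l \<in> sections A"
  shows "pair_defect x (\<lambda>y. \<Sum>l\<leftarrow>L. U l y) V \<gamma> = (\<Sum>l\<leftarrow>L. pair_defect x (U l) V \<gamma>)"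
  using assms(3)
  by (induction L) (simp_all add: pair_defect_zero assms pair_defect_add_left sections_sum_list)

lemma pair_defect_sum_right:
  assumes "\<gamma> \<in> kforms 1 A" "V \<in> sections A" "\<And>l. l \<in> set L \<Longrightarrow> U l \<in> sections A"
  shows "pair_defect x V (\<lambda>y. \<Sum>l\<leftarrow>L. U l y) \<gamma> = (\<Sum>l\<leftarrow>L. pair_defect x V (U l) \<gamma>)"
  using assms(3)
  by (induction L) (simp_all add: pair_defect_zero assms pair_defect_add_right sections_sum_list)

lemma pair_defect_local:
  assumes \<gamma>: "\<gamma> \<in> kforms 1 A" and "U \<in> sections A" "V \<in> sections A" "U' \<in> sections A" "V' \<in> sections A"
    and U: "\<forall>\<^sub>F y in nhds x. U y = U' y" and V: "\<forall>\<^sub>F y in nhds x. V y = V' y"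
  shows "pair_defect x U V \<gamma> = pair_defect x U' V' \<gamma>"
proof -
  have "bracket A U V x = bracket A U' V' x"
    using bracket_local(2)[OF assms(3,2,4) U] bracket_local(1)[OF assms(4,3,5) V] by simp
  moreover have "U x = U' x" using U by (rule eventually_nhds_x_imp_x)
  moreover have "anchor A x (U x) (\<lambda>y. \<gamma> y [V y]) = anchor A x (U x) (\<lambda>y. \<gamma> y [V' y])"
    by (rule tangent_local[OF A_base anchor_tangent[OF A_fibre[OF assms(2)]] A_eval[OF \<gamma> assms(3)] A_eval[OF \<gamma> assms(5)]])
      (use V in \<open>auto elim: eventually_mono\<close>)
  ultimately show ?thesis by (simp add: pair_defect_def)
qed

lemma neg_eval:
  assumes "\<theta> \<in> kforms 1 A" "Z \<in> sections A"
  shows "(\<lambda>y. - \<theta> y [Z y]) \<in> smooth_functions (base A)"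
  using smooth_functions_diff[OF A_base smooth_functions_const[OF A_base, of 0] A_eval[OF assms]] by simp

text \<open>This is \<open>sharp\<close> of the decomposable bivector with factors
  \<open>Xs ! 0\<close> and \<open>Xs ! 1\<close>, with the sign fixed by
  \<beta>(\<open>sharp\<close> \<alpha>) = P(\<alpha>, \<beta>).\<close>

definition simple_sharp :: "('m \<Rightarrow> 'v) list \<Rightarrow> ('m \<Rightarrow> 'v list \<Rightarrow> real) \<Rightarrow> 'm \<Rightarrow> 'v" where
  "simple_sharp Xs \<alpha> = (\<lambda>y. \<alpha> y [(Xs ! 0) y] *\<^sub>R (Xs ! 1) y + (- \<alpha> y [(Xs ! 1) y]) *\<^sub>R (Xs ! 0) y)"

lemma simple_sharp_section:
  assumes "\<alpha> \<in> kforms 1 A" "length Xs = 2" "set Xs \<subseteq> sections A"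
  shows "simple_sharp Xs \<alpha> \<in> sections A"
proof -
  have "Xs ! 0 \<in> sections A" "Xs ! 1 \<in> sections A"
    using assms(2,3) by (auto intro: nth_mem)
  then show ?thesis
    unfolding simple_sharp_def using assms(1)
    by (intro sections_add sections_scale algebroid_bundle neg_eval A_eval)
qed

text \<open>The summand of \<open>schouten_bracket\<close> for degrees 2 and 2, in the same
  syntactic form, so that its definition can later be folded into this name.\<close>

definition schouten_term where
  "schouten_term x Xs Ys = (\<Sum>i<2. \<Sum>j<2. (- 1) ^ (i + j) *\<^sub>R wedge (fibre A x)
    (map (\<lambda>X. X x) (bracket A (Xs ! i) (Ys ! j) # del i Xs @ del j Ys)))"

definition schouten_sum where
  "schouten_sum x C D = (\<Sum>Xs\<leftarrow>C. \<Sum>Ys\<leftarrow>D. schouten_term x Xs Ys)"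

text \<open>The polarised form of the relation between the Schouten bracket and the cyclic sum: the
  two decomposables differ, so each cyclic term appears with their roles exchanged as well. After
  expansion all derivatives of pairings cancel, and the brackets that remain are those in the
  determinants of \<open>wedge_3\<close>.\<close>

lemma schouten_simple:
  assumes \<alpha>: "\<alpha> \<in> kforms 1 A" and \<beta>: "\<beta> \<in> kforms 1 A" and \<gamma>: "\<gamma> \<in> kforms 1 A"
    and X: "length Xs = 2" "set Xs \<subseteq> sections A" and Y: "length Ys = 2" "set Ys \<subseteq> sections A"
  shows "schouten_term x Xs Ys [\<alpha> x, \<beta> x, \<gamma> x] =
    pair_defect x (simple_sharp Xs \<alpha>) (simple_sharp Ys \<beta>) \<gamma> + pair_defect x (simple_sharp Ys \<alpha>) (simple_sharp Xs \<beta>) \<gamma> +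
    (pair_defect x (simple_sharp Xs \<beta>) (simple_sharp Ys \<gamma>) \<alpha> + pair_defect x (simple_sharp Ys \<beta>) (simple_sharp Xs \<gamma>) \<alpha>) +
    (pair_defect x (simple_sharp Xs \<gamma>) (simple_sharp Ys \<alpha>) \<beta> + pair_defect x (simple_sharp Ys \<gamma>) (simple_sharp Xs \<alpha>) \<beta>)"
proof -
  obtain X1 X2 where Xs: "Xs = [X1, X2]" and X12: "X1 \<in> sections A" "X2 \<in> sections A"
    using X by (auto simp: length_Suc_conv numeral_2_eq_2)
  obtain Y1 Y2 where Ys: "Ys = [Y1, Y2]" and Y12: "Y1 \<in> sections A" "Y2 \<in> sections A"
    using Y by (auto simp: length_Suc_conv numeral_2_eq_2)
  note [simp] = A_form[OF \<alpha>] A_form[OF \<beta>] A_form[OF \<gamma>]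
  have two: "{..<2::nat} = {0, 1}" by auto
  have L: "schouten_term x Xs Ys [\<alpha> x, \<beta> x, \<gamma> x] =
      wedge (fibre A x) [bracket A X1 Y1 x, X2 x, Y2 x] [\<alpha> x, \<beta> x, \<gamma> x]
      - wedge (fibre A x) [bracket A X1 Y2 x, X2 x, Y1 x] [\<alpha> x, \<beta> x, \<gamma> x]
      - wedge (fibre A x) [bracket A X2 Y1 x, X1 x, Y2 x] [\<alpha> x, \<beta> x, \<gamma> x]
      + wedge (fibre A x) [bracket A X2 Y2 x, X1 x, Y1 x] [\<alpha> x, \<beta> x, \<gamma> x]"
    by (simp add: schouten_term_def two Xs Ys del_def scaleR_fun_def One_nat_def)
  have aneg: "anchor A x (V x) (\<lambda>y. - \<theta> y [Z y]) = - anchor A x (V x) (\<lambda>y. \<theta> y [Z y])"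
    if "\<theta> \<in> kforms 1 A" "Z \<in> sections A" "V \<in> sections A" for \<theta> Z V
    using tangent_scale[OF A_base anchor_tangent[OF A_fibre[OF that(3)]] A_eval[OF that(1,2)], where c = "-1"] by simp
  \<comment> \<open>Additivity in both arguments splits the defect into four parts, and
    \<open>pair_defect_scale\<close> pulls out the coefficients; each part keeps one derivative as
    residue.\<close>
  have D: "pair_defect x (simple_sharp [U1, U2] \<theta>) (simple_sharp [V1, V2] \<eta>) \<zeta> =
      \<theta> x [U1 x] * \<eta> x [V1 x] * pair_defect x U2 V2 \<zeta> - \<eta> x [V1 x] * anchor A x (V2 x) (\<lambda>y. \<theta> y [U1 y]) * \<zeta> x [U2 x]
      - (\<theta> x [U1 x] * \<eta> x [V2 x] * pair_defect x U2 V1 \<zeta> - \<eta> x [V2 x] * anchor A x (V1 x) (\<lambda>y. \<theta> y [U1 y]) * \<zeta> x [U2 x])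
      - (\<theta> x [U2 x] * \<eta> x [V1 x] * pair_defect x U1 V2 \<zeta> - \<eta> x [V1 x] * anchor A x (V2 x) (\<lambda>y. \<theta> y [U2 y]) * \<zeta> x [U1 x])
      + (\<theta> x [U2 x] * \<eta> x [V2 x] * pair_defect x U1 V1 \<zeta> - \<eta> x [V2 x] * anchor A x (V1 x) (\<lambda>y. \<theta> y [U2 y]) * \<zeta> x [U1 x])"
    if \<theta>: "\<theta> \<in> kforms 1 A" and \<eta>: "\<eta> \<in> kforms 1 A" and \<zeta>: "\<zeta> \<in> kforms 1 A"
      and U: "U1 \<in> sections A" "U2 \<in> sections A" and V: "V1 \<in> sections A" "V2 \<in> sections A" for \<theta> \<eta> \<zeta> U1 U2 V1 V2
  proof -
    have s: "(\<lambda>y. \<theta> y [U1 y] *\<^sub>R U2 y) \<in> sections A" "(\<lambda>y. (- \<theta> y [U2 y]) *\<^sub>R U1 y) \<in> sections A"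
      "(\<lambda>y. \<eta> y [V1 y] *\<^sub>R V2 y) \<in> sections A" "(\<lambda>y. (- \<eta> y [V2 y]) *\<^sub>R V1 y) \<in> sections A"
      by (intro sections_scale[OF algebroid_bundle] neg_eval A_eval U V \<theta> \<eta>)+
    have s': "(\<lambda>y. \<eta> y [V1 y] *\<^sub>R V2 y + (- \<eta> y [V2 y]) *\<^sub>R V1 y) \<in> sections A"
      using s(3,4) by (rule sections_add[OF algebroid_bundle])
    show ?thesis
      unfolding simple_sharp_def
      by (simp only: nth_Cons_0 nth_Cons_Suc One_nat_def
          pair_defect_add_left[OF \<zeta> s(1,2) s'] pair_defect_add_right[OF \<zeta> s(3,4) s(1)]
          pair_defect_add_right[OF \<zeta> s(3,4) s(2)]
          pair_defect_scale[OF \<zeta> U(2) V(2) A_eval[OF \<theta> U(1)] A_eval[OF \<eta> V(1)]]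
          pair_defect_scale[OF \<zeta> U(2) V(1) A_eval[OF \<theta> U(1)] neg_eval[OF \<eta> V(2)]]
          pair_defect_scale[OF \<zeta> U(1) V(2) neg_eval[OF \<theta> U(2)] A_eval[OF \<eta> V(1)]]
          pair_defect_scale[OF \<zeta> U(1) V(1) neg_eval[OF \<theta> U(2)] neg_eval[OF \<eta> V(2)]]
          aneg[OF \<theta> U(2) V(1)] aneg[OF \<theta> U(2) V(2)])
  qed
  \<comment> \<open>Orients every bracket as one of an entry of \<open>Xs\<close> with an entry of
    \<open>Ys\<close>; with brackets, pairings and derivatives as atoms, the claim is then a
    polynomial identity.\<close>
  have sk: "\<theta> x [bracket A V U x] = - \<theta> x [bracket A U V x]"
    if "\<theta> \<in> kforms 1 A" "U \<in> sections A" "V \<in> sections A" for \<theta> U V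
    using bracket_skew[OF that(3,2), of x] alt_forms_1_minus[OF A_subspace A_form[OF that(1)]]
      A_fibre[OF bracket_section[OF that(2,3)]] by simp
  show ?thesis
    unfolding L
    unfolding Xs Ys D[OF \<alpha> \<beta> \<gamma> X12 Y12] D[OF \<alpha> \<beta> \<gamma> Y12 X12] D[OF \<beta> \<gamma> \<alpha> X12 Y12] D[OF \<beta> \<gamma> \<alpha> Y12 X12]
      D[OF \<gamma> \<alpha> \<beta> X12 Y12] D[OF \<gamma> \<alpha> \<beta> Y12 X12]
    unfolding wedge_3[OF A_form[OF \<alpha>] A_form[OF \<beta>] A_form[OF \<gamma>]] pair_defect_def
      sk[OF \<alpha> X12(1) Y12(1)] sk[OF \<alpha> X12(1) Y12(2)] sk[OF \<alpha> X12(2) Y12(1)] sk[OF \<alpha> X12(2) Y12(2)]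
      sk[OF \<beta> X12(1) Y12(1)] sk[OF \<beta> X12(1) Y12(2)] sk[OF \<beta> X12(2) Y12(1)] sk[OF \<beta> X12(2) Y12(2)]
      sk[OF \<gamma> X12(1) Y12(1)] sk[OF \<gamma> X12(1) Y12(2)] sk[OF \<gamma> X12(2) Y12(1)] sk[OF \<gamma> X12(2) Y12(2)]
    by algebra
qed

text \<open>Equality is needed in a neighbourhood and not just at \<open>x\<close>, because pair
  defects differentiate the sections to which this is applied.\<close>

lemma decomposes_sharp:
  assumes P: "P \<in> multisections 2 A" and C: "decomposes A 2 P C x" and \<alpha>: "\<alpha> \<in> kforms 1 A"
  shows "\<forall>\<^sub>F y in nhds x. sharp A P \<alpha> y = (\<Sum>Xs\<leftarrow>C. simple_sharp Xs \<alpha> y)"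
proof -
  have Cs: "length Xs = 2 \<and> set Xs \<subseteq> sections A" if "Xs \<in> set C" for Xs
    using C that by (simp add: decomposes_def)
  obtain W where W: "open W" "x \<in> W" "\<And>y. y \<in> W \<Longrightarrow> P y = (\<Sum>Xs\<leftarrow>C. wedge (fibre A y) (map (\<lambda>X. X y) Xs))"
    using C unfolding decomposes_def by blast
  have "sharp A P \<alpha> y = (\<Sum>Xs\<leftarrow>C. simple_sharp Xs \<alpha> y)" if y: "y \<in> W" for y
  proof (rule sharp_eqI[OF algebroid_bundle])
    have "(\<lambda>y. \<Sum>Xs\<leftarrow>C. simple_sharp Xs \<alpha> y) \<in> sections A"
      using Cs by (intro sections_sum_list simple_sharp_section \<alpha>) auto
    then show "(\<Sum>Xs\<leftarrow>C. simple_sharp Xs \<alpha> y) \<in> fibre A y" by (rule A_fibre)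
    fix \<beta> assume \<beta>: "\<beta> \<in> alt_forms 1 (fibre A y)"
    have *: "\<beta> [\<Sum>Xs\<leftarrow>D. simple_sharp Xs \<alpha> y] = (\<Sum>Xs\<leftarrow>D. wedge (fibre A y) (map (\<lambda>X. X y) Xs) [\<alpha> y, \<beta>])"
      if "set D \<subseteq> set C" for D
      using that
    proof (induction D)
      case Nil
      show ?case using alt_forms_1_zero[OF A_subspace \<beta>] by simp
    next
      case (Cons Xs D)
      have Xs: "length Xs = 2" "set Xs \<subseteq> sections A" using Cs Cons.prems by auto
      obtain X1 X2 where X: "Xs = [X1, X2]" "X1 \<in> sections A" "X2 \<in> sections A"
        using Xs by (auto simp: length_Suc_conv numeral_2_eq_2)
      have "(\<lambda>y. \<Sum>Xs\<leftarrow>D. simple_sharp Xs \<alpha> y) \<in> sections A"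
        using Cs Cons.prems by (intro sections_sum_list simple_sharp_section \<alpha>) auto
      then have "\<beta> [\<Sum>Xs\<leftarrow>Xs # D. simple_sharp Xs \<alpha> y] =
          \<beta> [simple_sharp Xs \<alpha> y] + \<beta> [\<Sum>Xs\<leftarrow>D. simple_sharp Xs \<alpha> y]"
        using alt_forms_1_add[OF A_subspace \<beta> A_fibre[OF simple_sharp_section[OF \<alpha> Xs], of y]] A_fibre by force
      moreover have "\<beta> [simple_sharp Xs \<alpha> y] = wedge (fibre A y) (map (\<lambda>X. X y) Xs) [\<alpha> y, \<beta>]"
        using alt_forms_1_linear[OF \<beta> A_fibre[OF X(3)] A_fibre[OF X(2)], of "\<alpha> y [X1 y]" "- \<alpha> y [X2 y]"]
        by (simp add: simple_sharp_def X(1) wedge_2[OF A_form[OF \<alpha>] \<beta>] One_nat_def)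
      ultimately show ?case using Cons by simp
    qed
    show "\<beta> [\<Sum>Xs\<leftarrow>C. simple_sharp Xs \<alpha> y] = P y [\<alpha> y, \<beta>]"
      using *[of C] by (simp add: W(3)[OF y] sum_list_fun_apply)
  qed
  with W(1,2) show ?thesis by (auto simp: eventually_nhds)
qed

text \<open>In dual frames near \<open>x\<close>, \<open>P\<close> is the sum of
  \<open>P y [\<epsilon> i y, \<epsilon> j y] / 2\<close> times the wedge of \<open>e i\<close> and
  \<open>e j\<close>, over all ordered pairs.\<close>

lemma decomposition_exists:
  assumes P: "P \<in> multisections 2 A"
  shows "\<exists>C. decomposes A 2 P C x"
proof -
  let ?n = "bdl_rank A"
  obtain e \<epsilon> where e: "\<And>i. i < ?n \<Longrightarrow> e i \<in> sections A" and \<epsilon>: "\<And>i. i < ?n \<Longrightarrow> \<epsilon> i \<in> kforms 1 A"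
    and ev: "\<forall>\<^sub>F y in nhds x. dual_bases (fibre A y) ?n (\<lambda>i. e i y) (\<lambda>i. \<epsilon> i y)"
    using global_frame[OF algebroid_bundle] by blast
  \<comment> \<open>The coefficient is absorbed into the first factor. The factor 1/2 compensates
    for counting each unordered pair twice.\<close>
  define Z where "Z = (\<lambda>i j y. (1/2 * P y [\<epsilon> i y, \<epsilon> j y]) *\<^sub>R e i y)"
  have Z: "Z i j \<in> sections A" if "i < ?n" "j < ?n" for i j
  proof -
    have "(\<lambda>y. P y [\<epsilon> i y, \<epsilon> j y]) \<in> smooth_functions (base A)"
      using P \<epsilon> that by (simp add: multisections_2_iff[OF algebroid_bundle])
    then show ?thesis
      unfolding Z_def using e that smooth_functions_const[OF A_base]
      by (intro sections_scale[OF algebroid_bundle] smooth_functions_mult[OF A_base])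
  qed
  define C where "C = concat (map (\<lambda>i. map (\<lambda>j. [Z i j, e j]) [0..<?n]) [0..<?n])"
  obtain W where W: "open W" "x \<in> W" and b: "\<And>y. y \<in> W \<Longrightarrow> dual_bases (fibre A y) ?n (\<lambda>i. e i y) (\<lambda>i. \<epsilon> i y)"
    using ev unfolding eventually_nhds by blast
  have "P y = (\<Sum>Xs\<leftarrow>C. wedge (fibre A y) (map (\<lambda>X. X y) Xs))" if y: "y \<in> W" for y
  proof
    fix as
    let ?D = "alt_forms 1 (fibre A y)"
    have D: "subspace ?D" by (rule alt_forms_1_subspace[OF A_subspace])
    have Py: "P y \<in> alt_forms 2 ?D" using P by (rule multisections_2_fibre[OF algebroid_bundle])
    have "(\<Sum>Xs\<leftarrow>C. wedge (fibre A y) (map (\<lambda>X. X y) Xs)) as =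
        (\<Sum>i\<leftarrow>[0..<?n]. \<Sum>j\<leftarrow>[0..<?n]. wedge (fibre A y) [Z i j y, e j y] as)"
      by (simp add: C_def sum_list_fun_apply sum_list_concat_map comp_def)
    also have "\<dots> = (\<Sum>i<?n. \<Sum>j<?n. wedge (fibre A y) [Z i j y, e j y] as)"
      by (simp add: interv_sum_list_conv_sum_set_nat atLeast0LessThan)
    also have "\<dots> = P y as"
    proof (cases "length as = 2 \<and> set as \<subseteq> ?D")
      case True
      then obtain a b where as: "as = [a, b]" "a \<in> ?D" "b \<in> ?D"
        by (auto simp: length_Suc_conv numeral_2_eq_2)
      have "wedge (fibre A y) [Z i j y, e j y] as =
          1/2 * (a [e i y] * (b [e j y] * P y [\<epsilon> i y, \<epsilon> j y])) - 1/2 * (b [e i y] * (a [e j y] * P y [\<epsilon> i y, \<epsilon> j y]))"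
        if "i < ?n" "j < ?n" for i j
        using alt_forms_1_scale[OF A_subspace as(2) A_fibre[OF e[OF that(1)]], of "1/2 * P y [\<epsilon> i y, \<epsilon> j y]"]
          alt_forms_1_scale[OF A_subspace as(3) A_fibre[OF e[OF that(1)]], of "1/2 * P y [\<epsilon> i y, \<epsilon> j y]"]
        by (simp only: as(1) wedge_2[OF as(2,3)] Z_def) (simp add: algebra_simps)
      then have "(\<Sum>i<?n. \<Sum>j<?n. wedge (fibre A y) [Z i j y, e j y] as) =
          1/2 * P y [a, b] - 1/2 * P y [b, a]"
        by (simp add: dual_bases_bilinear[OF b[OF y] Py as(2,3)] dual_bases_bilinear[OF b[OF y] Py as(3,2)]
            sum_subtractf sum_distrib_left)
      also have "\<dots> = P y as"
        using alt_forms_2_skew[OF D Py as(3,2)] as(1) by simp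
      finally show ?thesis .
    next
      case False
      then have "P y as = 0"
        by (rule alt_forms_support[OF Py])
      moreover have "wedge (fibre A y) [Z i j y, e j y] as = 0" for i j
        using False by (intro wedge_support) (auto simp: numeral_2_eq_2)
      ultimately show ?thesis by simp
    qed
    finally show "P y as = (\<Sum>Xs\<leftarrow>C. wedge (fibre A y) (map (\<lambda>X. X y) Xs)) as" by simp
  qed
  moreover have "\<forall>Xs\<in>set C. length Xs = 2 \<and> set Xs \<subseteq> sections A"
    using Z e by (auto simp: C_def)
  ultimately show ?thesis
    using W unfolding decomposes_def by blast
qed

definition jacobiator where
  "jacobiator P \<alpha> \<beta> \<gamma> x = pair_defect x (sharp A P \<alpha>) (sharp A P \<beta>) \<gamma> +
    pair_defect x (sharp A P \<beta>) (sharp A P \<gamma>) \<alpha> + pair_defect x (sharp A P \<gamma>) (sharp A P \<alpha>) \<beta>"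

text \<open>The right-hand side mentions neither \<open>C\<close> nor \<open>D\<close>, which is
  what makes the Schouten bracket well defined. The factor 2 arises because each pair defect is
  expanded in two ways, with \<open>C\<close> in the first slot and \<open>D\<close> in the second
  and conversely, matching the two terms of the polarised identity.\<close>

lemma schouten_decomposition:
  assumes P: "P \<in> multisections 2 A" and C: "decomposes A 2 P C x" and D: "decomposes A 2 P D x"
    and \<alpha>: "\<alpha> \<in> kforms 1 A" and \<beta>: "\<beta> \<in> kforms 1 A" and \<gamma>: "\<gamma> \<in> kforms 1 A"
  shows "schouten_sum x C D [\<alpha> x, \<beta> x, \<gamma> x] =
    2 * jacobiator P \<alpha> \<beta> \<gamma> x"
proof -
  have Cs: "length Xs = 2" "set Xs \<subseteq> sections A" if "Xs \<in> set C" for Xs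
    using C that by (simp_all add: decomposes_def)
  have Ds: "length Xs = 2" "set Xs \<subseteq> sections A" if "Xs \<in> set D" for Xs
    using D that by (simp_all add: decomposes_def)
  have CD: "pair_defect x (sharp A P \<theta>) (sharp A P \<eta>) \<zeta> =
      (\<Sum>Xs\<leftarrow>C. \<Sum>Ys\<leftarrow>D. pair_defect x (simple_sharp Xs \<theta>) (simple_sharp Ys \<eta>) \<zeta>)"
    "pair_defect x (sharp A P \<theta>) (sharp A P \<eta>) \<zeta> =
      (\<Sum>Xs\<leftarrow>C. \<Sum>Ys\<leftarrow>D. pair_defect x (simple_sharp Ys \<theta>) (simple_sharp Xs \<eta>) \<zeta>)"
    if \<theta>: "\<theta> \<in> kforms 1 A" and \<eta>: "\<eta> \<in> kforms 1 A" and \<zeta>: "\<zeta> \<in> kforms 1 A" for \<theta> \<eta> \<zeta>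
  proof -
    have sC: "(\<lambda>y. \<Sum>Xs\<leftarrow>C. simple_sharp Xs \<kappa> y) \<in> sections A" if "\<kappa> \<in> kforms 1 A" for \<kappa>
      using Cs that by (intro sections_sum_list simple_sharp_section) auto
    have sD: "(\<lambda>y. \<Sum>Xs\<leftarrow>D. simple_sharp Xs \<kappa> y) \<in> sections A" if "\<kappa> \<in> kforms 1 A" for \<kappa>
      using Ds that by (intro sections_sum_list simple_sharp_section) auto
    note sh = sharp_sections[OF algebroid_bundle P]
    have "pair_defect x (sharp A P \<theta>) (sharp A P \<eta>) \<zeta> =
        pair_defect x (\<lambda>y. \<Sum>Xs\<leftarrow>C. simple_sharp Xs \<theta> y) (\<lambda>y. \<Sum>Ys\<leftarrow>D. simple_sharp Ys \<eta> y) \<zeta>"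
      by (intro pair_defect_local \<zeta> sh \<theta> \<eta> sC sD decomposes_sharp[OF P C] decomposes_sharp[OF P D])
    also have "\<dots> = (\<Sum>Xs\<leftarrow>C. pair_defect x (simple_sharp Xs \<theta>) (\<lambda>y. \<Sum>Ys\<leftarrow>D. simple_sharp Ys \<eta> y) \<zeta>)"
      by (intro pair_defect_sum_left \<zeta> sD \<eta> simple_sharp_section \<theta> Cs)
    also have "\<dots> = (\<Sum>Xs\<leftarrow>C. \<Sum>Ys\<leftarrow>D. pair_defect x (simple_sharp Xs \<theta>) (simple_sharp Ys \<eta>) \<zeta>)"
      by (intro arg_cong[where f = sum_list] map_cong refl pair_defect_sum_right \<zeta> simple_sharp_section \<theta> \<eta> Cs Ds)
    finally show "pair_defect x (sharp A P \<theta>) (sharp A P \<eta>) \<zeta> =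
      (\<Sum>Xs\<leftarrow>C. \<Sum>Ys\<leftarrow>D. pair_defect x (simple_sharp Xs \<theta>) (simple_sharp Ys \<eta>) \<zeta>)" .
    have "pair_defect x (sharp A P \<theta>) (sharp A P \<eta>) \<zeta> =
        pair_defect x (\<lambda>y. \<Sum>Ys\<leftarrow>D. simple_sharp Ys \<theta> y) (\<lambda>y. \<Sum>Xs\<leftarrow>C. simple_sharp Xs \<eta> y) \<zeta>"
      by (intro pair_defect_local \<zeta> sh \<theta> \<eta> sC sD decomposes_sharp[OF P C] decomposes_sharp[OF P D])
    also have "\<dots> = (\<Sum>Xs\<leftarrow>C. pair_defect x (\<lambda>y. \<Sum>Ys\<leftarrow>D. simple_sharp Ys \<theta> y) (simple_sharp Xs \<eta>) \<zeta>)"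
      by (intro pair_defect_sum_right \<zeta> sD \<theta> simple_sharp_section \<eta> Cs)
    also have "\<dots> = (\<Sum>Xs\<leftarrow>C. \<Sum>Ys\<leftarrow>D. pair_defect x (simple_sharp Ys \<theta>) (simple_sharp Xs \<eta>) \<zeta>)"
      by (intro arg_cong[where f = sum_list] map_cong refl pair_defect_sum_left \<zeta> simple_sharp_section \<theta> \<eta> Cs Ds)
    finally show "pair_defect x (sharp A P \<theta>) (sharp A P \<eta>) \<zeta> =
      (\<Sum>Xs\<leftarrow>C. \<Sum>Ys\<leftarrow>D. pair_defect x (simple_sharp Ys \<theta>) (simple_sharp Xs \<eta>) \<zeta>)" .
  qed
  have "2 * jacobiator P \<alpha> \<beta> \<gamma> x =
    (\<Sum>Xs\<leftarrow>C. \<Sum>Ys\<leftarrow>D.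
      pair_defect x (simple_sharp Xs \<alpha>) (simple_sharp Ys \<beta>) \<gamma> + pair_defect x (simple_sharp Ys \<alpha>) (simple_sharp Xs \<beta>) \<gamma> +
      (pair_defect x (simple_sharp Xs \<beta>) (simple_sharp Ys \<gamma>) \<alpha> + pair_defect x (simple_sharp Ys \<beta>) (simple_sharp Xs \<gamma>) \<alpha>) +
      (pair_defect x (simple_sharp Xs \<gamma>) (simple_sharp Ys \<alpha>) \<beta> + pair_defect x (simple_sharp Ys \<gamma>) (simple_sharp Xs \<alpha>) \<beta>))"
    using CD[OF \<alpha> \<beta> \<gamma>] CD[OF \<beta> \<gamma> \<alpha>] CD[OF \<gamma> \<alpha> \<beta>]
    by (simp add: jacobiator_def sum_list_addf)
  also have "\<dots> = (\<Sum>Xs\<leftarrow>C. \<Sum>Ys\<leftarrow>D. schouten_term x Xs Ys [\<alpha> x, \<beta> x, \<gamma> x])"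
    by (intro arg_cong[where f = sum_list] map_cong refl schouten_simple[symmetric] \<alpha> \<beta> \<gamma> Cs Ds)
  finally show ?thesis by (simp only: schouten_sum_def sum_list_fun_apply)
qed

text \<open>Every triple of covectors at \<open>x\<close> extends to forms, so all decompositions
  give the same value and the definite description is solved by the sum for one chosen decomposition
  \<open>C x\<close>. Its values on triples are twice the cyclic sum.\<close>

lemma schouten_zero_iff:
  assumes P: "P \<in> multisections 2 A"
  shows "schouten_bracket A 2 P 2 P = 0 \<longleftrightarrow>
    (\<forall>\<alpha>\<in>kforms 1 A. \<forall>\<beta>\<in>kforms 1 A. \<forall>\<gamma>\<in>kforms 1 A. \<forall>x. jacobiator P \<alpha> \<beta> \<gamma> x = 0)"
proof -
  obtain C where C: "\<And>x. decomposes A 2 P (C x) x"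
    using decomposition_exists[OF P] by metis
  have J: "schouten_sum x C' D [\<alpha> x, \<beta> x, \<gamma> x] = 2 * jacobiator P \<alpha> \<beta> \<gamma> x"
    if "decomposes A 2 P C' x" "decomposes A 2 P D x" "\<alpha> \<in> kforms 1 A" "\<beta> \<in> kforms 1 A" "\<gamma> \<in> kforms 1 A"
    for C' D x \<alpha> \<beta> \<gamma>
    by (rule schouten_decomposition[OF P that])
  \<comment> \<open>The sums are compared as functions on all lists of covectors; off triples in the
    dual fibre every wedge has the default value 0.\<close>
  have S0: "schouten_sum x C' D as = 0" if CD: "decomposes A 2 P C' x" "decomposes A 2 P D x"
    and as: "\<not> (length as = 3 \<and> set as \<subseteq> alt_forms 1 (fibre A x))" for C' D x as
  proof -
    have "wedge (fibre A x) (map (\<lambda>X. X x) (bracket A (Xs ! i) (Ys ! j) # del i Xs @ del j Ys)) as = 0"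
      if "Xs \<in> set C'" "Ys \<in> set D" "i < 2" "j < 2" for Xs Ys i j
    proof (rule wedge_support)
      have "length Xs = 2" "length Ys = 2" using CD that by (simp_all add: decomposes_def)
      then have "length (map (\<lambda>X. X x) (bracket A (Xs ! i) (Ys ! j) # del i Xs @ del j Ys)) = 3"
        using that by (simp add: del_def)
      then show "\<not> (length as = length (map (\<lambda>X. X x) (bracket A (Xs ! i) (Ys ! j) # del i Xs @ del j Ys)) \<and>
          set as \<subseteq> alt_forms 1 (fibre A x))"
        using as by simp
    qed
    then show ?thesis
      by (simp add: schouten_sum_def schouten_term_def sum_list_fun_apply sum_fun_apply scaleR_fun_def sum_list_zero)
  qed
  have eq: "schouten_sum x C' D = schouten_sum x (C x) (C x)" if CD: "decomposes A 2 P C' x" "decomposes A 2 P D x" for C' D x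
  proof
    fix as
    show "schouten_sum x C' D as = schouten_sum x (C x) (C x) as"
    proof (cases "length as = 3 \<and> set as \<subseteq> alt_forms 1 (fibre A x)")
      case True
      then obtain a b c where as: "as = [a, b, c]" "a \<in> alt_forms 1 (fibre A x)"
        "b \<in> alt_forms 1 (fibre A x)" "c \<in> alt_forms 1 (fibre A x)"
        by (auto simp: length_Suc_conv numeral_3_eq_3)
      obtain \<alpha> where \<alpha>: "\<alpha> \<in> kforms 1 A" "\<alpha> x = a" using form_through[OF algebroid_bundle as(2)] by blast
      obtain \<beta> where \<beta>: "\<beta> \<in> kforms 1 A" "\<beta> x = b" using form_through[OF algebroid_bundle as(3)] by blast
      obtain \<gamma> where \<gamma>: "\<gamma> \<in> kforms 1 A" "\<gamma> x = c" using form_through[OF algebroid_bundle as(4)] by blast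
      show ?thesis
        using J[OF CD \<alpha>(1) \<beta>(1) \<gamma>(1)] J[OF C[of x] C[of x] \<alpha>(1) \<beta>(1) \<gamma>(1)] as(1) \<alpha>(2) \<beta>(2) \<gamma>(2) by simp
    qed (use S0[OF CD] S0[OF C C] in simp)
  qed
  have sch: "schouten_bracket A 2 P 2 P x = schouten_sum x (C x) (C x)" for x
    unfolding schouten_bracket_def schouten_term_def[symmetric] schouten_sum_def[symmetric]
  proof (rule the_equality)
    show "\<forall>C' D. decomposes A 2 P C' x \<and> decomposes A 2 P D x \<longrightarrow>
        schouten_sum x (C x) (C x) = schouten_sum x C' D"
      by (intro allI impI eq[symmetric]) auto
    fix R
    assume "\<forall>C' D. decomposes A 2 P C' x \<and> decomposes A 2 P D x \<longrightarrow> R = schouten_sum x C' D"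
    from this[rule_format, of "C x" "C x"] show "R = schouten_sum x (C x) (C x)"
      using C by blast
  qed
  show ?thesis
  proof
    assume 0: "schouten_bracket A 2 P 2 P = 0"
    show "\<forall>\<alpha>\<in>kforms 1 A. \<forall>\<beta>\<in>kforms 1 A. \<forall>\<gamma>\<in>kforms 1 A. \<forall>x. jacobiator P \<alpha> \<beta> \<gamma> x = 0"
    proof (intro ballI allI)
      fix \<alpha> \<beta> \<gamma> x assume "\<alpha> \<in> kforms 1 A" "\<beta> \<in> kforms 1 A" "\<gamma> \<in> kforms 1 A"
      then show "jacobiator P \<alpha> \<beta> \<gamma> x = 0"
        using J[OF C C, of \<alpha> \<beta> \<gamma> x] sch[of x] 0 by simp
    qed
  next
    assume j: "\<forall>\<alpha>\<in>kforms 1 A. \<forall>\<beta>\<in>kforms 1 A. \<forall>\<gamma>\<in>kforms 1 A. \<forall>x. jacobiator P \<alpha> \<beta> \<gamma> x = 0"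
    have "schouten_sum x (C x) (C x) as = 0" for x as
    proof (cases "length as = 3 \<and> set as \<subseteq> alt_forms 1 (fibre A x)")
      case True
      then obtain a b c where as: "as = [a, b, c]" "a \<in> alt_forms 1 (fibre A x)"
        "b \<in> alt_forms 1 (fibre A x)" "c \<in> alt_forms 1 (fibre A x)"
        by (auto simp: length_Suc_conv numeral_3_eq_3)
      obtain \<alpha> where \<alpha>: "\<alpha> \<in> kforms 1 A" "\<alpha> x = a" using form_through[OF algebroid_bundle as(2)] by blast
      obtain \<beta> where \<beta>: "\<beta> \<in> kforms 1 A" "\<beta> x = b" using form_through[OF algebroid_bundle as(3)] by blast
      obtain \<gamma> where \<gamma>: "\<gamma> \<in> kforms 1 A" "\<gamma> x = c" using form_through[OF algebroid_bundle as(4)] by blast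
      show ?thesis
        using J[OF C[of x] C[of x] \<alpha>(1) \<beta>(1) \<gamma>(1)] as(1) \<alpha> \<beta> \<gamma> j by simp
    qed (use S0[OF C C] in simp)
    then show "schouten_bracket A 2 P 2 P = 0"
      using sch by (intro ext) simp
  qed
qed

end

subsection \<open>Pullback of forms and lifts of sections along a bundle morphism\<close>

context
  fixes E :: "('m::{t2_space,second_countable_topology}, 'e::real_normed_vector, 'v::real_vector, 'y) vbundle_scheme"
    and F :: "('n::{t2_space,second_countable_topology}, 'f::real_normed_vector, 'w::real_vector, 'z) vbundle_scheme"
    and \<Phi> :: "'m \<Rightarrow> 'v \<Rightarrow> 'w" and \<pi> :: "'m \<Rightarrow> 'n"
  assumes E: "vector_bundle E" and F: "vector_bundle F" and mor: "bundle_morphism E F \<Phi> \<pi>"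
begin

lemma morphism_base: "smooth_map (base E) (base F) \<pi>"
  using mor by (simp add: bundle_morphism_def)

lemma morphism_fibre: "v \<in> fibre E x \<Longrightarrow> \<Phi> x v \<in> fibre F (\<pi> x)"
  using mor by (simp add: bundle_morphism_def)

lemma morphism_linear:
  "v \<in> fibre E x \<Longrightarrow> w \<in> fibre E x \<Longrightarrow> \<Phi> x (a *\<^sub>R v + b *\<^sub>R w) = a *\<^sub>R \<Phi> x v + b *\<^sub>R \<Phi> x w"
  using mor by (simp add: bundle_morphism_def)

lemma morphism_add: "v \<in> fibre E x \<Longrightarrow> w \<in> fibre E x \<Longrightarrow> \<Phi> x (v + w) = \<Phi> x v + \<Phi> x w"
  using morphism_linear[of v x w 1 1] by simp

lemma morphism_diff: "v \<in> fibre E x \<Longrightarrow> w \<in> fibre E x \<Longrightarrow> \<Phi> x (v - w) = \<Phi> x v - \<Phi> x w"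
  using morphism_linear[of v x w 1 "-1"] by simp

lemma morphism_scale: "v \<in> fibre E x \<Longrightarrow> \<Phi> x (a *\<^sub>R v) = a *\<^sub>R \<Phi> x v"
  using morphism_linear[of v x v a 0] by simp

lemma morphism_zero: "\<Phi> x 0 = 0"
  using morphism_scale[of 0 x 0] subspace_0[OF fibre_subspace[OF E]] by simp

lemma morphism_sum:
  "(\<And>i. i \<in> I \<Longrightarrow> v i \<in> fibre E x) \<Longrightarrow> \<Phi> x (\<Sum>i\<in>I. c i *\<^sub>R v i) = (\<Sum>i\<in>I. c i *\<^sub>R \<Phi> x (v i))"
proof (induction I rule: infinite_finite_induct)
  case (insert a I)
  have "(\<Sum>i\<in>I. c i *\<^sub>R v i) \<in> fibre E x" "c a *\<^sub>R v a \<in> fibre E x"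
    using insert.prems by (auto intro!: subspace_sum subspace_scale fibre_subspace[OF E])
  then show ?case
    using insert by (simp add: morphism_add morphism_scale)
qed (simp_all add: morphism_zero)

lemma morphism_eventually: "\<forall>\<^sub>F z in nhds (\<pi> x). Q z \<Longrightarrow> \<forall>\<^sub>F y in nhds x. Q (\<pi> y)"
proof -
  assume Q: "\<forall>\<^sub>F z in nhds (\<pi> x). Q z"
  have "isCont \<pi> x"
    using morphism_base by (simp add: smooth_map_def continuous_on_eq_continuous_at)
  then have "filterlim \<pi> (nhds (\<pi> x)) (nhds x)"
    by (simp add: isCont_def tendsto_at_iff_tendsto_nhds)
  with Q show ?thesis by (rule eventually_compose_filterlim)
qed

lemma morphism_smooth_at: "smooth_at (base F) (\<pi> x) f \<Longrightarrow> smooth_at (base E) x (\<lambda>y. f (\<pi> y))"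
  by (rule smooth_at_compose[OF bundle_base[OF E] bundle_base[OF F] morphism_base])

lemma morphism_smooth: "f \<in> smooth_functions (base F) \<Longrightarrow> (\<lambda>y. f (\<pi> y)) \<in> smooth_functions (base E)"
  by (simp add: smooth_functions_iff[OF bundle_base[OF E]] smooth_functions_iff[OF bundle_base[OF F]] morphism_smooth_at)

text \<open>Smoothness of a bundle morphism is stated through frames only; this is the form of it
  that global sections and forms can use.\<close>

lemma pullback_pairing_smooth:
  assumes \<beta>: "\<beta> \<in> kforms 1 F" and X: "X \<in> sections E"
  shows "(\<lambda>y. \<beta> (\<pi> y) [\<Phi> y (X y)]) \<in> smooth_functions (base E)"
  unfolding smooth_functions_iff[OF bundle_base[OF E]]
proof
  fix x
  let ?n = "bdl_rank E" and ?k = "bdl_rank F"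
  obtain U e where U: "(U, e) \<in> frames E" "x \<in> U" using frame_exists[OF E] by blast
  obtain V b where V: "(V, b) \<in> frames F" "\<pi> x \<in> V" using frame_exists[OF F] by blast
  have oV: "open (\<pi> -` V)"
    using morphism_base frameD(1)[OF F V(1)] continuous_on_open_vimage[OF open_UNIV, of \<pi>]
    by (simp add: smooth_map_def)
  let ?W = "U \<inter> \<pi> -` V"
  have W: "open ?W" "x \<in> ?W" using oV frameD(1)[OF E U(1)] U(2) V(2) by auto
  obtain a where a: "\<And>i. i < ?n \<Longrightarrow> smooth_at (base E) x (a i)"
    "\<forall>\<^sub>F y in nhds x. X y = (\<Sum>i<?n. a i y *\<^sub>R e i y)"
    using sec_at_in_frame[OF E _ U, of X] X by (auto simp: sections_iff[OF E])
  have "\<forall>i. i < ?n \<longrightarrow> smooth_comb (base E) ?W ?k (\<lambda>j x. b j (\<pi> x)) (\<lambda>x. \<Phi> x (e i x))"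
  proof -
    have "\<forall>p\<in>frames E. \<forall>q\<in>frames F. \<forall>i<?n. smooth_comb (base E) (fst p \<inter> \<pi> -` fst q) ?k
        (\<lambda>j x. snd q j (\<pi> x)) (\<lambda>x. \<Phi> x (snd p i x))"
      using mor by (simp add: bundle_morphism_def case_prod_unfold)
    from bspec[OF bspec[OF this U(1)] V(1)] show ?thesis by simp
  qed
  then have "\<forall>i. \<exists>c. i < ?n \<longrightarrow> (\<forall>j<?k. smooth_fun_on (base E) ?W (c j)) \<and>
      (\<forall>y\<in>?W. \<Phi> y (e i y) = (\<Sum>j<?k. c j y *\<^sub>R b j (\<pi> y)))"
    unfolding smooth_comb_def by blast
  from choice[OF this] obtain c where
    c: "\<And>i j. i < ?n \<Longrightarrow> j < ?k \<Longrightarrow> smooth_fun_on (base E) ?W (c i j)"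
    "\<And>i y. i < ?n \<Longrightarrow> y \<in> ?W \<Longrightarrow> \<Phi> y (e i y) = (\<Sum>j<?k. c i j y *\<^sub>R b j (\<pi> y))"
    by blast
  have cs: "smooth_at (base E) x (c i j)" if "i < ?n" "j < ?k" for i j
    using c(1)[OF that] W by (auto simp: smooth_at_def)
  have bs: "smooth_at (base F) (\<pi> x) (\<lambda>z. \<beta> z [b j z])" if j: "j < ?k" for j
  proof -
    obtain t where t: "t \<in> sections F" "\<forall>\<^sub>F z in nhds (\<pi> x). t z = b j z"
      using section_extension[OF F sec_at_frame[OF F V j]] by blast
    have "smooth_at (base F) (\<pi> x) (\<lambda>z. \<beta> z [t z])"
      using kforms_1_eval[OF F \<beta> t(1)] by (simp add: smooth_functions_iff[OF bundle_base[OF F]])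
    then show ?thesis
      by (rule smooth_at_cong[OF bundle_base[OF F]]) (use t(2) in \<open>auto elim: eventually_mono\<close>)
  qed
  have "smooth_at (base E) x (\<lambda>y. \<Sum>i<?n. a i y * (\<Sum>j<?k. c i j y * \<beta> (\<pi> y) [b j (\<pi> y)]))"
    using a(1) cs morphism_smooth_at[OF bs]
    by (intro smooth_at_sum smooth_at_mult bundle_base[OF E]) auto
  moreover have "\<forall>\<^sub>F y in nhds x. (\<Sum>i<?n. a i y * (\<Sum>j<?k. c i j y * \<beta> (\<pi> y) [b j (\<pi> y)])) = \<beta> (\<pi> y) [\<Phi> y (X y)]"
    using a(2) eventually_nhds_in_open[OF W]
  proof eventually_elim
    case (elim y)
    have em: "e i y \<in> fibre E y" if "i < ?n" for i
      using basis_of_mem[OF frameD(2)[OF E U(1)]] elim(2) that by blast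
    have bm: "b j (\<pi> y) \<in> fibre F (\<pi> y)" if "j < ?k" for j
      using basis_of_mem[OF frameD(2)[OF F V(1)]] elim(2) that by blast
    have "\<Phi> y (X y) = (\<Sum>i<?n. a i y *\<^sub>R \<Phi> y (e i y))"
      using morphism_sum[of "{..<?n}" "\<lambda>i. e i y" y "\<lambda>i. a i y"] em by (simp add: elim(1))
    then have "\<beta> (\<pi> y) [\<Phi> y (X y)] = (\<Sum>i<?n. a i y * \<beta> (\<pi> y) [\<Phi> y (e i y)])"
      using alt_forms_1_sum[OF fibre_subspace[OF F] kforms_1_fibre[OF F \<beta>], of "{..<?n}" "\<lambda>i. \<Phi> y (e i y)"]
        em morphism_fibre by simp
    also have "\<dots> = (\<Sum>i<?n. a i y * (\<Sum>j<?k. c i j y * \<beta> (\<pi> y) [b j (\<pi> y)]))"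
      using alt_forms_1_sum[OF fibre_subspace[OF F] kforms_1_fibre[OF F \<beta>], of "{..<?k}" "\<lambda>j. b j (\<pi> y)"]
        bm c(2)[OF _ elim(2)] by (intro sum.cong refl) simp
    finally show ?case by simp
  qed
  ultimately show "smooth_at (base E) x (\<lambda>y. \<beta> (\<pi> y) [\<Phi> y (X y)])"
    by (rule smooth_at_cong[OF bundle_base[OF E]])
qed

lemma pullback_eval: "v \<in> fibre E x \<Longrightarrow> pullback E \<Phi> \<pi> \<beta> x [v] = \<beta> (\<pi> x) [\<Phi> x v]"
  by (simp add: pullback_def)

text \<open>On lists of length other than 1 both sides vanish, the left one because \<beta> has the
  default value 0 there. The right side makes sense for a single covector at \<open>\<pi> x\<close>,
  which is how the projected bivector is built.\<close>

lemma pullback_covector: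
  assumes "\<beta> (\<pi> x) \<in> alt_forms 1 (fibre F (\<pi> x))"
  shows "pullback E \<Phi> \<pi> \<beta> x = covector (fibre E x) (\<lambda>v. \<beta> (\<pi> x) [\<Phi> x v])"
proof
  fix vs :: "'v list"
  consider v where "vs = [v]" | "length vs \<noteq> 1"
    by (cases vs rule: list.exhaust; cases "tl vs") (auto simp: One_nat_def)
  then show "pullback E \<Phi> \<pi> \<beta> x vs = covector (fibre E x) (\<lambda>v. \<beta> (\<pi> x) [\<Phi> x v]) vs"
  proof cases
    case 2
    then have "\<beta> (\<pi> x) (map (\<Phi> x) vs) = 0"
      by (intro alt_forms_support[OF assms]) simp
    then show ?thesis
      using 2 by (auto simp: pullback_def covector_def split: list.split)
  qed (simp add: pullback_def covector_def)
qed

lemma pullback_covector_alt: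
  assumes "a \<in> alt_forms 1 (fibre F (\<pi> x))"
  shows "covector (fibre E x) (\<lambda>v. a [\<Phi> x v]) \<in> alt_forms 1 (fibre E x)"
  using alt_forms_1_linear[OF assms morphism_fibre morphism_fibre]
  by (intro covector_in_alt_forms fibre_subspace[OF E]) (simp add: morphism_linear)

lemma pullback_kforms_1:
  assumes \<beta>: "\<beta> \<in> kforms 1 F"
  shows "pullback E \<Phi> \<pi> \<beta> \<in> kforms 1 E"
  unfolding kforms_1_iff[OF E]
proof (intro conjI allI ballI)
  show "pullback E \<Phi> \<pi> \<beta> x \<in> alt_forms 1 (fibre E x)" for x
    using pullback_covector[of \<beta> x, OF kforms_1_fibre[OF F \<beta>]]
      pullback_covector_alt[of "\<beta> (\<pi> x)" x, OF kforms_1_fibre[OF F \<beta>]] by simp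
  show "(\<lambda>y. pullback E \<Phi> \<pi> \<beta> y [s y]) \<in> smooth_functions (base E)" if "s \<in> sections E" for s
    using pullback_pairing_smooth[OF \<beta> that] section_fibre[OF E that] by (simp add: pullback_eval)
qed

text \<open>\<open>u\<close> is a map on the base of \<open>E\<close> and not a section of
  \<open>F\<close> composed with \<pi>: the germs are multiplied by functions on the base of
  \<open>E\<close>, which need not descend.\<close>

definition liftable where
  "liftable x u \<longleftrightarrow> (\<exists>X\<in>sections E. \<forall>\<^sub>F y in nhds x. \<Phi> y (X y) = u y)"

lemma liftable_add: "liftable x u \<Longrightarrow> liftable x w \<Longrightarrow> liftable x (\<lambda>y. u y + w y)"
proof -
  assume "liftable x u" "liftable x w"
  then obtain X Y where X: "X \<in> sections E" "\<forall>\<^sub>F y in nhds x. \<Phi> y (X y) = u y"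
    and Y: "Y \<in> sections E" "\<forall>\<^sub>F y in nhds x. \<Phi> y (Y y) = w y"
    unfolding liftable_def by blast
  have "\<forall>\<^sub>F y in nhds x. \<Phi> y (X y + Y y) = u y + w y"
    using X(2) Y(2) by eventually_elim (simp add: morphism_add section_fibre[OF E] X(1) Y(1))
  then show ?thesis
    unfolding liftable_def by (rule bexI[OF _ sections_add[OF E X(1) Y(1)]])
qed

lemma liftable_scale:
  assumes "liftable x u" "smooth_at (base E) x f"
  shows "liftable x (\<lambda>y. f y *\<^sub>R u y)"
proof -
  obtain X where X: "X \<in> sections E" "\<forall>\<^sub>F y in nhds x. \<Phi> y (X y) = u y"
    using assms(1) unfolding liftable_def by blast
  obtain h where h: "h \<in> smooth_functions (base E)" "\<forall>\<^sub>F y in nhds x. h y = f y"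
    using smooth_function_extension[OF bundle_base[OF E] assms(2)] by blast
  have "\<forall>\<^sub>F y in nhds x. \<Phi> y (h y *\<^sub>R X y) = f y *\<^sub>R u y"
    using X(2) h(2) by eventually_elim (simp add: morphism_scale section_fibre[OF E] X(1))
  then show ?thesis
    unfolding liftable_def by (rule bexI[OF _ sections_scale[OF E X(1) h(1)]])
qed

lemma liftable_zero: "liftable x (\<lambda>y. 0)"
  unfolding liftable_def by (rule bexI[OF _ sections_zero[OF E]]) (simp add: morphism_zero)

lemma liftable_cong: "liftable x u \<Longrightarrow> \<forall>\<^sub>F y in nhds x. u y = w y \<Longrightarrow> liftable x w"
proof -
  assume "liftable x u" and uw: "\<forall>\<^sub>F y in nhds x. u y = w y"
  then obtain X where X: "X \<in> sections E" "\<forall>\<^sub>F y in nhds x. \<Phi> y (X y) = u y"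
    unfolding liftable_def by blast
  have "\<forall>\<^sub>F y in nhds x. \<Phi> y (X y) = w y"
    using X(2) uw by eventually_elim simp
  then show ?thesis
    unfolding liftable_def by (rule bexI[OF _ X(1)])
qed

lemma liftable_sum:
  "(\<And>i. i \<in> I \<Longrightarrow> liftable x (u i)) \<Longrightarrow> liftable x (\<lambda>y. \<Sum>i\<in>I. u i y)"
  by (induction I rule: infinite_finite_induct) (simp_all add: liftable_zero liftable_add)

text \<open>Nakayama's lemma over the local ring of germs of functions at \<open>x\<close>.\<close>

lemma liftable_nakayama:
  fixes n :: nat
  assumes "\<And>j. j < n \<Longrightarrow> \<exists>l m. liftable x l \<and> (\<forall>k<n. smooth_at (base E) x (m k) \<and> m k x = 0) \<and>
    (\<forall>\<^sub>F y in nhds x. b j y = l y + (\<Sum>k<n. m k y *\<^sub>R b k y))"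
  shows "j < n \<Longrightarrow> liftable x (b j)"
  using assms
proof (induction n arbitrary: j)
  case (Suc n)
  note M = bundle_base[OF E]
  obtain l m where l: "liftable x l" and m: "\<And>k. k < Suc n \<Longrightarrow> smooth_at (base E) x (m k)" "\<And>k. k < Suc n \<Longrightarrow> m k x = 0"
    and bn: "\<forall>\<^sub>F y in nhds x. b n y = l y + (\<Sum>k<Suc n. m k y *\<^sub>R b k y)"
    using Suc.prems(2)[of n] by blast
  \<comment> \<open>Since \<open>m n\<close> vanishes at \<open>x\<close>, \<open>1 - m n\<close> is
    invertible near \<open>x\<close>, so the relation for \<open>b n\<close> can be solved for
    \<open>b n\<close> itself.\<close>
  define r where "r = (\<lambda>y. inverse (1 - m n y))"
  have r1: "smooth_at (base E) x (\<lambda>y. 1 - m n y)"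
    using m(1)[of n] by (intro smooth_at_diff M smooth_at_const) auto
  have r: "smooth_at (base E) x r"
    unfolding r_def using r1 m(2)[of n] by (intro smooth_at_inverse M) auto
  have ne: "\<forall>\<^sub>F y in nhds x. 1 - m n y \<noteq> 0"
  proof -
    have "((\<lambda>y. 1 - m n y) \<longlongrightarrow> 1) (at x)"
      using smooth_at_continuous[OF M r1] m(2)[of n] by (simp add: isCont_def)
    then have "\<forall>\<^sub>F y in at x. 1 - m n y \<noteq> 0"
      by (rule tendsto_imp_eventually_ne) simp
    then show ?thesis using m(2)[of n] by (simp add: eventually_nhds_conv_at)
  qed
  have bn': "\<forall>\<^sub>F y in nhds x. b n y = r y *\<^sub>R l y + (\<Sum>k<n. (r y * m k y) *\<^sub>R b k y)"
    using bn ne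
  proof eventually_elim
    case (elim y)
    have "(1 - m n y) *\<^sub>R b n y = l y + (\<Sum>k<n. m k y *\<^sub>R b k y)"
      using elim(1) by (simp add: scaleR_diff_left algebra_simps)
    then have "r y *\<^sub>R (1 - m n y) *\<^sub>R b n y = r y *\<^sub>R (l y + (\<Sum>k<n. m k y *\<^sub>R b k y))"
      by simp
    then show ?case
      using elim(2) by (simp add: r_def scaleR_add_right scaleR_sum_right)
  qed
  \<comment> \<open>Substituting the solved expression eliminates \<open>b n\<close> from the other
    relations. The new coefficients still vanish at \<open>x\<close>, because \<open>m'\<close>
    does, and the new remainder is still liftable; the induction hypothesis applies.\<close>
  have lift: "liftable x (b j)" if j: "j < n" for j
  proof (rule Suc.IH[OF j])
    fix j assume "j < n"
    then have "j < Suc n" by simp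
    from Suc.prems(2)[OF this] obtain l' m' where *: "liftable x l' \<and>
        (\<forall>k<Suc n. smooth_at (base E) x (m' k) \<and> m' k x = 0) \<and>
        (\<forall>\<^sub>F y in nhds x. b j y = l' y + (\<Sum>k<Suc n. m' k y *\<^sub>R b k y))"
      by (elim exE)
    note l' = conjunct1[OF *] and bj = conjunct2[OF conjunct2[OF *]]
    have m': "smooth_at (base E) x (m' k)" "m' k x = 0" if "k < Suc n" for k
      using conjunct1[OF conjunct2[OF *]] that by blast+
    have 1: "liftable x (\<lambda>y. l' y + (m' n y * r y) *\<^sub>R l y)"
      using l l' m' r by (intro liftable_add liftable_scale smooth_at_mult[OF M]) auto
    have 2: "\<forall>k<n. smooth_at (base E) x (\<lambda>y. m' k y + m' n y * (r y * m k y)) \<and> m' k x + m' n x * (r x * m k x) = 0"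
      using m m' r by (auto intro!: smooth_at_add[OF M] smooth_at_mult[OF M])
    have 3: "\<forall>\<^sub>F y in nhds x. b j y = l' y + (m' n y * r y) *\<^sub>R l y + (\<Sum>k<n. (m' k y + m' n y * (r y * m k y)) *\<^sub>R b k y)"
      using bj bn'
    proof eventually_elim
      case (elim y)
      have "b j y = l' y + ((\<Sum>k<n. m' k y *\<^sub>R b k y) + m' n y *\<^sub>R b n y)"
        using elim(1) by simp
      also have "\<dots> = l' y + ((\<Sum>k<n. m' k y *\<^sub>R b k y) + m' n y *\<^sub>R (r y *\<^sub>R l y + (\<Sum>k<n. (r y * m k y) *\<^sub>R b k y)))"
        using elim(2) by simp
      finally show ?case
        by (simp add: scaleR_add_right scaleR_add_left scaleR_sum_right sum.distrib algebra_simps)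
    qed
    show "\<exists>l m. liftable x l \<and> (\<forall>k<n. smooth_at (base E) x (m k) \<and> m k x = 0) \<and>
        (\<forall>\<^sub>F y in nhds x. b j y = l y + (\<Sum>k<n. m k y *\<^sub>R b k y))"
      by (intro exI[of _ "\<lambda>y. l' y + (m' n y * r y) *\<^sub>R l y"] exI[of _ "\<lambda>k y. m' k y + m' n y * (r y * m k y)"]
          conjI 1 2 3)
  qed
  have "liftable x (\<lambda>y. r y *\<^sub>R l y + (\<Sum>k<n. (r y * m k y) *\<^sub>R b k y))"
    using l r m lift by (intro liftable_add liftable_scale liftable_sum smooth_at_mult[OF M]) auto
  moreover have "\<forall>\<^sub>F y in nhds x. r y *\<^sub>R l y + (\<Sum>k<n. (r y * m k y) *\<^sub>R b k y) = b n y"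
    using bn' by (rule eventually_mono) simp
  ultimately have "liftable x (b n)" by (rule liftable_cong)
  then show ?case using lift Suc.prems(1) by (cases "j = n") auto
qed simp

context
  assumes onto: "\<And>x. \<Phi> x ` fibre E x = fibre F (\<pi> x)"
begin

lemma fibre_lift:
  assumes "w \<in> fibre F (\<pi> x)"
  obtains v where "v \<in> fibre E x" "\<Phi> x v = w"
proof -
  have "w \<in> \<Phi> x ` fibre E x"
    using assms by (simp only: onto)
  then show ?thesis using that by fast
qed

text \<open>It suffices to lift a local frame \<open>b j\<close> of \<open>F\<close>. Surjectivity
  on the single fibre over \<open>x\<close> gives a section whose image agrees with
  \<open>b j\<close> at \<open>x\<close>.\<close>

lemma liftable_section:
  assumes Y: "Y \<in> sections F"
  shows "liftable x (\<lambda>y. Y (\<pi> y))"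
proof -
  let ?k = "bdl_rank F"
  note M = bundle_base[OF E]
  obtain b \<epsilon> where b: "\<And>i. i < ?k \<Longrightarrow> b i \<in> sections F" and \<epsilon>: "\<And>i. i < ?k \<Longrightarrow> \<epsilon> i \<in> kforms 1 F"
    and ev: "\<forall>\<^sub>F z in nhds (\<pi> x). dual_bases (fibre F z) ?k (\<lambda>i. b i z) (\<lambda>i. \<epsilon> i z)"
    using global_frame[OF F] by blast
  have lift: "liftable x (\<lambda>y. b j (\<pi> y))" if j: "j < ?k" for j
  proof (rule liftable_nakayama[of ?k, OF _ j])
    fix j assume j: "j < ?k"
    obtain v where v: "v \<in> fibre E x" "\<Phi> x v = b j (\<pi> x)"
      using fibre_lift section_fibre[OF F b[OF j]] by blast
    obtain X where X: "X \<in> sections E" "X x = v"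
      using section_through[OF E v(1)] by blast
    \<comment> \<open>The coordinates of the error between \<open>b j\<close> and the image of
      \<open>X\<close>; they vanish at \<open>x\<close> since \<open>X\<close> was chosen to hit
      \<open>b j\<close> there.\<close>
    define m where "m = (\<lambda>k y. (if k = j then 1 else 0) - \<epsilon> k (\<pi> y) [\<Phi> y (X y)])"
    have "liftable x (\<lambda>y. \<Phi> y (X y))"
      using X(1) unfolding liftable_def by (intro bexI[of _ X]) auto
    moreover have "\<forall>k<?k. smooth_at (base E) x (m k) \<and> m k x = 0"
    proof (intro allI impI conjI)
      fix k assume k: "k < ?k"
      have "smooth_at (base E) x (\<lambda>y. \<epsilon> k (\<pi> y) [\<Phi> y (X y)])"
        using pullback_pairing_smooth[OF \<epsilon>[OF k] X(1)] by (simp add: smooth_functions_iff[OF M])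
      then show "smooth_at (base E) x (m k)"
        unfolding m_def by (intro smooth_at_diff[OF M] smooth_at_const[OF M])
      show "m k x = 0"
        using dual_bases_pairing[OF eventually_nhds_x_imp_x[OF ev] k j] v(2) X(2) by (simp add: m_def)
    qed
    moreover have "\<forall>\<^sub>F y in nhds x. b j (\<pi> y) = \<Phi> y (X y) + (\<Sum>k<?k. m k y *\<^sub>R b k (\<pi> y))"
      using morphism_eventually[OF ev]
    proof eventually_elim
      case (elim y)
      have "(\<Sum>k<?k. m k y *\<^sub>R b k (\<pi> y)) =
          (\<Sum>k<?k. (if k = j then 1 else 0) *\<^sub>R b k (\<pi> y)) - (\<Sum>k<?k. \<epsilon> k (\<pi> y) [\<Phi> y (X y)] *\<^sub>R b k (\<pi> y))"
        by (simp add: m_def scaleR_diff_left sum_subtractf)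
      also have "\<dots> = b j (\<pi> y) - \<Phi> y (X y)"
        using dual_bases_vector[OF elim morphism_fibre[OF section_fibre[OF E X(1)]]] j
        by (simp add: if_distrib[of "\<lambda>c. c *\<^sub>R _"] cong: if_cong)
      finally show ?case by simp
    qed
    ultimately show "\<exists>l m. liftable x l \<and> (\<forall>k<?k. smooth_at (base E) x (m k) \<and> m k x = 0) \<and>
        (\<forall>\<^sub>F y in nhds x. b j (\<pi> y) = l y + (\<Sum>k<?k. m k y *\<^sub>R b k (\<pi> y)))"
      by (intro exI[of _ "\<lambda>y. \<Phi> y (X y)"] exI[of _ m] conjI)
  qed
  have "liftable x (\<lambda>y. \<Sum>j<?k. \<epsilon> j (\<pi> y) [Y (\<pi> y)] *\<^sub>R b j (\<pi> y))"
  proof (intro liftable_sum liftable_scale lift)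
    fix j assume "j \<in> {..<?k}"
    then have "(\<lambda>z. \<epsilon> j z [Y z]) \<in> smooth_functions (base F)"
      using \<epsilon> Y by (intro kforms_1_eval[OF F]) auto
    then show "smooth_at (base E) x (\<lambda>y. \<epsilon> j (\<pi> y) [Y (\<pi> y)])"
      using morphism_smooth by (force simp: smooth_functions_iff[OF M])
  qed auto
  moreover have "\<forall>\<^sub>F y in nhds x. (\<Sum>j<?k. \<epsilon> j (\<pi> y) [Y (\<pi> y)] *\<^sub>R b j (\<pi> y)) = Y (\<pi> y)"
    using morphism_eventually[OF ev] by eventually_elim (rule dual_bases_vector[OF _ section_fibre[OF F Y]])
  ultimately show ?thesis by (rule liftable_cong)
qed

text \<open>The local lifts \<open>X\<^sub>n\<close> are glued with the weights \<open>g\<^sub>n (1 - g\<^sub>0) \<dots> (1 - g\<^sub>n\<^sub>-\<^sub>1)\<close>, where the bump functions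
  \<open>g\<^sub>n\<close> are \<open>1\<close> on the members of a countable open cover: near every point only finitely many weights are
  not \<open>0\<close>, and their sum telescopes to \<open>1\<close>.\<close>

lemma section_lift:
  assumes Y: "Y \<in> sections F"
  obtains X where "X \<in> sections E" "related \<Phi> \<pi> X Y"
proof -
  note M = bundle_base[OF E]
  \<comment> \<open>\<open>t\<close> packs a local lift, a bump function supported where the lift is
    correct, and an open set on which the bump function is 1.\<close>
  have "\<forall>x. \<exists>t. fst t \<in> sections E \<and> fst (snd t) \<in> smooth_functions (base E) \<and> open (snd (snd t)) \<and>
      x \<in> snd (snd t) \<and> (\<forall>y\<in>snd (snd t). fst (snd t) y = 1) \<and>
      (\<forall>y. fst (snd t) y \<noteq> 0 \<longrightarrow> \<Phi> y (fst t y) = Y (\<pi> y))"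
  proof
    fix x
    obtain X where X: "X \<in> sections E" "\<forall>\<^sub>F y in nhds x. \<Phi> y (X y) = Y (\<pi> y)"
      using liftable_section[OF Y, of x] unfolding liftable_def by blast
    then obtain W where W: "open W" "x \<in> W" "\<And>y. y \<in> W \<Longrightarrow> \<Phi> y (X y) = Y (\<pi> y)"
      by (auto simp: eventually_nhds)
    obtain g where g: "g \<in> smooth_functions (base E)" "\<forall>\<^sub>F y in nhds x. g y = 1"
      "\<And>y. y \<notin> W \<Longrightarrow> \<forall>\<^sub>F z in nhds y. g z = 0"
      using smooth_bump_exists[OF M W(1,2)] by blast
    obtain O' where O': "open O'" "x \<in> O'" "\<forall>y\<in>O'. g y = 1"
      using g(2) by (auto simp: eventually_nhds)
    have "\<Phi> y (X y) = Y (\<pi> y)" if "g y \<noteq> 0" for y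
      using W(3)[of y] g(3)[of y, THEN eventually_nhds_x_imp_x] that by blast
    with X(1) g(1) O' show "\<exists>t. fst t \<in> sections E \<and> fst (snd t) \<in> smooth_functions (base E) \<and> open (snd (snd t)) \<and>
      x \<in> snd (snd t) \<and> (\<forall>y\<in>snd (snd t). fst (snd t) y = 1) \<and>
      (\<forall>y. fst (snd t) y \<noteq> 0 \<longrightarrow> \<Phi> y (fst t y) = Y (\<pi> y))"
      by (intro exI[of _ "(X, g, O')"]) simp
  qed
  from choice[OF this] obtain t where
    t: "\<And>x. fst (t x) \<in> sections E" "\<And>x. fst (snd (t x)) \<in> smooth_functions (base E)" "\<And>x. open (snd (snd (t x)))"
      "\<And>x. x \<in> snd (snd (t x))" "\<And>x y. y \<in> snd (snd (t x)) \<Longrightarrow> fst (snd (t x)) y = 1"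
      "\<And>x y. fst (snd (t x)) y \<noteq> 0 \<Longrightarrow> \<Phi> y (fst (t x) y) = Y (\<pi> y)"
    by blast
  let ?\<O> = "\<lambda>x. snd (snd (t x))"
  obtain \<F> where \<F>: "\<F> \<subseteq> range ?\<O>" "countable \<F>" "\<Union>\<F> = \<Union>(range ?\<O>)"
    using Lindelof[of "range ?\<O>"] t(3) by blast
  have U: "\<Union>\<F> = UNIV" using \<F>(3) t(4) by blast
  then have "\<F> \<noteq> {}" by blast
  \<comment> \<open>The enumeration repeats members if the subcover is finite; this is harmless, as
    below only the covering property matters.\<close>
  then have rg: "range (from_nat_into \<F>) = \<F>" using \<F>(2) by (rule range_from_nat_into)
  have "\<forall>n. \<exists>x. ?\<O> x = from_nat_into \<F> n"
  proof
    fix n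
    have "from_nat_into \<F> n \<in> range ?\<O>"
      using from_nat_into[OF \<open>\<F> \<noteq> {}\<close>] \<F>(1) by (rule set_mp[rotated])
    then obtain x where "from_nat_into \<F> n = ?\<O> x" by (elim rangeE)
    then show "\<exists>x. ?\<O> x = from_nat_into \<F> n" by (intro exI[of _ x]) simp
  qed
  from choice[OF this] obtain s where s: "\<And>n. ?\<O> (s n) = from_nat_into \<F> n" by blast
  define Z where "Z = (\<lambda>n. fst (t (s n)))"
  define g where "g = (\<lambda>n. fst (snd (t (s n))))"
  define W where "W = (\<lambda>n. ?\<O> (s n))"
  have Z: "Z n \<in> sections E" for n using t(1) by (simp add: Z_def)
  have g: "g n \<in> smooth_functions (base E)" for n using t(2) by (simp add: g_def)
  have W: "open (W n)" "\<And>y. y \<in> W n \<Longrightarrow> g n y = 1" for n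
    using t(3,5) by (simp_all add: W_def g_def)
  have ZY: "\<Phi> y (Z n y) = Y (\<pi> y)" if "g n y \<noteq> 0" for n y
    using t(6) that by (simp add: Z_def g_def)
  have cover: "\<exists>n. y \<in> W n" for y
  proof -
    have "y \<in> \<Union>\<F>" unfolding U by simp
    then obtain T where T: "T \<in> \<F>" "y \<in> T" by (elim UnionE)
    then have "T \<in> range (from_nat_into \<F>)" by (simp only: rg)
    then obtain n where "T = from_nat_into \<F> n" by (elim rangeE)
    then have "y \<in> W n" using T(2) s[of n] by (simp add: W_def)
    then show ?thesis by (rule exI)
  qed
  define p where "p = (\<lambda>n y. \<Prod>k<n. (1 - g k y))"
  have p: "p n \<in> smooth_functions (base E)" for n
  proof (induction n)
    case 0
    show ?case by (simp add: p_def smooth_functions_const[OF M])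
  next
    case (Suc n)
    have "(\<lambda>y. p n y * (1 - g n y)) \<in> smooth_functions (base E)"
      by (intro smooth_functions_mult[OF M] smooth_functions_diff[OF M] smooth_functions_const[OF M] Suc g)
    then show ?case by (simp add: p_def)
  qed
  define S where "S = (\<lambda>n y. \<Sum>k<n. (p k y * g k y) *\<^sub>R Z k y)"
  have S: "S n \<in> sections E" for n
    unfolding S_def
    by (intro sections_sum[OF E] sections_scale[OF E] smooth_functions_mult[OF M] Z g p)
  have \<Phi>S: "\<Phi> y (S n y) = (1 - p n y) *\<^sub>R Y (\<pi> y)" for n y
  proof -
    have "\<Phi> y (S n y) = (\<Sum>k<n. (p k y * g k y) *\<^sub>R \<Phi> y (Z k y))"
      unfolding S_def by (intro morphism_sum section_fibre[OF E] Z)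
    \<comment> \<open>\<open>Z k\<close> need not lift \<open>Y\<close> where \<open>g k\<close>
      vanishes, but its weight is 0 there.\<close>
    also have "\<dots> = (\<Sum>k<n. (p k y * g k y) *\<^sub>R Y (\<pi> y))"
      using ZY by (intro sum.cong refl) (metis mult_zero_right scaleR_zero_left)
    also have "\<dots> = (\<Sum>k<n. p k y * g k y) *\<^sub>R Y (\<pi> y)"
      by (simp add: scaleR_sum_left)
    also have "(\<Sum>k<n. p k y * g k y) = 1 - p n y"
      by (induction n) (simp_all add: p_def algebra_simps)
    finally show ?thesis .
  qed
  have p0: "p n y = 0" if "y \<in> W k" "k < n" for y k n
    using W(2)[OF that(1)] that(2) unfolding p_def by (intro prod_zero) auto
  \<comment> \<open>On \<open>W k\<close> the factor \<open>1 - g k\<close> is 0, so all weights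
    with index above \<open>k\<close> vanish. As \<open>S n\<close> runs over indices below
    \<open>n\<close>, the value is reached at \<open>Suc k\<close>.\<close>
  have stable: "S n y = S (Suc k) y" if y: "y \<in> W k" and n: "Suc k \<le> n" for y k n
    unfolding S_def using n p0[OF y] by (intro sum.mono_neutral_right) auto
  define m where "m = (\<lambda>y. Suc (LEAST k. y \<in> W k))"
  define X where "X = (\<lambda>y. S (m y) y)"
  have XS: "X y = S (Suc k) y" if "y \<in> W k" for y k
  proof -
    have "y \<in> W (LEAST k. y \<in> W k)" "(LEAST k. y \<in> W k) \<le> k"
      using that by (auto intro: LeastI Least_le)
    then show ?thesis using stable[of y "LEAST k. y \<in> W k" "Suc k"] by (simp add: X_def m_def)
  qed
  have "X \<in> sections E"
    unfolding sections_iff[OF E]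
  proof
    fix x
    obtain k where k: "x \<in> W k" using cover by blast
    have "\<forall>\<^sub>F y in nhds x. S (Suc k) y = X y"
      using eventually_nhds_in_open[OF W(1) k] by (rule eventually_mono) (simp add: XS)
    moreover have "sec_at E x (S (Suc k))" using S by (simp add: sections_iff[OF E])
    ultimately show "sec_at E x X" using sec_at_cong[OF E] by blast
  qed
  moreover have "related \<Phi> \<pi> X Y"
    unfolding related_def
  proof
    fix y
    obtain k where k: "y \<in> W k" using cover by blast
    show "\<Phi> y (X y) = Y (\<pi> y)"
      using \<Phi>S[of y "Suc k"] p0[OF k, of "Suc k"] XS[OF k] by simp
  qed
  ultimately show ?thesis by (rule that)
qed

text \<open>An arbitrary section \<open>Z\<close> through \<open>v\<close> is corrected by lifts
  \<open>L j\<close> of a local frame of \<open>F\<close>, with the coordinates of its image as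
  coefficients. These vanish at \<open>x\<close> because \<open>v\<close> lies in the kernel, so the
  value at \<open>x\<close> is unchanged; a bump function makes the result vanish under \<Phi>
  everywhere.\<close>

lemma kernel_section_through:
  assumes v: "v \<in> fibre E x" "\<Phi> x v = 0"
  obtains X where "X \<in> sections E" "\<And>y. \<Phi> y (X y) = 0" "X x = v"
proof -
  let ?k = "bdl_rank F"
  note M = bundle_base[OF E]
  obtain b \<epsilon> where b: "\<And>i. i < ?k \<Longrightarrow> b i \<in> sections F" and \<epsilon>: "\<And>i. i < ?k \<Longrightarrow> \<epsilon> i \<in> kforms 1 F"
    and ev: "\<forall>\<^sub>F z in nhds (\<pi> x). dual_bases (fibre F z) ?k (\<lambda>i. b i z) (\<lambda>i. \<epsilon> i z)"
    using global_frame[OF F] by blast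
  have "\<forall>j. \<exists>X. j < ?k \<longrightarrow> X \<in> sections E \<and> related \<Phi> \<pi> X (b j)"
    using section_lift[OF b] by blast
  from choice[OF this] obtain L where L: "\<And>j. j < ?k \<Longrightarrow> L j \<in> sections E" "\<And>j y. j < ?k \<Longrightarrow> \<Phi> y (L j y) = b j (\<pi> y)"
    by (auto simp: related_def)
  obtain Z where Z: "Z \<in> sections E" "Z x = v" using section_through[OF E v(1)] by blast
  define c where "c = (\<lambda>j y. \<epsilon> j (\<pi> y) [\<Phi> y (Z y)])"
  have c: "c j \<in> smooth_functions (base E)" if "j < ?k" for j
    unfolding c_def using \<epsilon>[OF that] Z(1) by (rule pullback_pairing_smooth)
  let ?S = "\<lambda>y. \<Sum>j<?k. c j y *\<^sub>R L j y"
  have S: "?S \<in> sections E"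
    using c L(1) by (intro sections_sum[OF E] sections_scale[OF E]) auto
  have ZS: "(\<lambda>y. Z y - ?S y) \<in> sections E"
    using Z(1) S by (rule sections_diff[OF E])
  have "\<forall>\<^sub>F y in nhds x. \<Phi> y (Z y - ?S y) = 0"
    using morphism_eventually[OF ev]
  proof eventually_elim
    case (elim y)
    have "\<Phi> y (?S y) = (\<Sum>j<?k. c j y *\<^sub>R b j (\<pi> y))"
      using morphism_sum[of "{..<?k}" "\<lambda>j. L j y" y "\<lambda>j. c j y"] L(2) section_fibre[OF E L(1)] by simp
    also have "\<dots> = \<Phi> y (Z y)"
      unfolding c_def by (rule dual_bases_vector[OF elim morphism_fibre[OF section_fibre[OF E Z(1)]]])
    finally show ?case
      using morphism_diff[OF section_fibre[OF E Z(1)] section_fibre[OF E S], of y] by simp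
  qed
  then obtain W where W: "open W" "x \<in> W" "\<And>y. y \<in> W \<Longrightarrow> \<Phi> y (Z y - ?S y) = 0"
    by (auto simp: eventually_nhds)
  obtain g where g: "g \<in> smooth_functions (base E)" "\<forall>\<^sub>F y in nhds x. g y = 1"
    "\<And>y. y \<notin> W \<Longrightarrow> \<forall>\<^sub>F z in nhds y. g z = 0"
    using smooth_bump_exists[OF M W(1,2)] by blast
  have "(\<lambda>y. g y *\<^sub>R (Z y - ?S y)) \<in> sections E"
    using ZS g(1) by (rule sections_scale[OF E])
  moreover have "\<Phi> y (g y *\<^sub>R (Z y - ?S y)) = 0" for y
    using W(3)[of y] g(3)[of y, THEN eventually_nhds_x_imp_x] morphism_scale[OF section_fibre[OF E ZS], of y "g y"]
    by (cases "y \<in> W") auto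
  moreover have "g x *\<^sub>R (Z x - ?S x) = v"
  proof -
    have "c j x = 0" if "j < ?k" for j
      using alt_forms_1_zero[OF fibre_subspace[OF F] kforms_1_fibre[OF F \<epsilon>[OF that]]] v(2) Z(2) by (simp add: c_def)
    then show ?thesis using eventually_nhds_x_imp_x[OF g(2)] Z(2) by simp
  qed
  ultimately show ?thesis by (rule that)
qed

end

end

subsection \<open>Projection along a Lie algebroid epimorphism\<close>

lemma pullback_add: "pullback E \<Phi> \<pi> (\<omega> + \<eta>) = pullback E \<Phi> \<pi> \<omega> + pullback E \<Phi> \<pi> \<eta>"
  by (auto simp: pullback_def fun_eq_iff)

lemma pullback_diff: "pullback E \<Phi> \<pi> (\<omega> - \<eta>) = pullback E \<Phi> \<pi> \<omega> - pullback E \<Phi> \<pi> \<eta>"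
  by (auto simp: pullback_def fun_eq_iff)

lemma insertion_pullback:
  assumes "related \<Phi> \<pi> X Y" "\<And>x. X x \<in> fibre E x"
  shows "insertion X (pullback E \<Phi> \<pi> \<omega>) = pullback E \<Phi> \<pi> (insertion Y \<omega>)"
  using assms by (auto simp: insertion_def pullback_def related_def fun_eq_iff)

lemma differential_support: "\<not> set vs \<subseteq> fibre A x \<Longrightarrow> differential A \<omega> x vs = 0"
  by (simp add: differential_def)

lemma form_bracket_support: "\<not> set vs \<subseteq> fibre A x \<Longrightarrow> form_bracket A P \<alpha> \<beta> x vs = 0"
  by (simp add: form_bracket_def lie_derivative_def insertion_def differential_support)

lemma dual_map_support: "\<not> set vs \<subseteq> fibre A x \<Longrightarrow> dual_map A N \<omega> x vs = 0"
  by (simp add: dual_map_def pullback_def)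

text \<open>\<open>sharp\<close> at \<open>x\<close> reads its form at \<open>x\<close> only, so the
  constant family in the definition of \<open>comp_bivector\<close> may be replaced by
  \<alpha>.\<close>

lemma comp_bivector_pairing:
  assumes "\<alpha> x \<in> alt_forms 1 (fibre A x)" "b \<in> alt_forms 1 (fibre A x)"
  shows "comp_bivector A N P x [\<alpha> x, b] = b [N x (sharp A P \<alpha> x)]"
  using assms by (simp add: comp_bivector_def sharp_def One_nat_def)

lemma comp_bivector_eval:
  assumes "lie_algebroid A" "P \<in> multisections 2 A" "\<alpha> \<in> kforms 1 A" "\<beta> \<in> kforms 1 A"
  shows "comp_bivector A N P x [\<alpha> x, \<beta> x] = \<beta> x [N x (sharp A P \<alpha> x)]"
  using kforms_1_fibre[OF algebroid_bundle[OF assms(1)]] assms(3,4) by (intro comp_bivector_pairing) auto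

text \<open>The vector on the right satisfies the defining description of \<open>sharp\<close>
  directly, since pairing it with a covector is how \<open>comp_bivector\<close> is defined.\<close>

lemma sharp_comp_bivector:
  assumes "lie_algebroid A" "bundle_morphism A A N id"
    "P \<in> multisections 2 A" "\<alpha> \<in> kforms 1 A"
  shows "sharp A (comp_bivector A N P) \<alpha> = app N (sharp A P \<alpha>)"
proof
  fix x
  note AE = algebroid_bundle[OF assms(1)]
  show "sharp A (comp_bivector A N P) \<alpha> x = app N (sharp A P \<alpha>) x"
  proof (rule sharp_eqI[OF AE])
    show "app N (sharp A P \<alpha>) x \<in> fibre A x"
      using morphism_fibre[OF AE AE assms(2) section_fibre[OF AE sharp_sections[OF AE assms(3,4)]]]
      by (simp add: app_def)
    show "\<beta> [app N (sharp A P \<alpha>) x] = comp_bivector A N P x [\<alpha> x, \<beta>]"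
      if "\<beta> \<in> alt_forms 1 (fibre A x)" for \<beta>
      using comp_bivector_pairing[where \<alpha> = \<alpha> and x = x, OF kforms_1_fibre[OF AE assms(4)] that] by (simp add: app_def)
  qed
qed

context
  fixes A :: "('m::{t2_space,second_countable_topology}, 'e::real_normed_vector, 'v::real_vector) algebroid"
    and B :: "('n::{t2_space,second_countable_topology}, 'f::real_normed_vector, 'w::real_vector) algebroid"
    and \<Phi> :: "'m \<Rightarrow> 'v \<Rightarrow> 'w" and \<pi> :: "'m \<Rightarrow> 'n"
  assumes A: "lie_algebroid A" and B: "lie_algebroid B" and epi: "algebroid_epimorphism A B \<Phi> \<pi>"
begin

lemmas AE = algebroid_bundle[OF A]
lemmas BE = algebroid_bundle[OF B]

lemma epi_bundle_morphism: "bundle_morphism A B \<Phi> \<pi>"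
  using epi by (simp add: algebroid_epimorphism_def algebroid_morphism_def)

lemma epi_differential: "\<omega> \<in> kforms k B \<Longrightarrow> differential A (pullback A \<Phi> \<pi> \<omega>) = pullback A \<Phi> \<pi> (differential B \<omega>)"
  using epi by (simp add: algebroid_epimorphism_def algebroid_morphism_def)

lemma epi_onto: "\<Phi> x ` fibre A x = fibre B (\<pi> x)"
  using epi by (simp add: algebroid_epimorphism_def)

lemma epi_surj: "\<exists>x. \<pi> x = y"
proof -
  have "surj \<pi>" using epi by (simp add: algebroid_epimorphism_def)
  then show ?thesis by (metis surjD)
qed

lemmas E_fibre = morphism_fibre[OF AE BE epi_bundle_morphism]
lemmas E_pullback = pullback_kforms_1[OF AE BE epi_bundle_morphism]
lemmas E_eval = pullback_eval[OF AE BE epi_bundle_morphism]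
lemmas E_lift = section_lift[OF AE BE epi_bundle_morphism epi_onto]

text \<open>\<pi> and the fibre maps are onto, so every list in a fibre of \<open>B\<close> is the
  image of a list in a fibre of \<open>A\<close>. Lists outside the fibres are invisible to the
  pullback, whence the second hypothesis.\<close>

lemma pullback_injective:
  assumes "pullback A \<Phi> \<pi> \<omega> = pullback A \<Phi> \<pi> \<eta>"
    "\<And>y vs. \<not> set vs \<subseteq> fibre B y \<Longrightarrow> \<omega> y vs = \<eta> y vs"
  shows "\<omega> = \<eta>"
proof (intro ext)
  fix y vs
  show "\<omega> y vs = \<eta> y vs"
  proof (cases "set vs \<subseteq> fibre B y")
    case True
    obtain x where x: "\<pi> x = y" using epi_surj by blast
    have "vs \<in> lists (\<Phi> x ` fibre A x)"
      using True epi_onto[of x] x by auto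
    then obtain us where us: "us \<in> lists (fibre A x)" "vs = map (\<Phi> x) us"
      unfolding lists_image by blast
    have "pullback A \<Phi> \<pi> \<omega> x us = pullback A \<Phi> \<pi> \<eta> x us" using assms(1) by simp
    then show ?thesis using us x by (auto simp: pullback_def subset_iff split: if_splits)
  qed (rule assms(2))
qed

section \<open>Anchors, brackets and brackets of forms for related objects\<close>

lemma anchor_related:
  assumes v: "v \<in> fibre A x" and f: "f \<in> smooth_functions (base B)"
  shows "anchor A x v (\<lambda>y. f (\<pi> y)) = anchor B (\<pi> x) (\<Phi> x v) f"
proof -
  define \<omega> :: "'n \<Rightarrow> 'w list \<Rightarrow> real" where "\<omega> = (\<lambda>y vs. if vs = [] then f y else 0)"
  have "\<omega> \<in> kforms 0 B"
    using f by (simp add: kforms_0_iff[OF BE] alt_forms_0_iff \<omega>_def)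
  then have "differential A (pullback A \<Phi> \<pi> \<omega>) x [v] = pullback A \<Phi> \<pi> (differential B \<omega>) x [v]"
    by (simp add: epi_differential)
  then show ?thesis
    using v E_fibre[OF v] by (simp add: differential_0_form[OF A] differential_0_form[OF B] pullback_def \<omega>_def)
qed

text \<open>In the two Koszul expressions for the differential of a 1-form the anchor terms agree by
  \<open>anchor_related\<close>. What remains is the pairing of an arbitrary form with the two
  brackets, and forms separate the vectors of a fibre.\<close>

lemma bracket_related:
  assumes X: "X \<in> sections A" "X' \<in> sections A" and Y: "Y \<in> sections B" "Y' \<in> sections B"
    and XY: "related \<Phi> \<pi> X Y" "related \<Phi> \<pi> X' Y'"
  shows "related \<Phi> \<pi> (bracket A X X') (bracket B Y Y')"
  unfolding related_def
proof
  fix x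
  note fA = section_fibre[OF AE] and fB = section_fibre[OF BE]
  note bA = bracket_section[OF A X] and bB = bracket_section[OF B Y]
  show "\<Phi> x (bracket A X X' x) = bracket B Y Y' (\<pi> x)"
  proof (rule fibre_eqI[OF BE])
    show "\<Phi> x (bracket A X X' x) \<in> fibre B (\<pi> x)" by (intro E_fibre fA bA)
    show "bracket B Y Y' (\<pi> x) \<in> fibre B (\<pi> x)" by (intro fB bB)
    fix \<beta> assume \<beta>: "\<beta> \<in> kforms 1 B"
    have rel: "\<Phi> y (X y) = Y (\<pi> y)" "\<Phi> y (X' y) = Y' (\<pi> y)" for y
      using XY by (simp_all add: related_def)
    have "koszul_1 A (pullback A \<Phi> \<pi> \<beta>) X X' x = pullback A \<Phi> \<pi> (differential B \<beta>) x [X x, X' x]"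
      using differential_1_form[OF A E_pullback[OF \<beta>] X, of x] epi_differential[OF \<beta>] by simp
    also have "\<dots> = koszul_1 B \<beta> Y Y' (\<pi> x)"
      using differential_1_form[OF B \<beta> Y, of "\<pi> x"] fA[OF X(1)] fA[OF X(2)] rel by (simp add: pullback_def)
    finally show "\<beta> (\<pi> x) [\<Phi> x (bracket A X X' x)] = \<beta> (\<pi> x) [bracket B Y Y' (\<pi> x)]"
      using fA[OF X(1)] fA[OF X(2)] fA[OF bA]
        anchor_related[OF fA[OF X(1)] kforms_1_eval[OF BE \<beta> Y(2)]]
        anchor_related[OF fA[OF X(2)] kforms_1_eval[OF BE \<beta> Y(1)]]
      by (simp add: koszul_1_def[OF A] koszul_1_def[OF B] E_eval rel)
  qed
qed

text \<open>Only the data entering the bracket of two given forms are assumed of \<open>P\<close>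
  and \<open>Q\<close>, so that the lemma applies both to the bivectors and to their compositions
  with the endomorphisms.\<close>

lemma form_bracket_related:
  assumes \<alpha>: "\<alpha> \<in> kforms 1 B" and \<beta>: "\<beta> \<in> kforms 1 B"
    and sA: "\<And>x. sharp A P (pullback A \<Phi> \<pi> \<alpha>) x \<in> fibre A x" "\<And>x. sharp A P (pullback A \<Phi> \<pi> \<beta>) x \<in> fibre A x"
    and sB: "sharp B Q \<alpha> \<in> sections B" "sharp B Q \<beta> \<in> sections B"
    and rel: "related \<Phi> \<pi> (sharp A P (pullback A \<Phi> \<pi> \<alpha>)) (sharp B Q \<alpha>)"
      "related \<Phi> \<pi> (sharp A P (pullback A \<Phi> \<pi> \<beta>)) (sharp B Q \<beta>)"
    and val: "\<And>x. P x [pullback A \<Phi> \<pi> \<alpha> x, pullback A \<Phi> \<pi> \<beta> x] = Q (\<pi> x) [\<alpha> (\<pi> x), \<beta> (\<pi> x)]"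
    and sm: "(\<lambda>y. Q y [\<alpha> y, \<beta> y]) \<in> smooth_functions (base B)"
  shows "form_bracket A P (pullback A \<Phi> \<pi> \<alpha>) (pullback A \<Phi> \<pi> \<beta>) = pullback A \<Phi> \<pi> (form_bracket B Q \<alpha> \<beta>)"
proof -
  have ins: "insertion Y \<omega> \<in> kforms 0 B" if "Y \<in> sections B" "\<omega> \<in> kforms 1 B" for Y \<omega>
  proof -
    have "insertion Y \<omega> x vs = 0" if "vs \<noteq> []" for x vs
      using that alt_forms_support[OF kforms_1_fibre[OF BE \<open>\<omega> \<in> kforms 1 B\<close>]] by (simp add: insertion_def)
    then show ?thesis
      using kforms_1_eval[OF BE that(2,1)]
      by (simp add: kforms_0_iff[OF BE] alt_forms_0_iff insertion_def)
  qed
  have lie: "lie_derivative A X (pullback A \<Phi> \<pi> \<omega>) = pullback A \<Phi> \<pi> (lie_derivative B Y \<omega>)"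
    if "related \<Phi> \<pi> X Y" "\<And>x. X x \<in> fibre A x" "Y \<in> sections B" "\<omega> \<in> kforms 1 B" for X Y \<omega>
    by (simp add: lie_derivative_def pullback_add insertion_pullback[OF that(1,2)]
        epi_differential[OF that(4)] epi_differential[OF ins[OF that(3,4)]])
  define \<omega> :: "'n \<Rightarrow> 'w list \<Rightarrow> real" where "\<omega> = (\<lambda>x vs. if vs = [] then Q x [\<alpha> x, \<beta> x] else 0)"
  have "\<omega> \<in> kforms 0 B"
    using sm by (simp add: kforms_0_iff[OF BE] alt_forms_0_iff \<omega>_def)
  moreover have "pullback A \<Phi> \<pi> \<omega> = (\<lambda>x vs. if vs = [] then P x [pullback A \<Phi> \<pi> \<alpha> x, pullback A \<Phi> \<pi> \<beta> x] else 0)"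
  proof (intro ext)
    fix x :: 'm and vs :: "'v list"
    show "pullback A \<Phi> \<pi> \<omega> x vs = (if vs = [] then P x [pullback A \<Phi> \<pi> \<alpha> x, pullback A \<Phi> \<pi> \<beta> x] else 0)"
      by (subst pullback_def) (simp add: \<omega>_def val)
  qed
  ultimately have "differential A (\<lambda>x vs. if vs = [] then P x [pullback A \<Phi> \<pi> \<alpha> x, pullback A \<Phi> \<pi> \<beta> x] else 0) =
      pullback A \<Phi> \<pi> (differential B \<omega>)"
    using epi_differential by metis
  then show ?thesis
    unfolding form_bracket_def
    by (simp add: pullback_diff lie[OF rel(1) sA(1) sB(1) \<beta>] lie[OF rel(2) sA(2) sB(2) \<alpha>] \<omega>_def)
qed

section \<open>Projection of a bivector\<close>

context
  fixes P :: "'m \<Rightarrow> ('v list \<Rightarrow> real) list \<Rightarrow> real"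
  assumes P: "P \<in> multisections 2 A" and proj: "projectable_bivector A B \<Phi> \<pi> P"
begin

lemma sharp_projects:
  assumes "\<alpha> \<in> kforms 1 B"
  obtains Y where "Y \<in> sections B" "related \<Phi> \<pi> (sharp A P (pullback A \<Phi> \<pi> \<alpha>)) Y"
  using proj assms unfolding projectable_bivector_def projectable_sections_def by blast

text \<open>At \<open>y\<close>, two covectors are pulled back to the chosen point
  \<open>\<sigma> y\<close> and inserted into \<open>P\<close>. This is bilinear and alternating by
  construction; independence of \<sigma> and smoothness come from the section \<open>Y\<close> to
  which \<open>sharp\<close> of a pullback projects.\<close>

lemma projected_bivector_exists:
  "\<exists>Q. Q \<in> multisections 2 B \<and> (\<forall>\<alpha>\<in>kforms 1 B. related \<Phi> \<pi> (sharp A P (pullback A \<Phi> \<pi> \<alpha>)) (sharp B Q \<alpha>))"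
proof -
  define \<sigma> where "\<sigma> = (\<lambda>y. SOME x. \<pi> x = y)"
  have \<sigma>: "\<pi> (\<sigma> y) = y" for y
    unfolding \<sigma>_def using epi_surj by (rule someI_ex)
  define c where "c = (\<lambda>y a. covector (fibre A (\<sigma> y)) (\<lambda>v. a [\<Phi> (\<sigma> y) v]) :: 'v list \<Rightarrow> real)"
  have c: "c y a \<in> alt_forms 1 (fibre A (\<sigma> y))" if "a \<in> alt_forms 1 (fibre B y)" for y a
    unfolding c_def using pullback_covector_alt[OF AE BE epi_bundle_morphism, of a "\<sigma> y"] that \<sigma> by simp
  have cl: "c y (s *\<^sub>R a + t *\<^sub>R b) = s *\<^sub>R c y a + t *\<^sub>R c y b" for y s t a b
  proof
    fix vs
    show "c y (s *\<^sub>R a + t *\<^sub>R b) vs = (s *\<^sub>R c y a + t *\<^sub>R c y b) vs"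
      by (simp add: c_def covector_def scaleR_fun_def split: list.split)
  qed
  define Q where "Q = (\<lambda>y. bilinear_form (alt_forms 1 (fibre B y)) (\<lambda>a b. P (\<sigma> y) [c y a, c y b]))"
  have D: "subspace (alt_forms 1 (fibre B y))" for y
    by (rule alt_forms_1_subspace[OF fibre_subspace[OF BE]])
  have DA: "subspace (alt_forms 1 (fibre A x))" for x
    by (rule alt_forms_1_subspace[OF fibre_subspace[OF AE]])
  note PA = multisections_2_fibre[OF AE P]
  have Qalt: "Q y \<in> alt_forms 2 (alt_forms 1 (fibre B y))" for y
    unfolding Q_def
    by (rule bilinear_form_in_alt_forms[OF D])
      (simp_all only: cl c alt_forms_2_linear_1[OF DA PA] alt_forms_2_linear_2[OF DA PA] alt_forms_2_self[OF DA PA])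
  have cp: "c y (\<alpha> y) = pullback A \<Phi> \<pi> \<alpha> (\<sigma> y)" if "\<alpha> \<in> kforms 1 B" for \<alpha> y
    unfolding c_def
    using pullback_covector[OF AE BE epi_bundle_morphism, of \<alpha> "\<sigma> y"] kforms_1_fibre[OF BE that] \<sigma> by simp
  \<comment> \<open>The right-hand side no longer involves \<sigma> and is smooth in
    \<open>y\<close> when \<open>Y\<close> is a section.\<close>
  have Qv: "Q y [\<alpha> y, \<beta> y] = \<beta> y [Y y]"
    if \<alpha>: "\<alpha> \<in> kforms 1 B" and \<beta>: "\<beta> \<in> kforms 1 B" and Y: "related \<Phi> \<pi> (sharp A P (pullback A \<Phi> \<pi> \<alpha>)) Y" for \<alpha> \<beta> Y y
  proof -
    have "Q y [\<alpha> y, \<beta> y] = P (\<sigma> y) [pullback A \<Phi> \<pi> \<alpha> (\<sigma> y), pullback A \<Phi> \<pi> \<beta> (\<sigma> y)]"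
      unfolding Q_def using kforms_1_fibre[OF BE \<alpha>] kforms_1_fibre[OF BE \<beta>] by (simp add: cp[OF \<alpha>] cp[OF \<beta>])
    also have "\<dots> = pullback A \<Phi> \<pi> \<beta> (\<sigma> y) [sharp A P (pullback A \<Phi> \<pi> \<alpha>) (\<sigma> y)]"
      using sharpD(2)[OF AE P] E_pullback[OF \<alpha>] E_pullback[OF \<beta>] kforms_1_fibre[OF AE] by metis
    also have "\<dots> = \<beta> y [Y y]"
      using E_eval[OF section_fibre[OF AE sharp_sections[OF AE P E_pullback[OF \<alpha>]]]] Y \<sigma> by (simp add: related_def)
    finally show ?thesis .
  qed
  have "Q \<in> multisections 2 B"
    unfolding multisections_2_iff[OF BE]
  proof (intro conjI allI ballI Qalt)
    fix \<alpha> \<beta> assume \<alpha>: "\<alpha> \<in> kforms 1 B" and \<beta>: "\<beta> \<in> kforms 1 B"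
    obtain Y where Y: "Y \<in> sections B" "related \<Phi> \<pi> (sharp A P (pullback A \<Phi> \<pi> \<alpha>)) Y"
      using sharp_projects[OF \<alpha>] by blast
    show "(\<lambda>y. Q y [\<alpha> y, \<beta> y]) \<in> smooth_functions (base B)"
      using kforms_1_eval[OF BE \<beta> Y(1)] by (simp add: Qv[OF \<alpha> \<beta> Y(2)])
  qed
  moreover have "related \<Phi> \<pi> (sharp A P (pullback A \<Phi> \<pi> \<alpha>)) (sharp B Q \<alpha>)" if \<alpha>: "\<alpha> \<in> kforms 1 B" for \<alpha>
  proof -
    obtain Y where Y: "Y \<in> sections B" "related \<Phi> \<pi> (sharp A P (pullback A \<Phi> \<pi> \<alpha>)) Y"
      using sharp_projects[OF \<alpha>] by blast
    have "sharp B Q \<alpha> y = Y y" for y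
    proof (rule sharp_eqI[OF BE])
      show "Y y \<in> fibre B y" using Y(1) by (rule section_fibre[OF BE])
      fix b assume "b \<in> alt_forms 1 (fibre B y)"
      then obtain \<beta> where "\<beta> \<in> kforms 1 B" "\<beta> y = b" using form_through[OF BE] by blast
      then show "b [Y y] = Q y [\<alpha> y, b]" using Qv[OF \<alpha> _ Y(2), of \<beta> y] by simp
    qed
    then show ?thesis using Y(2) by (simp add: related_def)
  qed
  ultimately show ?thesis by blast
qed

text \<open>For uniqueness: relatedness and surjectivity of \<pi> determine
  \<open>sharp B Q \<alpha>\<close> at every point, and pairing it with covectors recovers
  \<open>Q\<close>.\<close>

lemma projected_bivector_props:
  shows "projected_bivector A B \<Phi> \<pi> P \<in> multisections 2 B"
    and "\<alpha> \<in> kforms 1 B \<Longrightarrow> related \<Phi> \<pi> (sharp A P (pullback A \<Phi> \<pi> \<alpha>)) (sharp B (projected_bivector A B \<Phi> \<pi> P) \<alpha>)"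
proof -
  let ?R = "\<lambda>Q. Q \<in> multisections 2 B \<and> (\<forall>\<alpha>\<in>kforms 1 B. related \<Phi> \<pi> (sharp A P (pullback A \<Phi> \<pi> \<alpha>)) (sharp B Q \<alpha>))"
  have "\<exists>!Q. ?R Q"
  proof (rule ex_ex1I[OF projected_bivector_exists])
    fix Q Q' assume Q: "?R Q" and Q': "?R Q'"
    show "Q = Q'"
    proof
      fix y
      show "Q y = Q' y"
      proof (rule alt_forms_2_eqI)
        show "Q y \<in> alt_forms 2 (alt_forms 1 (fibre B y))" "Q' y \<in> alt_forms 2 (alt_forms 1 (fibre B y))"
          using Q Q' multisections_2_fibre[OF BE] by blast+
        fix a b assume a: "a \<in> alt_forms 1 (fibre B y)" and b: "b \<in> alt_forms 1 (fibre B y)"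
        obtain \<alpha> where \<alpha>: "\<alpha> \<in> kforms 1 B" "\<alpha> y = a" using form_through[OF BE a] by blast
        obtain x where x: "\<pi> x = y" using epi_surj by blast
        have "sharp B Q \<alpha> y = sharp B Q' \<alpha> y"
          using Q Q' \<alpha>(1) x unfolding related_def by metis
        moreover have "b [sharp B Q \<alpha> y] = Q y [\<alpha> y, b]" "b [sharp B Q' \<alpha> y] = Q' y [\<alpha> y, b]"
          using Q Q' a b \<alpha>(2) by (auto intro!: sharpD(2)[OF BE])
        ultimately show "Q y [a, b] = Q' y [a, b]" using \<alpha>(2) by simp
      qed
    qed
  qed
  from theI'[OF this] have *: "?R (projected_bivector A B \<Phi> \<pi> P)"
    unfolding projected_bivector_def .
  then show "projected_bivector A B \<Phi> \<pi> P \<in> multisections 2 B"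
    "\<alpha> \<in> kforms 1 B \<Longrightarrow> related \<Phi> \<pi> (sharp A P (pullback A \<Phi> \<pi> \<alpha>)) (sharp B (projected_bivector A B \<Phi> \<pi> P) \<alpha>)"
    by blast+
qed

lemma projected_bivector_eval:
  assumes \<alpha>: "\<alpha> \<in> kforms 1 B" and \<beta>: "\<beta> \<in> kforms 1 B"
  shows "P x [pullback A \<Phi> \<pi> \<alpha> x, pullback A \<Phi> \<pi> \<beta> x] = projected_bivector A B \<Phi> \<pi> P (\<pi> x) [\<alpha> (\<pi> x), \<beta> (\<pi> x)]"
proof -
  let ?Q = "projected_bivector A B \<Phi> \<pi> P"
  have "P x [pullback A \<Phi> \<pi> \<alpha> x, pullback A \<Phi> \<pi> \<beta> x] = pullback A \<Phi> \<pi> \<beta> x [sharp A P (pullback A \<Phi> \<pi> \<alpha>) x]"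
    using sharpD(2)[OF AE P] E_pullback[OF \<alpha>] E_pullback[OF \<beta>] kforms_1_fibre[OF AE] by metis
  also have "\<dots> = \<beta> (\<pi> x) [sharp B ?Q \<alpha> (\<pi> x)]"
    using E_eval[OF section_fibre[OF AE sharp_sections[OF AE P E_pullback[OF \<alpha>]]]] projected_bivector_props(2)[OF \<alpha>]
    by (simp add: related_def)
  also have "\<dots> = ?Q (\<pi> x) [\<alpha> (\<pi> x), \<beta> (\<pi> x)]"
    using sharpD(2)[OF BE projected_bivector_props(1)] kforms_1_fibre[OF BE] \<alpha> \<beta> by metis
  finally show ?thesis .
qed

lemma projected_poisson:
  assumes "schouten_bracket A 2 P 2 P = 0"
  shows "poisson B (projected_bivector A B \<Phi> \<pi> P)"
proof -
  let ?Q = "projected_bivector A B \<Phi> \<pi> P"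
  note Q = projected_bivector_props
  have pd: "pair_defect A x (sharp A P (pullback A \<Phi> \<pi> \<alpha>)) (sharp A P (pullback A \<Phi> \<pi> \<beta>)) (pullback A \<Phi> \<pi> \<gamma>) =
      pair_defect B (\<pi> x) (sharp B ?Q \<alpha>) (sharp B ?Q \<beta>) \<gamma>"
    if \<alpha>: "\<alpha> \<in> kforms 1 B" and \<beta>: "\<beta> \<in> kforms 1 B" and \<gamma>: "\<gamma> \<in> kforms 1 B" for x \<alpha> \<beta> \<gamma>
  proof -
    note sa = sharp_sections[OF AE P E_pullback[OF \<alpha>]] and sb = sharp_sections[OF AE P E_pullback[OF \<beta>]]
    note ta = sharp_sections[OF BE Q(1) \<alpha>] and tb = sharp_sections[OF BE Q(1) \<beta>]
    have rel: "\<Phi> y (sharp A P (pullback A \<Phi> \<pi> \<theta>) y) = sharp B ?Q \<theta> (\<pi> y)" if "\<theta> \<in> kforms 1 B" for \<theta> y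
      using Q(2)[OF that] by (simp add: related_def)
    have "\<Phi> x (bracket A (sharp A P (pullback A \<Phi> \<pi> \<alpha>)) (sharp A P (pullback A \<Phi> \<pi> \<beta>)) x) =
        bracket B (sharp B ?Q \<alpha>) (sharp B ?Q \<beta>) (\<pi> x)"
      using bracket_related[OF sa sb ta tb Q(2)[OF \<alpha>] Q(2)[OF \<beta>]] by (simp add: related_def)
    then show ?thesis
      using anchor_related[OF section_fibre[OF AE sa] kforms_1_eval[OF BE \<gamma> tb]]
        section_fibre[OF AE bracket_section[OF A sa sb]] section_fibre[OF AE sb]
      by (simp add: pair_defect_def[OF A] pair_defect_def[OF B] E_eval rel[OF \<alpha>] rel[OF \<beta>])
  qed
  have "jacobiator B ?Q \<alpha> \<beta> \<gamma> y = 0"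
    if \<alpha>: "\<alpha> \<in> kforms 1 B" and \<beta>: "\<beta> \<in> kforms 1 B" and \<gamma>: "\<gamma> \<in> kforms 1 B" for y \<alpha> \<beta> \<gamma>
  proof -
    obtain x where x: "\<pi> x = y" using epi_surj by blast
    have "jacobiator A P (pullback A \<Phi> \<pi> \<alpha>) (pullback A \<Phi> \<pi> \<beta>) (pullback A \<Phi> \<pi> \<gamma>) x = 0"
      using schouten_zero_iff[OF A P] assms E_pullback[OF \<alpha>] E_pullback[OF \<beta>] E_pullback[OF \<gamma>] by blast
    then show ?thesis
      using pd[OF \<alpha> \<beta> \<gamma>, of x] pd[OF \<beta> \<gamma> \<alpha>, of x] pd[OF \<gamma> \<alpha> \<beta>, of x] x
      by (simp add: jacobiator_def[OF A] jacobiator_def[OF B])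
  qed
  then have "schouten_bracket B 2 ?Q 2 ?Q = 0"
    using schouten_zero_iff[OF B Q(1)] by blast
  with Q(1) show ?thesis by (simp add: poisson_def)
qed

end

section \<open>Projection of an endomorphism\<close>

context
  fixes N :: "'m \<Rightarrow> 'v \<Rightarrow> 'v"
  assumes N: "bundle_morphism A A N id" and projN: "projectable_endo A B \<Phi> \<pi> N"
begin

lemmas N_fibre = morphism_fibre[OF AE AE N, simplified]
lemmas N_linear = morphism_linear[OF AE AE N]
lemmas N_diff = morphism_diff[OF AE AE N]
lemmas \<Phi>_linear = morphism_linear[OF AE BE epi_bundle_morphism]
lemmas \<Phi>_diff = morphism_diff[OF AE BE epi_bundle_morphism]

text \<open>Projectability of \<open>N\<close> speaks of kernel sections only; extending a kernel
  vector to such a section makes it a statement about single vectors.\<close>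

lemma N_kernel:
  assumes "v \<in> fibre A x" "\<Phi> x v = 0"
  shows "\<Phi> x (N x v) = 0"
proof -
  obtain X where X: "X \<in> sections A" "\<And>y. \<Phi> y (X y) = 0" "X x = v"
    using kernel_section_through[OF AE BE epi_bundle_morphism epi_onto assms] by blast
  then have "X \<in> kernel_sections A \<Phi>" by (simp add: kernel_sections_def)
  then have "app N X \<in> kernel_sections A \<Phi>"
    using projN unfolding projectable_endo_def by blast
  then have "\<Phi> x (app N X x) = 0" by (simp add: kernel_sections_def)
  then show ?thesis using X(3) by (simp add: app_def)
qed

lemma N_fibrewise:
  assumes "v \<in> fibre A x" "w \<in> fibre A x" "\<Phi> x v = \<Phi> x w"
  shows "\<Phi> x (N x v) = \<Phi> x (N x w)"
proof -
  have "v - w \<in> fibre A x" using assms by (intro subspace_diff fibre_subspace[OF AE])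
  then have "\<Phi> x (N x (v - w)) = 0"
    using assms by (intro N_kernel) (simp_all add: \<Phi>_diff)
  then show ?thesis using assms by (simp add: N_diff \<Phi>_diff N_fibre)
qed

lemma N_projects:
  assumes "X \<in> sections A" "Y \<in> sections B" "related \<Phi> \<pi> X Y"
  obtains Z where "Z \<in> sections B" "related \<Phi> \<pi> (app N X) Z" "app N X \<in> sections A"
proof -
  have "X \<in> projectable_sections A B \<Phi> \<pi>"
    using assms by (auto simp: projectable_sections_def)
  then have "app N X \<in> projectable_sections A B \<Phi> \<pi>"
    using projN by (auto simp: projectable_endo_def)
  then show ?thesis using that by (auto simp: projectable_sections_def)
qed

text \<open>\<open>L\<close> is defined by choosing a point over \<open>y\<close> and a preimage
  vector at that point. The preimage is irrelevant by \<open>N_fibrewise\<close>, the point by the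
  projectability of \<open>N\<close> on sections.\<close>

lemma projected_endo_exists:
  obtains L where "bundle_morphism B B L id"
    "\<And>x v. v \<in> fibre A x \<Longrightarrow> L (\<pi> x) (\<Phi> x v) = \<Phi> x (N x v)"
proof -
  define \<sigma> where "\<sigma> = (\<lambda>y. SOME x. \<pi> x = y)"
  have \<sigma>: "\<pi> (\<sigma> y) = y" for y
    unfolding \<sigma>_def using epi_surj by (rule someI_ex)
  define u where "u = (\<lambda>y w. SOME v. v \<in> fibre A (\<sigma> y) \<and> \<Phi> (\<sigma> y) v = w)"
  have u: "u y w \<in> fibre A (\<sigma> y)" "\<Phi> (\<sigma> y) (u y w) = w" if "w \<in> fibre B y" for y w
  proof -
    have "w \<in> \<Phi> (\<sigma> y) ` fibre A (\<sigma> y)" using that by (simp only: epi_onto \<sigma>)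
    then have "\<exists>v. v \<in> fibre A (\<sigma> y) \<and> \<Phi> (\<sigma> y) v = w" by blast
    from someI_ex[OF this] show "u y w \<in> fibre A (\<sigma> y)" "\<Phi> (\<sigma> y) (u y w) = w"
      by (simp_all add: u_def)
  qed
  define L where "L = (\<lambda>y w. if w \<in> fibre B y then \<Phi> (\<sigma> y) (N (\<sigma> y) (u y w)) else 0)"
  have L0: "L y (\<Phi> (\<sigma> y) v) = \<Phi> (\<sigma> y) (N (\<sigma> y) v)" if v: "v \<in> fibre A (\<sigma> y)" for y v
  proof -
    have w: "\<Phi> (\<sigma> y) v \<in> fibre B y" using E_fibre[OF v] \<sigma> by simp
    then show ?thesis using N_fibrewise[OF u(1)[OF w] v u(2)[OF w]] by (simp add: L_def)
  qed
  \<comment> \<open>\<open>N_fibrewise\<close> compares vectors over one point \<open>x\<close>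
    only. Different points over the same \<open>y\<close> are compared here through
    \<open>Z\<close>, the common projection of \<open>app N X\<close>.\<close>
  have sec: "L (\<pi> x) (Y (\<pi> x)) = \<Phi> x (N x (X x)) \<and> L (\<pi> x) (Y (\<pi> x)) = Z (\<pi> x)"
    if X: "X \<in> sections A" "related \<Phi> \<pi> X Y" and Z: "related \<Phi> \<pi> (app N X) Z" for X Y Z x
  proof -
    have r: "\<Phi> z (X z) = Y (\<pi> z)" "\<Phi> z (N z (X z)) = Z (\<pi> z)" for z
      using X(2) Z by (simp_all add: related_def app_def)
    have "L (\<pi> x) (Y (\<pi> x)) = L (\<pi> x) (\<Phi> (\<sigma> (\<pi> x)) (X (\<sigma> (\<pi> x))))"
      by (simp add: r \<sigma>)
    also have "\<dots> = Z (\<pi> x)"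
      using L0[of "X (\<sigma> (\<pi> x))" "\<pi> x"] section_fibre[OF AE X(1)] by (simp add: r \<sigma>)
    finally show ?thesis using r by simp
  qed
  have LN: "L (\<pi> x) (\<Phi> x v) = \<Phi> x (N x v)" if v: "v \<in> fibre A x" for x v
  proof -
    obtain Y where Y: "Y \<in> sections B" "Y (\<pi> x) = \<Phi> x v"
      using section_through[OF BE E_fibre[OF v]] by blast
    obtain X where X: "X \<in> sections A" "related \<Phi> \<pi> X Y" using E_lift[OF Y(1)] by blast
    obtain Z where Z: "related \<Phi> \<pi> (app N X) Z" using N_projects[OF X(1) Y(1) X(2)] by blast
    have "\<Phi> x (X x) = \<Phi> x v" using X(2) Y(2) by (simp add: related_def)
    then show ?thesis
      using sec[OF X Z, of x] N_fibrewise[OF section_fibre[OF AE X(1)] v] Y(2) by simp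
  qed
  have lift: "\<exists>v. v \<in> fibre A (\<sigma> y) \<and> \<Phi> (\<sigma> y) v = w" if "w \<in> fibre B y" for y w
    using u[OF that] by blast
  have "bundle_morphism B B L id"
    unfolding bundle_morphism_def
  proof (intro conjI allI ballI impI)
    show "smooth_map (base B) (base B) id" by (rule smooth_map_id[OF bundle_base[OF BE]])
    show "L y w \<in> fibre B (id y)" if "w \<in> fibre B y" for y w
      using u[OF that] N_fibre E_fibre[OF N_fibre[OF u(1)[OF that]]] that by (simp add: L_def \<sigma>)
    show "L y w = 0" if "w \<notin> fibre B y" for y w using that by (simp add: L_def)
    show "L y (a *\<^sub>R w + b *\<^sub>R w') = a *\<^sub>R L y w + b *\<^sub>R L y w'"
      if w: "w \<in> fibre B y" "w' \<in> fibre B y" for y w w' a b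
    proof -
      obtain v v' where v: "v \<in> fibre A (\<sigma> y)" "\<Phi> (\<sigma> y) v = w" "v' \<in> fibre A (\<sigma> y)" "\<Phi> (\<sigma> y) v' = w'"
        using lift w by blast
      have m: "a *\<^sub>R v + b *\<^sub>R v' \<in> fibre A (\<sigma> y)"
        using v by (intro subspace_add subspace_scale fibre_subspace[OF AE])
      have "L y (a *\<^sub>R w + b *\<^sub>R w') = \<Phi> (\<sigma> y) (N (\<sigma> y) (a *\<^sub>R v + b *\<^sub>R v'))"
        using L0[OF m] by (simp add: \<Phi>_linear v)
      also have "\<dots> = a *\<^sub>R L y w + b *\<^sub>R L y w'"
        using L0[OF v(1)] L0[OF v(3)] by (simp add: v N_linear \<Phi>_linear N_fibre)
      finally show ?thesis .
    qed
    have "smooth_comb (base B) (U \<inter> V) (bdl_rank B) b (\<lambda>y. L y (e i y))"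
      if U: "(U, e) \<in> frames B" and V: "(V, b) \<in> frames B" and i: "i < bdl_rank B" for U e V b i
    proof -
      have "open (U \<inter> V)" using frameD(1)[OF BE U] frameD(1)[OF BE V] by blast
      \<comment> \<open>Near \<open>y\<close> the image of a frame element under \<open>L\<close> is
        the projection \<open>Z\<close> of a section of \<open>A\<close>, hence smooth.\<close>
      moreover have "sec_at B y (\<lambda>y. L y (e i y))" if y: "y \<in> U \<inter> V" for y
      proof -
        have "y \<in> U" using y by simp
        then obtain Y where Y: "Y \<in> sections B" "\<forall>\<^sub>F z in nhds y. Y z = e i z"
          using section_extension[OF BE sec_at_frame[OF BE U _ i]] by blast
        obtain X where X: "X \<in> sections A" "related \<Phi> \<pi> X Y" using E_lift[OF Y(1)] by blast
        obtain Z where Z: "Z \<in> sections B" "related \<Phi> \<pi> (app N X) Z" using N_projects[OF X(1) Y(1) X(2)] by blast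
        have "Z z = L z (Y z)" for z
        proof -
          obtain x where "\<pi> x = z" using epi_surj by blast
          then show ?thesis using conjunct2[OF sec[OF X Z(2), of x]] by simp
        qed
        then have Zz: "\<forall>\<^sub>F z in nhds y. Z z = L z (e i z)"
          using Y(2) by (auto elim: eventually_mono)
        have "sec_at B y Z" using Z(1) by (simp only: sections_iff[OF BE])
        from sec_at_cong[OF BE this Zz] show ?thesis .
      qed
      ultimately show ?thesis
        using smooth_comb_iff[OF BE V] by (simp add: smooth_comb_iff[OF BE V])
    qed
    then show "case p of (U, e) \<Rightarrow> \<forall>(V, b)\<in>frames B. \<forall>i<bdl_rank B.
        smooth_comb (base B) (U \<inter> id -` V) (bdl_rank B) (\<lambda>j x. b j (id x)) (\<lambda>x. L x (e i x))"
      if "p \<in> frames B" for p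
      using that by (auto simp: case_prod_unfold)
  qed
  then show ?thesis using LN that by blast
qed

text \<open>Uniqueness has two cases: a vector in the fibre extends to a section of
  \<open>B\<close>, which lifts to \<open>A\<close>; outside the fibre every bundle morphism has the
  default value 0.\<close>

lemma projected_endo_props:
  shows "bundle_morphism B B (projected_endo A B \<Phi> \<pi> N) id"
    and "v \<in> fibre A x \<Longrightarrow> projected_endo A B \<Phi> \<pi> N (\<pi> x) (\<Phi> x v) = \<Phi> x (N x v)"
proof -
  let ?R = "\<lambda>L. bundle_morphism B B L id \<and>
    (\<forall>Y\<in>sections B. \<forall>X\<in>sections A. related \<Phi> \<pi> X Y \<longrightarrow> related \<Phi> \<pi> (app N X) (app L Y))"
  obtain L where L: "bundle_morphism B B L id" "\<And>x v. v \<in> fibre A x \<Longrightarrow> L (\<pi> x) (\<Phi> x v) = \<Phi> x (N x v)"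
    using projected_endo_exists by blast
  have "related \<Phi> \<pi> (app N X) (app L Y)" if "X \<in> sections A" "related \<Phi> \<pi> X Y" for X Y
    using L(2)[OF section_fibre[OF AE that(1)]] that(2) by (simp add: related_def app_def)
  then have RL: "?R L" using L(1) by blast
  have uniq: "L' = L" if R: "?R L'" for L'
  proof (intro ext)
    fix y w
    show "L' y w = L y w"
    proof (cases "w \<in> fibre B y")
      case True
      obtain x where x: "\<pi> x = y" using epi_surj by blast
      obtain Y where Y: "Y \<in> sections B" "Y y = w" using section_through[OF BE True] by blast
      obtain X where X: "X \<in> sections A" "related \<Phi> \<pi> X Y" using E_lift[OF Y(1)] by blast
      have "related \<Phi> \<pi> (app N X) (app L' Y)" "related \<Phi> \<pi> (app N X) (app L Y)"
        using R RL Y(1) X by blast+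
      then have "app L' Y y = app L Y y" using x by (auto simp: related_def)
      then show ?thesis using Y(2) by (simp add: app_def)
    next
      case False
      then show ?thesis using R L(1) by (simp add: bundle_morphism_def)
    qed
  qed
  have "projected_endo A B \<Phi> \<pi> N = L"
    unfolding projected_endo_def by (rule the_equality[where P = ?R, OF RL uniq])
  then show "bundle_morphism B B (projected_endo A B \<Phi> \<pi> N) id"
    "v \<in> fibre A x \<Longrightarrow> projected_endo A B \<Phi> \<pi> N (\<pi> x) (\<Phi> x v) = \<Phi> x (N x v)"
    using L by simp_all
qed

lemma projected_endo_related:
  assumes "X \<in> sections A" "related \<Phi> \<pi> X Y"
  shows "related \<Phi> \<pi> (app N X) (app (projected_endo A B \<Phi> \<pi> N) Y)"
  using projected_endo_props(2)[OF section_fibre[OF AE assms(1)]] assms(2) by (simp add: related_def app_def)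

lemma projected_endo_section:
  assumes "Y \<in> sections B"
  shows "app (projected_endo A B \<Phi> \<pi> N) Y \<in> sections B"
proof -
  obtain X where X: "X \<in> sections A" "related \<Phi> \<pi> X Y" using E_lift[OF assms] by blast
  obtain Z where Z: "Z \<in> sections B" "related \<Phi> \<pi> (app N X) Z" using N_projects[OF X(1) assms X(2)] by blast
  have "app (projected_endo A B \<Phi> \<pi> N) Y y = Z y" for y
  proof -
    obtain x where "\<pi> x = y" using epi_surj by blast
    then show ?thesis using projected_endo_related[OF X] Z(2) by (auto simp: related_def)
  qed
  then have "app (projected_endo A B \<Phi> \<pi> N) Y = Z" by blast
  then show ?thesis using Z(1) by simp
qed

lemma projected_nijenhuis:
  assumes nij: "\<And>X Y. X \<in> sections A \<Longrightarrow> Y \<in> sections A \<Longrightarrow> bracket A (app N X) (app N Y) =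
       app N (bracket A (app N X) Y + bracket A X (app N Y) - app N (bracket A X Y))"
  shows "nijenhuis B (projected_endo A B \<Phi> \<pi> N)"
  unfolding nijenhuis_def
proof (intro conjI ballI projected_endo_props(1))
  let ?L = "projected_endo A B \<Phi> \<pi> N"
  fix Y Y' assume Y: "Y \<in> sections B" "Y' \<in> sections B"
  obtain X where X: "X \<in> sections A" "related \<Phi> \<pi> X Y" using E_lift[OF Y(1)] by blast
  obtain X' where X': "X' \<in> sections A" "related \<Phi> \<pi> X' Y'" using E_lift[OF Y(2)] by blast
  have NX: "app N X \<in> sections A" using N_projects[OF X(1) Y(1) X(2)] by blast
  have NX': "app N X' \<in> sections A" using N_projects[OF X'(1) Y(2) X'(2)] by blast
  note LY = projected_endo_section[OF Y(1)] projected_endo_section[OF Y(2)]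
  note r = projected_endo_related[OF X] projected_endo_related[OF X']
  have b1: "related \<Phi> \<pi> (bracket A (app N X) X') (bracket B (app ?L Y) Y')"
    by (rule bracket_related[OF NX X'(1) LY(1) Y(2) r(1) X'(2)])
  have b2: "related \<Phi> \<pi> (bracket A X (app N X')) (bracket B Y (app ?L Y'))"
    by (rule bracket_related[OF X(1) NX' Y(1) LY(2) X(2) r(2)])
  have b3: "related \<Phi> \<pi> (bracket A X X') (bracket B Y Y')"
    by (rule bracket_related[OF X(1) X'(1) Y X(2) X'(2)])
  have b4: "related \<Phi> \<pi> (bracket A (app N X) (app N X')) (bracket B (app ?L Y) (app ?L Y'))"
    by (rule bracket_related[OF NX NX' LY r])
  have N3: "app N (bracket A X X') \<in> sections A"
    using N_projects[OF bracket_section[OF A X(1) X'(1)] bracket_section[OF B Y] b3] by blast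
  note b5 = projected_endo_related[OF bracket_section[OF A X(1) X'(1)] b3]
  note s1 = bracket_section[OF A NX X'(1)] and s2 = bracket_section[OF A X(1) NX']
  let ?S = "bracket A (app N X) X' + bracket A X (app N X') - app N (bracket A X X')"
  let ?T = "bracket B (app ?L Y) Y' + bracket B Y (app ?L Y') - app ?L (bracket B Y Y')"
  have S': "(\<lambda>y. bracket A (app N X) X' y + bracket A X (app N X') y) \<in> sections A"
    using s1 s2 by (rule sections_add[OF AE])
  have S: "?S \<in> sections A"
    using sections_diff[OF AE S' N3] by (simp add: fun_diff_def plus_fun_def)
  have "related \<Phi> \<pi> ?S ?T"
    unfolding related_def
  proof
    fix x
    have "\<Phi> x (?S x) = \<Phi> x (bracket A (app N X) X' x + bracket A X (app N X') x) - \<Phi> x (app N (bracket A X X') x)"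
      using \<Phi>_diff[OF section_fibre[OF AE S'] section_fibre[OF AE N3], of x] by simp
    also have "\<dots> = ?T (\<pi> x)"
      using morphism_add[OF AE BE epi_bundle_morphism section_fibre[OF AE s1] section_fibre[OF AE s2], of x] b1 b2 b5
      by (simp add: related_def)
    finally show "\<Phi> x (?S x) = ?T (\<pi> x)" .
  qed
  note b6 = projected_endo_related[OF S this]
  show "bracket B (app ?L Y) (app ?L Y') = app ?L ?T"
  proof
    fix y
    obtain x where x: "\<pi> x = y" using epi_surj by blast
    have "\<Phi> x (bracket A (app N X) (app N X') x) = bracket B (app ?L Y) (app ?L Y') (\<pi> x)"
      using b4 unfolding related_def by blast
    moreover have "\<Phi> x (app N ?S x) = app ?L ?T (\<pi> x)"
      using b6 unfolding related_def by blast
    ultimately show "bracket B (app ?L Y) (app ?L Y') y = app ?L ?T y"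
      unfolding nij[OF X(1) X'(1)] x by simp
  qed
qed

text \<open>The transpose of the fibrewise identity between \<Phi> after \<open>N\<close> and the
  projected endomorphism after \<Phi>.\<close>

lemma pullback_dual_map:
  "pullback A \<Phi> \<pi> (dual_map B (projected_endo A B \<Phi> \<pi> N) \<omega>) = dual_map A N (pullback A \<Phi> \<pi> \<omega>)"
proof (intro ext)
  fix x vs
  show "pullback A \<Phi> \<pi> (dual_map B (projected_endo A B \<Phi> \<pi> N) \<omega>) x vs = dual_map A N (pullback A \<Phi> \<pi> \<omega>) x vs"
  proof (cases "set vs \<subseteq> fibre A x")
    case True
    then have "\<Phi> x ` set vs \<subseteq> fibre B (\<pi> x)" "N x ` set vs \<subseteq> fibre A x"
      using E_fibre N_fibre by blast+
    moreover have "\<omega> (\<pi> x) (map (projected_endo A B \<Phi> \<pi> N (\<pi> x) \<circ> \<Phi> x) vs) = \<omega> (\<pi> x) (map (\<Phi> x \<circ> N x) vs)"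
      using True projected_endo_props(2) by (intro arg_cong[where f = "\<omega> (\<pi> x)"]) auto
    ultimately show ?thesis using True by (simp add: dual_map_def pullback_def)
  qed (simp add: dual_map_def pullback_def)
qed

lemma dual_map_kforms_1: "\<alpha> \<in> kforms 1 B \<Longrightarrow> dual_map B (projected_endo A B \<Phi> \<pi> N) \<alpha> \<in> kforms 1 B"
  unfolding dual_map_def by (rule pullback_kforms_1[OF BE BE projected_endo_props(1)])

lemma projected_compatible:
  assumes P: "P \<in> multisections 2 A" and proj: "projectable_bivector A B \<Phi> \<pi> P" and comp: "compatible A P N"
  shows "compatible B (projected_bivector A B \<Phi> \<pi> P) (projected_endo A B \<Phi> \<pi> N)"
proof -
  let ?Q = "projected_bivector A B \<Phi> \<pi> P" and ?L = "projected_endo A B \<Phi> \<pi> N"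
  let ?p = "pullback A \<Phi> \<pi>"
  note Q = projected_bivector_props[OF P proj]
  note Qs = sharp_sections[OF BE Q(1)]
  have rel: "\<Phi> x (sharp A P (?p \<theta>) x) = sharp B ?Q \<theta> (\<pi> x)" if "\<theta> \<in> kforms 1 B" for \<theta> x
    using Q(2)[OF that] by (simp add: related_def)
  have Ps: "sharp A P (?p \<theta>) \<in> sections A" if "\<theta> \<in> kforms 1 B" for \<theta>
    by (intro sharp_sections[OF AE P] E_pullback that)
  have NP: "app N (sharp A P \<alpha>) = sharp A P (dual_map A N \<alpha>)" if "\<alpha> \<in> kforms 1 A" for \<alpha>
    using comp that by (simp add: compatible_def)
  \<comment> \<open>Over \<open>x\<close>, both sides are images under \<Phi> of sections of
    \<open>A\<close> attached to the pullback of \<alpha>, and these sections agree by the first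
    compatibility condition for \<open>N\<close> and \<open>P\<close>.\<close>
  have c1: "app ?L (sharp B ?Q \<alpha>) = sharp B ?Q (dual_map B ?L \<alpha>)" if \<alpha>: "\<alpha> \<in> kforms 1 B" for \<alpha>
  proof
    fix y
    obtain x where x: "\<pi> x = y" using epi_surj by blast
    have "sharp B ?Q (dual_map B ?L \<alpha>) (\<pi> x) = \<Phi> x (sharp A P (dual_map A N (?p \<alpha>)) x)"
      using rel[OF dual_map_kforms_1[OF \<alpha>], of x] by (simp add: pullback_dual_map)
    also have "\<dots> = \<Phi> x (N x (sharp A P (?p \<alpha>) x))"
      using NP[OF E_pullback[OF \<alpha>]] by (simp add: app_def fun_eq_iff)
    also have "\<dots> = ?L (\<pi> x) (\<Phi> x (sharp A P (?p \<alpha>) x))"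
      using projected_endo_props(2)[OF section_fibre[OF AE Ps[OF \<alpha>]]] by simp
    finally show "app ?L (sharp B ?Q \<alpha>) y = sharp B ?Q (dual_map B ?L \<alpha>) y"
      using rel[OF \<alpha>, of x] x by (simp add: app_def)
  qed
  note evA = comp_bivector_eval[where N = N, OF A P] and evB = comp_bivector_eval[where N = ?L, OF B Q(1)]
  note shA = sharp_comp_bivector[OF A N P] and shB = sharp_comp_bivector[OF B projected_endo_props(1) Q(1)]
  have fb: "form_bracket A P (?p \<alpha>) (?p \<beta>) = ?p (form_bracket B ?Q \<alpha> \<beta>)"
    if \<alpha>: "\<alpha> \<in> kforms 1 B" and \<beta>: "\<beta> \<in> kforms 1 B" for \<alpha> \<beta>
    using Q(1) \<alpha> \<beta>
    by (intro form_bracket_related[OF \<alpha> \<beta>] section_fibre[OF AE Ps] Qs Q(2) projected_bivector_eval[OF P proj])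
      (auto simp: multisections_2_iff[OF BE])
  \<comment> \<open>\<open>form_bracket_related\<close> is used with the composed tensors in place
    of \<open>P\<close> and \<open>Q\<close>; their \<open>sharp\<close> maps are
    \<open>app N\<close> and \<open>app ?L\<close> applied to the original ones, which are
    related.\<close>
  have fbN: "form_bracket A (comp_bivector A N P) (?p \<alpha>) (?p \<beta>) = ?p (form_bracket B (comp_bivector B ?L ?Q) \<alpha> \<beta>)"
    if \<alpha>: "\<alpha> \<in> kforms 1 B" and \<beta>: "\<beta> \<in> kforms 1 B" for \<alpha> \<beta>
  proof -
    note pa = E_pullback[OF \<alpha>] and pb = E_pullback[OF \<beta>]
    have rN: "related \<Phi> \<pi> (app N (sharp A P (?p \<theta>))) (app ?L (sharp B ?Q \<theta>))" if "\<theta> \<in> kforms 1 B" for \<theta>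
      by (rule projected_endo_related[OF Ps[OF that] Q(2)[OF that]])
    have fN: "app N (sharp A P (?p \<theta>)) x \<in> fibre A x" if "\<theta> \<in> kforms 1 B" for \<theta> x
      using N_fibre section_fibre[OF AE Ps[OF that]] by (simp add: app_def)
    have v: "comp_bivector A N P x [?p \<alpha> x, ?p \<beta> x] = comp_bivector B ?L ?Q (\<pi> x) [\<alpha> (\<pi> x), \<beta> (\<pi> x)]" for x
    proof -
      have "comp_bivector A N P x [?p \<alpha> x, ?p \<beta> x] = ?p \<beta> x [N x (sharp A P (?p \<alpha>) x)]"
        by (rule evA[OF pa pb])
      also have "\<dots> = \<beta> (\<pi> x) [\<Phi> x (N x (sharp A P (?p \<alpha>) x))]"
        by (intro E_eval N_fibre section_fibre[OF AE Ps] \<alpha>)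
      also have "\<dots> = \<beta> (\<pi> x) [?L (\<pi> x) (sharp B ?Q \<alpha> (\<pi> x))]"
        using projected_endo_props(2)[OF section_fibre[OF AE Ps[OF \<alpha>]], of x] rel[OF \<alpha>, of x] by simp
      also have "\<dots> = comp_bivector B ?L ?Q (\<pi> x) [\<alpha> (\<pi> x), \<beta> (\<pi> x)]"
        by (rule evB[OF \<alpha> \<beta>, symmetric])
      finally show ?thesis .
    qed
    have sm: "(\<lambda>y. comp_bivector B ?L ?Q y [\<alpha> y, \<beta> y]) \<in> smooth_functions (base B)"
      using kforms_1_eval[OF BE \<beta> projected_endo_section[OF Qs[OF \<alpha>]]] by (simp add: evB[OF \<alpha> \<beta>] app_def)
    show ?thesis
      by (rule form_bracket_related[where P = "comp_bivector A N P" and Q = "comp_bivector B ?L ?Q",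
            OF \<alpha> \<beta> _ _ _ _ _ _ v sm])
        (simp_all add: shA[OF pa] shA[OF pb] shB[OF \<alpha>] shB[OF \<beta>]
          fN[OF \<alpha>] fN[OF \<beta>] rN[OF \<alpha>] rN[OF \<beta>] projected_endo_section[OF Qs[OF \<alpha>]] projected_endo_section[OF Qs[OF \<beta>]])
  qed
  have c2: "form_bracket B (comp_bivector B ?L ?Q) \<alpha> \<beta> =
      form_bracket B ?Q (dual_map B ?L \<alpha>) \<beta> + form_bracket B ?Q \<alpha> (dual_map B ?L \<beta>)
      - dual_map B ?L (form_bracket B ?Q \<alpha> \<beta>)" (is "_ = ?rhs")
    if \<alpha>: "\<alpha> \<in> kforms 1 B" and \<beta>: "\<beta> \<in> kforms 1 B" for \<alpha> \<beta>
  proof (rule pullback_injective)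
    have "?p (form_bracket B (comp_bivector B ?L ?Q) \<alpha> \<beta>) =
        form_bracket A P (dual_map A N (?p \<alpha>)) (?p \<beta>) + form_bracket A P (?p \<alpha>) (dual_map A N (?p \<beta>))
        - dual_map A N (form_bracket A P (?p \<alpha>) (?p \<beta>))"
      unfolding fbN[OF \<alpha> \<beta>, symmetric]
      using comp E_pullback[OF \<alpha>] E_pullback[OF \<beta>] unfolding compatible_def by blast
    also have "\<dots> = ?p ?rhs"
      unfolding fb[OF \<alpha> \<beta>] pullback_dual_map[symmetric] fb[OF dual_map_kforms_1[OF \<alpha>] \<beta>]
        fb[OF \<alpha> dual_map_kforms_1[OF \<beta>]] pullback_add pullback_diff ..
    finally show "?p (form_bracket B (comp_bivector B ?L ?Q) \<alpha> \<beta>) = ?p ?rhs" .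
    \<comment> \<open>Off the fibres all terms have the default value 0, which supplies the part of
      the equality that the pullback cannot detect.\<close>
    show "form_bracket B (comp_bivector B ?L ?Q) \<alpha> \<beta> y vs = ?rhs y vs" if "\<not> set vs \<subseteq> fibre B y" for y vs
      using that by (simp add: form_bracket_support dual_map_support)
  qed
  show ?thesis
    unfolding compatible_def using c1 c2 by blast
qed

end

end

theorem theorem4p6:
  fixes A :: "('m::{t2_space,second_countable_topology}, 'e::real_normed_vector, 'v::real_vector) algebroid"
    and B :: "('n::{t2_space,second_countable_topology}, 'f::real_normed_vector, 'w::real_vector) algebroid"
    and \<Phi> :: "'m \<Rightarrow> 'v \<Rightarrow> 'w" and \<pi> :: "'m \<Rightarrow> 'n"
    and P :: "'m \<Rightarrow> ('v list \<Rightarrow> real) list \<Rightarrow> real" and N :: "'m \<Rightarrow> 'v \<Rightarrow> 'v"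
  assumes "lie_algebroid A" and "lie_algebroid B"
    and "algebroid_epimorphism A B \<Phi> \<pi>"
    and "poisson_nijenhuis A P N"
    and "projectable_bivector A B \<Phi> \<pi> P"
    and "projectable_endo A B \<Phi> \<pi> N"
  shows "poisson_nijenhuis B (projected_bivector A B \<Phi> \<pi> P) (projected_endo A B \<Phi> \<pi> N)"
proof -
  note epi = assms(1-3)
  have P: "P \<in> multisections 2 A" "schouten_bracket A 2 P 2 P = 0"
    and N: "nijenhuis A N" and PN: "compatible A P N"
    using assms(4) by (simp_all add: poisson_nijenhuis_def poisson_def)
  have N': "bundle_morphism A A N id" and nij: "\<And>X Y. X \<in> sections A \<Longrightarrow> Y \<in> sections A \<Longrightarrow>
      bracket A (app N X) (app N Y) = app N (bracket A (app N X) Y + bracket A X (app N Y) - app N (bracket A X Y))"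
    using N unfolding nijenhuis_def by blast+
  show ?thesis
    unfolding poisson_nijenhuis_def
    using projected_poisson[OF epi P(1) assms(5) P(2)] projected_nijenhuis[OF epi N' assms(6) nij]
      projected_compatible[OF epi N' assms(6) P(1) assms(5) PN]
    by blast
qed

end
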